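(* Let $\mathcal{X}$ be a projective, non-singular, geometrically irreducible curve of genus $g$ over $\mathbb{F}_q$, and let $P_1,\dots,P_n,Q$ be distinct rational points of $\mathcal{X}$. For $m\ge 0$ let $C_m=\{(f(P_1),\dots,f(P_n)): f\in L(mQ)\}$, let $W$ be the Weierstrass semigroup of $\mathcal{X}$ at $Q$, and let $W^*=\{0\}\cup\{m\in\mathbb{N}, m>0: C_m\neq C_{m-1}\}=\{m_1=0<m_2<\dots<m_n\}$. Suppose that the sequence of codes $C^0=\{0\}$, $C^i=C_{m_i}$ ($i=1,\dots,n$) satisfies the isometry-dual condition. Let $\{P_{i_1},\dots,P_{i_{n'}}\}\subseteq\{P_1,\dots,P_n\}$ with $2g+2<n'<n$, define $C'_m=\{(f(P_{i_1}),\dots,f(P_{i_{n'}})): f\in L(mQ)\}$ and $(W^* )'=\{0\}\cup\{m\in\mathbb{N}, m>0: C'_m\neq C'_{m-1}\}=\{m'_1=0<m'_2<\dots<m'_{n'}\}$. If the sequence $\{0\}, C'_{m'_1},C'_{m'_2},\dots,C'_{m'_{n'}}$ satisfies the isometry-dual condition, then $n-n'\in W$.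
   Context: $L(mQ)$ is the Riemann–Roch space of functions on $\mathcal{X}$ with poles only at $Q$ of order at most $m$. The Weierstrass semigroup at $Q$ is $W=\{0\}\cup\{m\in\mathbb{N}: L(mQ)\neq L((m-1)Q)\}$. For $x\in\mathbb{F}_q^N$ let $\chi_x:\mathbb{F}_q^N\to\mathbb{F}_q^N$ be the componentwise product $\chi_x(v)=x*v$; two codes $C,D\subseteq\mathbb{F}_q^N$ are $x$-isometric if $\chi_x(C)=D$. A sequence of codes $(C^i)_{i=0,\dots,N}$ in $\mathbb{F}_q^N$ satisfies the isometry-dual condition if there exists $x\in(\mathbb{F}_q^* )^N$ such that $C^i$ is $x$-isometric to $(C^{N-i})^\perp$ for all $i=0,1,\dots,N$. *)

theory Defs
  imports
    "HOL-Library.Poly_Mapping"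
    "HOL-Library.Extended_Nat"
    "HOL-Library.Cardinality"
    "HOL-Algebra.Embedded_Algebras"
    "HOL-Algebra.Algebraic_Closure_Type"
    "Jordan_Normal_Form.Matrix"
begin

section \<open>Projective varieties\<close>

text \<open>
  The base field is a type \<open>'k\<close>, its algebraic closure is \<open>'k alg_closure\<close>. The homogeneous
  coordinates are indexed by a finite type \<open>'i\<close>, so the ambient projective space has dimension
  \<open>CARD('i) - 1\<close>.
\<close>

type_synonym ('i, 'a) mpol = "('i \<Rightarrow>\<^sub>0 nat) \<Rightarrow>\<^sub>0 'a"

text \<open>A point over the algebraic closure is the set of all its homogeneous coordinate vectors.\<close>

type_synonym ('i, 'k) point = "('i \<Rightarrow> 'k alg_closure) set"

definition poly_eval :: "('i::finite, 'a::comm_semiring_1) mpol \<Rightarrow> ('i \<Rightarrow> 'a) \<Rightarrow> 'a" where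
  "poly_eval p v =
     (\<Sum>e\<in>Poly_Mapping.keys p.
        Poly_Mapping.lookup p e * (\<Prod>i\<in>UNIV. v i ^ Poly_Mapping.lookup e i))"

definition homogeneous :: "nat \<Rightarrow> ('i::finite, 'a::zero) mpol \<Rightarrow> bool" where
  "homogeneous d p \<longleftrightarrow>
     (\<forall>e\<in>Poly_Mapping.keys p. (\<Sum>i\<in>UNIV. Poly_Mapping.lookup e i) = d)"

definition base_change :: "('i, 'k::field) mpol \<Rightarrow> ('i, 'k alg_closure) mpol" where
  "base_change p = Poly_Mapping.map to_ac p"

definition proj_point :: "('i \<Rightarrow> 'k::field alg_closure) \<Rightarrow> ('i, 'k) point" where
  "proj_point v = {(\<lambda>i. c * v i) | c. c \<noteq> 0}"

definition proj_space :: "('i, 'k::field) point set" where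
  "proj_space = {proj_point v | v. v \<noteq> (\<lambda>_. 0)}"

definition zero_locus :: "('i::finite, 'k::field alg_closure) mpol set \<Rightarrow> ('i, 'k) point set" where
  "zero_locus T = {P \<in> proj_space. \<forall>F\<in>T. \<forall>v\<in>P. poly_eval F v = 0}"

definition zariski_closed :: "('i::finite, 'k::field) point set \<Rightarrow> bool" where
  "zariski_closed Z \<longleftrightarrow> (\<exists>T. (\<forall>F\<in>T. \<exists>d. homogeneous d F) \<and> Z = zero_locus T)"

definition closed_over_base :: "('i::finite, 'k::field) point set \<Rightarrow> bool" where
  "closed_over_base Z \<longleftrightarrow>
     (\<exists>T :: ('i, 'k) mpol set.
        (\<forall>F\<in>T. \<exists>d. homogeneous d F) \<and> Z = zero_locus (base_change ` T))"

text \<open>Closed sets over the algebraic closure are used, so this is geometric irreducibility.\<close>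

definition geom_irreducible :: "('i::finite, 'k::field) point set \<Rightarrow> bool" where
  "geom_irreducible Z \<longleftrightarrow>
     Z \<noteq> {} \<and>
     (\<forall>A B. zariski_closed A \<and> zariski_closed B \<and> Z = A \<union> B \<longrightarrow> Z = A \<or> Z = B)"

text \<open>The Krull dimension of the Zariski topology on \<open>V\<close>.\<close>

definition zariski_dim :: "('i::finite, 'k::field) point set \<Rightarrow> enat" where
  "zariski_dim V =
     (SUP n\<in>{n. \<exists>Z :: nat \<Rightarrow> ('i, 'k) point set.
          (\<forall>j\<le>n. zariski_closed (Z j) \<and> geom_irreducible (Z j) \<and> Z j \<subseteq> V) \<and>
          (\<forall>j<n. Z j \<subset> Z (Suc j))}. enat n)"

definition rational_points :: "('i, 'k::field) point set \<Rightarrow> ('i, 'k) point set" where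
  "rational_points V = {P \<in> V. \<exists>w :: 'i \<Rightarrow> 'k. P = proj_point (\<lambda>i. to_ac (w i))}"


section \<open>The function field over the base field\<close>

definition vanishes_at :: "('i::finite, 'k::field) point \<Rightarrow> ('i, 'k) mpol \<Rightarrow> bool" where
  "vanishes_at P F \<longleftrightarrow> (\<forall>v\<in>P. poly_eval (base_change F) v = 0)"

definition fractions :: "('i::finite, 'k::field) point set \<Rightarrow> (('i, 'k) mpol \<times> ('i, 'k) mpol) set" where
  "fractions V =
     {(G, H). (\<exists>d. homogeneous d G \<and> homogeneous d H) \<and> \<not> (\<forall>P\<in>V. vanishes_at P H)}"

definition frac_rel ::
    "('i::finite, 'k::field) point set \<Rightarrow>
     ((('i, 'k) mpol \<times> ('i, 'k) mpol) \<times> (('i, 'k) mpol \<times> ('i, 'k) mpol)) set" where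
  "frac_rel V =
     {((G, H), (G', H')). (G, H) \<in> fractions V \<and> (G', H') \<in> fractions V \<and>
        (\<forall>P\<in>V. vanishes_at P (G * H' - G' * H))}"

type_synonym ('i, 'k) ratfun = "(('i, 'k) mpol \<times> ('i, 'k) mpol) set"

definition function_field :: "('i::finite, 'k::field) point set \<Rightarrow> ('i, 'k) ratfun ring" where
  "function_field V =
     \<lparr>carrier = fractions V // frac_rel V,
      monoid.mult = (\<lambda>a b. \<Union>(G, H)\<in>a. \<Union>(G', H')\<in>b. frac_rel V `` {(G * G', H * H')}),
      one = frac_rel V `` {(1, 1)},
      zero = frac_rel V `` {(0, 1)},
      add = (\<lambda>a b. \<Union>(G, H)\<in>a. \<Union>(G', H')\<in>b. frac_rel V `` {(G * H' + G' * H, H * H')})\<rparr>"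

definition constants :: "('i::finite, 'k::field) point set \<Rightarrow> ('i, 'k) ratfun set" where
  "constants V = {frac_rel V `` {(Poly_Mapping.single 0 c, 1)} | c. True}"

text \<open>
  The local ring at \<open>P\<close> depends only on the closed point below \<open>P\<close>, i.e. on the orbit of \<open>P\<close>
  under the Galois group.
\<close>

definition local_ring :: "('i::finite, 'k::field) point set \<Rightarrow> ('i, 'k) point \<Rightarrow> ('i, 'k) ratfun ring" where
  "local_ring V P =
     function_field V
       \<lparr>carrier := {f \<in> carrier (function_field V). \<exists>(G, H)\<in>f. \<not> vanishes_at P H}\<rparr>"

definition max_ideal :: "('i::finite, 'k::field) point set \<Rightarrow> ('i, 'k) point \<Rightarrow> ('i, 'k) ratfun set" where
  "max_ideal V P =
     {f \<in> carrier (function_field V). \<exists>(G, H)\<in>f. \<not> vanishes_at P H \<and> vanishes_at P G}"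

text \<open>The value \<open>f(P)\<close>; it is meaningful only for \<open>f\<close> in the local ring at \<open>P\<close>.\<close>

definition value_at :: "('i::finite, 'k::field) ratfun \<Rightarrow> ('i, 'k) point \<Rightarrow> 'k alg_closure" where
  "value_at f P =
     (THE y. \<exists>(G, H)\<in>f. \<exists>v\<in>P. poly_eval (base_change H) v \<noteq> 0 \<and>
        y = poly_eval (base_change G) v / poly_eval (base_change H) v)"

text \<open>
  Non-singularity: the local ring at every closed point is regular, i.e. its maximal ideal is
  generated by \<open>dim V\<close> elements. Over a perfect base field this is also non-singularity over
  the algebraic closure.
\<close>

definition nonsingular :: "('i::finite, 'k::field) point set \<Rightarrow> bool" where
  "nonsingular V \<longleftrightarrow>
     (\<forall>P\<in>V. \<exists>B. finite B \<and> enat (card B) = zariski_dim V \<and>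
        B \<subseteq> carrier (local_ring V P) \<and> max_ideal V P = Idl\<^bsub>local_ring V P\<^esub> B)"

definition nonsingular_projective_curve :: "('i::finite, 'k::field) point set \<Rightarrow> bool" where
  "nonsingular_projective_curve V \<longleftrightarrow>
     closed_over_base V \<and> geom_irreducible V \<and> zariski_dim V = 1 \<and> nonsingular V"


section \<open>Divisors, Riemann--Roch spaces and the genus\<close>

definition uniformizer :: "('i::finite, 'k::field) point set \<Rightarrow> ('i, 'k) point \<Rightarrow> ('i, 'k) ratfun \<Rightarrow> bool" where
  "uniformizer V P t \<longleftrightarrow>
     t \<in> carrier (local_ring V P) \<and> max_ideal V P = Idl\<^bsub>local_ring V P\<^esub> {t}"

text \<open>The valuation at \<open>P\<close> of a nonzero rational function; its value at zero is irrelevant.\<close>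

definition ord_at :: "('i::finite, 'k::field) point set \<Rightarrow> ('i, 'k) point \<Rightarrow> ('i, 'k) ratfun \<Rightarrow> int" where
  "ord_at V P f =
     (THE z. \<exists>t u. uniformizer V P t \<and> u \<in> Units (local_ring V P) \<and>
        f = u \<otimes>\<^bsub>function_field V\<^esub> (t [^]\<^bsub>function_field V\<^esub> z))"

definition frobenius :: "('i, 'k::{field,finite}) point \<Rightarrow> ('i, 'k) point" where
  "frobenius P = (\<lambda>v i. v i ^ CARD('k)) ` P"

text \<open>
  Divisors over the base field: sums of closed points, encoded as the Frobenius-invariant divisors
  on the points over the algebraic closure. A closed point of degree \<open>d\<close> is an orbit of
  \<open>d\<close> points, so the degree is the plain sum of the coefficients.
\<close>

definition divisor :: "('i, 'k::{field,finite}) point set \<Rightarrow> (('i, 'k) point \<Rightarrow> int) \<Rightarrow> bool" where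
  "divisor V D \<longleftrightarrow>
     finite {P. D P \<noteq> 0} \<and> {P. D P \<noteq> 0} \<subseteq> V \<and> (\<forall>P\<in>V. D (frobenius P) = D P)"

definition divisor_degree :: "(('i, 'k) point \<Rightarrow> int) \<Rightarrow> int" where
  "divisor_degree D = (\<Sum>P | D P \<noteq> 0. D P)"

definition riemann_roch_space ::
    "('i::finite, 'k::field) point set \<Rightarrow> (('i, 'k) point \<Rightarrow> int) \<Rightarrow> ('i, 'k) ratfun set" where
  "riemann_roch_space V D =
     {f \<in> carrier (function_field V).
        f = \<zero>\<^bsub>function_field V\<^esub> \<or> (\<forall>P\<in>V. ord_at V P f \<ge> - D P)}"

text \<open>The genus is the maximum of \<open>deg D + 1 - \<ell>(D)\<close> over all divisors \<open>D\<close>.\<close>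

definition has_genus :: "('i::finite, 'k::{field,finite}) point set \<Rightarrow> nat \<Rightarrow> bool" where
  "has_genus V g \<longleftrightarrow>
     (let S = {divisor_degree D + 1 - int l | D l. divisor V D \<and>
                 ring.dimension (function_field V) l (constants V) (riemann_roch_space V D)}
      in int g \<in> S \<and> (\<forall>s\<in>S. s \<le> int g))"

text \<open>\<open>L(mQ)\<close>\<close>

definition L_space ::
    "('i::finite, 'k::field) point set \<Rightarrow> ('i, 'k) point \<Rightarrow> nat \<Rightarrow> ('i, 'k) ratfun set" where
  "L_space V Q m = riemann_roch_space V (\<lambda>P. if P = Q then int m else 0)"

definition weierstrass_semigroup ::
    "('i::finite, 'k::field) point set \<Rightarrow> ('i, 'k) point \<Rightarrow> nat set" where
  "weierstrass_semigroup V Q = {0} \<union> {m. 0 < m \<and> L_space V Q m \<noteq> L_space V Q (m - 1)}"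


section \<open>Codes\<close>

text \<open>
  The code \<open>C\<^sub>m\<close>. The values at rational points are elements of the algebraic closure that
  lie in the base field.
\<close>

definition one_point_code ::
    "('i::finite, 'k::field) point set \<Rightarrow> ('i, 'k) point \<Rightarrow> ('i, 'k) point list \<Rightarrow> nat \<Rightarrow> 'k vec set" where
  "one_point_code V Q Ps m =
     {c \<in> carrier_vec (length Ps). \<exists>f\<in>L_space V Q m.
        \<forall>j<length Ps. to_ac (c $ j) = value_at f (Ps ! j)}"

text \<open>The set \<open>W\<^sup>*\<close>.\<close>

definition code_jumps ::
    "('i::finite, 'k::field) point set \<Rightarrow> ('i, 'k) point \<Rightarrow> ('i, 'k) point list \<Rightarrow> nat set" where
  "code_jumps V Q Ps =
     {0} \<union> {m. 0 < m \<and> one_point_code V Q Ps m \<noteq> one_point_code V Q Ps (m - 1)}"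

definition code_sequence ::
    "('i::finite, 'k::field) point set \<Rightarrow> ('i, 'k) point \<Rightarrow> ('i, 'k) point list \<Rightarrow> (nat \<Rightarrow> nat) \<Rightarrow>
     nat \<Rightarrow> 'k vec set" where
  "code_sequence V Q Ps m i =
     (if i = 0 then {0\<^sub>v (length Ps)} else one_point_code V Q Ps (m i))"

definition dual_code :: "nat \<Rightarrow> 'k::field vec set \<Rightarrow> 'k vec set" where
  "dual_code N C = {v \<in> carrier_vec N. \<forall>c\<in>C. v \<bullet> c = 0}"

definition chi :: "'k::field vec \<Rightarrow> 'k vec \<Rightarrow> 'k vec" where
  "chi x v = vec (dim_vec x) (\<lambda>j. x $ j * v $ j)"

definition isometric_by :: "'k::field vec \<Rightarrow> 'k vec set \<Rightarrow> 'k vec set \<Rightarrow> bool" where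
  "isometric_by x C D \<longleftrightarrow> chi x ` C = D"

definition isometry_dual :: "nat \<Rightarrow> (nat \<Rightarrow> 'k::field vec set) \<Rightarrow> bool" where
  "isometry_dual N C \<longleftrightarrow>
     (\<exists>x\<in>carrier_vec N. (\<forall>j<N. x $ j \<noteq> 0) \<and>
        (\<forall>i\<le>N. isometric_by x (C i) (dual_code N (C (N - i)))))"

end

theory Submission
  imports Defs
begin

text \<open>
  Write \<open>W\<close> for the Weierstrass semigroup. If \<open>x\<close> realizes the isometry duality, the functional
  \<open>lam f = x\<^sub>1 f(P\<^sub>1) + \<dots> + x\<^sub>n f(P\<^sub>n)\<close> vanishes on products of functions from complementary members of
  the flag; it vanishes below the last jump \<open>m\<^sub>n\<close> and is nonzero on all functions of pole order exactly \<open>m\<^sub>n\<close>.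
  The genus enters only through the Riemann inequality for the divisors \<open>mQ\<close>, which says that \<open>W\<close> has at
  most \<open>g\<close> gaps (and needs \<open>L(- Q) = 0\<close>, itself a consequence of the duality). Let \<open>W\<close> have \<open>c\<close> gaps.
  Counting decompositions of \<open>m\<^sub>n\<close> in \<open>W\<close> gives \<open>m\<^sub>n \<le> n + 2c - 1\<close>. If this were strict, \<open>m\<^sub>n\<close> would be the sum of
  two elements of \<open>W\<close> below \<open>n\<close>, on which \<open>lam\<close> is forced to vanish. Hence \<open>m\<^sub>n = n + 2c - 1\<close> and the
  set of jumps is symmetric. The same holds for the smaller set of points, and comparing the two functionals
  produces a function with pole order exactly \<open>n - n'\<close>.
\<close>

section \<open>Numerical semigroups\<close>

text \<open>Classically the value n + 2g - 1 of the last jump comes from a canonical divisor of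
  degree 2g - 2. Here it comes from counting alone, and the lower bound on the number of points
  makes the count decisive: if a too small last jump had no decomposition into summands below n,
  gaps would fill at least half of each of two intervals that cover {0..<n} and meet in one point,
  which is impossible for n \<ge> 2c + 2. The term 2c is the same for both point sets, so the two
  last jumps differ by exactly n - n'. This is why n - n' bounds the order of the function that
  represents the smaller functional through the larger one, and why the order cannot drop below that
  bound. The geometric half has a different obstacle. \<open>ord_at\<close> and
  \<open>value_at\<close> are definite descriptions, so nothing can be said about orders until every
  local ring is known to carry a discrete valuation. The critical point is that no nonzero function
  is divisible by all powers of a uniformizer; it is obtained from an ascending chain condition on
  forms in the homogeneous coordinates, with Dickson's lemma behind it.\<close>

locale cofinite_semigroup =
  fixes W :: "nat set"
  assumes zero_mem: "0 \<in> W"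
    and add_mem: "a \<in> W \<Longrightarrow> b \<in> W \<Longrightarrow> a + b \<in> W"
    and finite_gaps: "finite (- W)"
begin

definition gaps :: nat where "gaps = card (- W)"

lemma card_gaps_le: "card (- W \<inter> B) \<le> gaps"
  unfolding gaps_def by (intro card_mono finite_gaps) auto

text \<open>A number \<open>a \<le> w\<close> fails to give a decomposition only if \<open>a\<close>
  or \<open>w - a\<close> is a gap, which excludes at most \<open>2 * gaps\<close> of the
  \<open>w + 1\<close> candidates.\<close>

lemma card_decompositions: "w + 1 \<le> card {a. a \<le> w \<and> a \<in> W \<and> w - a \<in> W} + 2 * gaps"
proof -
  let ?T = "{a. a \<le> w \<and> a \<in> W \<and> w - a \<in> W}"
  let ?G = "- W \<inter> {..w}"
  have fin: "finite ?T" by (rule finite_subset[of _ "{..w}"]) auto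
  have "{..w} \<subseteq> ?T \<union> (?G \<union> (\<lambda>a. w - a) ` ?G)"
  proof
    fix a assume "a \<in> {..w}"
    moreover have "a = w - (w - a)" if "a \<le> w" using that by simp
    ultimately show "a \<in> ?T \<union> (?G \<union> (\<lambda>a. w - a) ` ?G)"
      by (cases "w - a \<in> W") (auto simp del: diff_diff_cancel intro!: image_eqI[where x = "w - a"])
  qed
  then have "card {..w} \<le> card (?T \<union> (?G \<union> (\<lambda>a. w - a) ` ?G))"
    using fin by (intro card_mono) auto
  also have "\<dots> \<le> card ?T + (card ?G + card ((\<lambda>a. w - a) ` ?G))"
    by (meson card_Un_le nat_add_left_cancel_le order_trans)
  also have "\<dots> \<le> card ?T + (card ?G + card ?G)"
    by (simp add: card_image_le)
  finally show ?thesis using card_gaps_le[of "{..w}"] by simp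
qed

text \<open>If \<open>a\<close> and \<open>l - a\<close> were both in \<open>W\<close>, so would be
  their sum \<open>l\<close>. Hence the gaps up to \<open>l\<close> and their mirror images cover
  \<open>{..l}\<close>.\<close>

lemma gap_bound:
  assumes "l \<notin> W" shows "l + 1 \<le> 2 * card (- W \<inter> {..l})"
proof -
  let ?G = "- W \<inter> {..l}"
  have "a \<in> ?G \<union> (\<lambda>a. l - a) ` ?G" if "a \<le> l" for a
  proof (cases "a \<in> W")
    case True
    then have "l - a \<notin> W" using add_mem[of a "l - a"] assms that by auto
    then show ?thesis using that by (auto intro!: image_eqI[where x = "l - a"])
  qed (use that in auto)
  then have "{..l} \<subseteq> ?G \<union> (\<lambda>a. l - a) ` ?G" by auto
  then have "card {..l} \<le> card (?G \<union> (\<lambda>a. l - a) ` ?G)" by (intro card_mono) auto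
  also have "\<dots> \<le> card ?G + card ?G"
    by (meson card_Un_le card_image_le add_left_mono order_trans finite_Int finite_atMost)
  finally show ?thesis by simp
qed

text \<open>By \<open>gap_bound\<close> a gap \<open>l\<close> satisfies
  \<open>l + 1 \<le> 2 * gaps\<close>: the classical bound on the conductor.\<close>

lemma conductor: "2 * gaps \<le> l \<Longrightarrow> l \<in> W"
  using gap_bound[of l] card_gaps_le[of "{..l}"] by fastforce

text \<open>
  Otherwise \<open>l = w + 1 - N\<close> is a gap, at least half of \<open>{0..l}\<close> are gaps, and so are at least half of
  \<open>{l..<N}\<close>, which is more than \<open>gaps\<close> in total.
\<close>

lemma decomposition_below:
  assumes w: "N \<le> w" "w + 2 \<le> N + 2 * gaps" and N: "2 * gaps + 2 \<le> N"
  obtains a b where "a \<in> W" "b \<in> W" "a + b = w" "a < N" "b < N"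
proof (rule ccontr)
  assume "\<not> thesis"
  then have none: "\<And>a b. a \<in> W \<Longrightarrow> b \<in> W \<Longrightarrow> a + b = w \<Longrightarrow> a < N \<Longrightarrow> b < N \<Longrightarrow> False"
    using that by blast
  define l where "l = w + 1 - N"
  let ?H = "- W \<inter> {l..<N}"
  \<comment> \<open>\<open>N - 1\<close> and \<open>l\<close> add up to \<open>w\<close>, and
    \<open>N - 1\<close> lies beyond the conductor, so \<open>l\<close> must be the missing
    summand.\<close>
  have "N - 1 \<in> W" using N by (intro conductor) auto
  moreover have "N - 1 + l = w" "N - 1 < N" "l < N" using w N by (auto simp: l_def)
  ultimately have l: "l \<notin> W" using none by blast
  have "a \<in> ?H \<union> (\<lambda>a. w - a) ` ?H" if a: "a \<in> {l..<N}" for a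
  proof (cases "a \<in> W")
    case True
    moreover have "a + (w - a) = w" "a < N" "w - a < N" using a w N by (auto simp: l_def)
    ultimately have "w - a \<notin> W" using none by blast
    then show ?thesis using a w N
      by (auto intro!: image_eqI[where x = "w - a"] simp: l_def)
  qed (use a in auto)
  then have "{l..<N} \<subseteq> ?H \<union> (\<lambda>a. w - a) ` ?H" by auto
  then have "card {l..<N} \<le> card (?H \<union> (\<lambda>a. w - a) ` ?H)" by (intro card_mono) auto
  also have "\<dots> \<le> card ?H + card ?H"
    by (meson card_Un_le card_image_le add_left_mono order_trans finite_Int finite_atLeastLessThan)
  finally have 1: "N - l \<le> 2 * card ?H" by simp
  \<comment> \<open>Only \<open>l\<close> is counted twice, so adding the two half bounds gives
    \<open>N + 1 \<le> 2 * (gaps + 1)\<close>. This is where \<open>2 * gaps + 2 \<le> N\<close> is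
    contradicted.\<close>
  have "card (- W \<inter> {..l}) + card ?H = card (- W \<inter> {..l} \<union> ?H) + card (- W \<inter> {..l} \<inter> ?H)"
    by (intro card_Un_Int) auto
  moreover have "card (- W \<inter> {..l} \<union> ?H) \<le> gaps"
    unfolding gaps_def by (intro card_mono finite_gaps) auto
  moreover have "card (- W \<inter> {..l} \<inter> ?H) \<le> card {l}" by (intro card_mono) auto
  moreover have "l < N" using w N by (simp add: l_def)
  ultimately show False using 1 gap_bound[OF l] N by simp
qed

lemma card_below: "card (W \<inter> {..s}) + card (- W \<inter> {..s}) = s + 1"
proof -
  have "card (W \<inter> {..s}) + card (- W \<inter> {..s}) = card ((W \<inter> {..s}) \<union> (- W \<inter> {..s}))"
    by (rule card_Un_disjoint[symmetric]) auto
  also have "(W \<inter> {..s}) \<union> (- W \<inter> {..s}) = {..s}" by auto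
  finally show ?thesis by simp
qed

lemma card_below_conductor:
  assumes "2 * gaps \<le> s + 1" shows "card (W \<inter> {..s}) + gaps = s + 1"
proof -
  have "x \<in> {..s}" if "x \<notin> W" for x using conductor[of x] that assms by (cases "x \<le> s") auto
  then have "- W \<inter> {..s} = - W" by auto
  then show ?thesis using card_below[of s] by (simp add: gaps_def)
qed

end

text \<open>\<open>A\<close> models the set of jumps: its complement \<open>W - A\<close> in the
  semigroup is an ideal, since a multiple of a function vanishing at all evaluation points vanishes
  there too.\<close>

locale semigroup_ideal_complement = cofinite_semigroup +
  fixes A :: "nat set"
  assumes A_sub: "A \<subseteq> W"
    and zero_A: "0 \<in> A"
    and A_ideal: "m \<in> W \<Longrightarrow> m \<notin> A \<Longrightarrow> w \<in> W \<Longrightarrow> m + w \<notin> A"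
    and finite_A: "finite A"
begin

lemma decompositions_sub:
  assumes "w \<in> A" shows "{a. a \<le> w \<and> a \<in> W \<and> w - a \<in> W} \<subseteq> A"
proof safe
  fix a assume "a \<le> w" "a \<in> W" "w - a \<in> W"
  then show "a \<in> A" using A_ideal[of a "w - a"] assms by (cases "a \<in> A") auto
qed

text \<open>
  The order bound: decompositions of an element of the complement of the ideal stay in the complement.
\<close>

lemma A_upper:
  assumes "w \<in> A" shows "w + 1 \<le> card A + 2 * gaps"
  using card_mono[OF finite_A decompositions_sub[OF assms]] card_decompositions[of w] by simp

text \<open>Equality in the order bound forces every element of \<open>A\<close> to occur in a
  decomposition of \<open>w\<close>, and the set of summands is invariant under reflection.\<close>

lemma A_symmetric:
  assumes "w \<in> A" "w + 1 = card A + 2 * gaps" "a \<in> A"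
  shows "a \<le> w \<and> w - a \<in> A"
proof -
  let ?T = "{a. a \<le> w \<and> a \<in> W \<and> w - a \<in> W}"
  have "card A \<le> card ?T" using card_decompositions[of w] assms by simp
  then have T: "?T = A" by (intro card_seteq finite_A decompositions_sub assms)
  then have "a \<in> ?T" using assms by simp
  then have "w - a \<in> ?T" by auto
  then have "w - a \<in> A" unfolding T .
  with \<open>a \<in> ?T\<close> show ?thesis by blast
qed

lemma card_A_le: "card (A \<inter> {..s}) \<le> card (W \<inter> {..s})"
  using A_sub by (intro card_mono) auto

end

section \<open>Isometry-dual flags in a ring with a pole filtration\<close>

text \<open>
  Here \<open>L a\<close> stands for \<open>L(aQ)\<close> with \<open>a\<close> any integer, \<open>tm\<close> for multiplication, \<open>lin f c h\<close> for
  \<open>f - c h\<close>, and \<open>ev f P\<close> for \<open>f(P)\<close>. The assumption \<open>L_reduce\<close> says that \<open>Q\<close> is rational.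
\<close>

locale pole_filtration =
  fixes L :: "int \<Rightarrow> 'f set"
    and tm :: "'f \<Rightarrow> 'f \<Rightarrow> 'f"
    and lin :: "'f \<Rightarrow> 'k::field \<Rightarrow> 'f \<Rightarrow> 'f"
    and ident :: 'f
    and ev :: "'f \<Rightarrow> 'p \<Rightarrow> 'k"
    and S :: "'p set"
  assumes L_mono: "a \<le> b \<Longrightarrow> L a \<subseteq> L b"
    and L_tm: "f \<in> L a \<Longrightarrow> h \<in> L b \<Longrightarrow> tm f h \<in> L (a + b)"
    and L_tm_exact: "f \<in> L a \<Longrightarrow> f \<notin> L (a - 1) \<Longrightarrow> h \<in> L b \<Longrightarrow> h \<notin> L (b - 1) \<Longrightarrow>
      tm f h \<notin> L (a + b - 1)"
    and L_lin: "f \<in> L a \<Longrightarrow> h \<in> L a \<Longrightarrow> lin f c h \<in> L a"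
    and L_lin_cancel: "f \<in> L b \<Longrightarrow> h \<in> L a \<Longrightarrow> lin f c h \<in> L a \<Longrightarrow> f \<in> L a"
    and L_reduce: "f \<in> L a \<Longrightarrow> h \<in> L a \<Longrightarrow> h \<notin> L (a - 1) \<Longrightarrow> \<exists>c. lin f c h \<in> L (a - 1)"
    and lin_0: "f \<in> L a \<Longrightarrow> h \<in> L a \<Longrightarrow> lin f 0 h = f"
    and one_L: "ident \<in> L 0" "ident \<notin> L (- 1)"
    and ev_lin: "f \<in> L a \<Longrightarrow> h \<in> L a \<Longrightarrow> P \<in> S \<Longrightarrow> ev (lin f c h) P = ev f P - c * ev h P"
    and ev_tm: "f \<in> L a \<Longrightarrow> h \<in> L b \<Longrightarrow> P \<in> S \<Longrightarrow> ev (tm f h) P = ev f P * ev h P"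
    and ev_one: "P \<in> S \<Longrightarrow> ev ident P = 1"
    and exact_order: "f \<in> L a \<Longrightarrow> P \<in> S \<Longrightarrow> ev f P \<noteq> 0 \<Longrightarrow> \<exists>b\<le>a. f \<in> L b \<and> f \<notin> L (b - 1)"
begin

definition exact :: "int \<Rightarrow> 'f \<Rightarrow> bool" where
  "exact a f \<longleftrightarrow> f \<in> L a \<and> f \<notin> L (a - 1)"

definition orders :: "nat set" where
  "orders = {w. \<exists>f. exact (int w) f}"

definition evals :: "'p list \<Rightarrow> 'f \<Rightarrow> 'k vec" where
  "evals Ps f = vec (length Ps) (\<lambda>j. ev f (Ps ! j))"

definition code :: "'p list \<Rightarrow> nat \<Rightarrow> 'k vec set" where
  "code Ps s = evals Ps ` L (int s)"

definition jumps :: "'p list \<Rightarrow> nat set" where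
  "jumps Ps = {0} \<union> {s. 0 < s \<and> code Ps s \<noteq> code Ps (s - 1)}"

definition flag :: "'p list \<Rightarrow> (nat \<Rightarrow> nat) \<Rightarrow> nat \<Rightarrow> 'k vec set" where
  "flag Ps m i = (if i = 0 then {0\<^sub>v (length Ps)} else code Ps (m i))"

lemma exact_tm: "exact a f \<Longrightarrow> exact b h \<Longrightarrow> exact (a + b) (tm f h)"
  unfolding exact_def using L_tm[of f a h b] L_tm_exact[of f a h b] by simp

lemma exact_one: "exact 0 ident"
  unfolding exact_def using one_L by simp

lemma orders_zero: "0 \<in> orders"
  unfolding orders_def using exact_one by auto

lemma orders_add: "a \<in> orders \<Longrightarrow> b \<in> orders \<Longrightarrow> a + b \<in> orders"
  unfolding orders_def by (auto dest: exact_tm)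

lemma exact_power:
  assumes "exact a f"
  obtains u where "exact (int k * a) u" "\<And>P. P \<in> S \<Longrightarrow> ev u P = ev f P ^ k"
proof -
  have "\<exists>u. exact (int k * a) u \<and> (\<forall>P\<in>S. ev u P = ev f P ^ k)"
  proof (induction k)
    case 0 then show ?case using exact_one ev_one by auto
  next
    case (Suc k)
    then obtain u where u: "exact (int k * a) u" "\<forall>P\<in>S. ev u P = ev f P ^ k" by blast
    have "exact (int (Suc k) * a) (tm f u)"
      using exact_tm[OF assms u(1)] by (simp add: algebra_simps)
    moreover have "\<forall>P\<in>S. ev (tm f u) P = ev f P ^ Suc k"
      using ev_tm[of f a u] u assms by (auto simp: exact_def)
    ultimately show ?case by blast
  qed
  then show thesis using that by blast
qed

lemma code_mono: "s \<le> t \<Longrightarrow> code Ps s \<subseteq> code Ps t"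
  unfolding code_def by (intro image_mono L_mono) simp

lemma zero_jumps: "0 \<in> jumps Ps"
  by (simp add: jumps_def)

lemma jumps_sub: "jumps Ps \<subseteq> orders"
proof
  fix s assume s: "s \<in> jumps Ps"
  show "s \<in> orders"
  proof (cases "s = 0")
    case False
    with s have s': "0 < s" "code Ps s \<noteq> code Ps (s - 1)" by (auto simp: jumps_def)
    then have "L (int s) \<noteq> L (int s - 1)" by (auto simp: code_def of_nat_diff)
    then show ?thesis using L_mono[of "int s - 1" "int s"] by (auto simp: orders_def exact_def)
  qed (use orders_zero in simp)
qed

text \<open>As \<open>m\<close> is no jump, a function of order \<open>m\<close> has the same values
  as one of lower order; their difference \<open>f\<close> has order exactly \<open>m\<close> and
  vanishes at all points. Multiplied by some \<open>r\<close> of order \<open>w\<close>, it fills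
  the step from \<open>L (m + w - 1)\<close> to \<open>L (m + w)\<close> without enlarging the
  code.\<close>

lemma jumps_ideal:
  assumes S: "set Ps \<subseteq> S" and m: "m \<in> orders" "m \<notin> jumps Ps" and w: "w \<in> orders"
  shows "m + w \<notin> jumps Ps"
proof -
  have m0: "m > 0" using m zero_jumps[of Ps] by (cases m) auto
  with m have eq: "code Ps m = code Ps (m - 1)" by (auto simp: jumps_def)
  obtain h where h: "exact (int m) h" using m by (auto simp: orders_def)
  then have "evals Ps h \<in> code Ps m" by (auto simp: code_def exact_def)
  then have "evals Ps h \<in> code Ps (m - 1)" by (simp only: eq)
  then obtain h' where h': "h' \<in> L (int m - 1)" "evals Ps h = evals Ps h'"
    using m0 by (auto simp: code_def of_nat_diff)
  have h'm: "h' \<in> L (int m)" using h' L_mono[of "int m - 1" "int m"] by auto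
  have hm: "h \<in> L (int m)" "h \<notin> L (int m - 1)" using h by (auto simp: exact_def)
  define f where "f = lin h 1 h'"
  have f: "exact (int m) f"
    using L_lin[OF hm(1) h'm] L_lin_cancel[OF hm(1) h'(1)] hm by (auto simp: exact_def f_def)
  have ev_nth: "P \<in> S \<and> ev h P = ev h' P" if "P \<in> set Ps" for P
  proof -
    obtain j where "j < length Ps" "P = Ps ! j" using \<open>P \<in> set Ps\<close> by (auto simp: in_set_conv_nth)
    then show ?thesis using h'(2) S that by (auto simp: evals_def vec_eq_iff)
  qed
  then have evf: "ev f P = 0" if "P \<in> set Ps" for P
    using ev_lin[OF hm(1) h'm] that by (auto simp: f_def)
  obtain r where r: "exact (int w) r" using w by (auto simp: orders_def)
  have fr: "exact (int m + int w) (tm f r)" by (rule exact_tm[OF f r])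
  have evfr: "ev (tm f r) P = 0" if "P \<in> set Ps" for P
    using ev_tm[of f "int m" r "int w" P] f r evf[OF that] S that by (auto simp: exact_def)
  have "code Ps (m + w) \<subseteq> code Ps (m + w - 1)"
  proof
    fix v assume "v \<in> code Ps (m + w)"
    then obtain k where k: "k \<in> L (int m + int w)" "v = evals Ps k" by (auto simp: code_def)
    have frL: "tm f r \<in> L (int m + int w)" "tm f r \<notin> L (int m + int w - 1)"
      using fr by (auto simp: exact_def)
    obtain c where c: "lin k c (tm f r) \<in> L (int m + int w - 1)"
      using L_reduce[OF k(1) frL] by blast
    have "evals Ps (lin k c (tm f r)) = v"
      using evfr ev_lin[OF k(1) frL(1)] S by (auto simp: evals_def k vec_eq_iff subset_iff)
    then show "v \<in> code Ps (m + w - 1)" using c m0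
      by (auto simp: code_def of_nat_diff intro!: image_eqI[where x = "lin k c (tm f r)"])
  qed
  then show ?thesis using m0 code_mono[of "m + w - 1" "m + w" Ps] by (auto simp: jumps_def)
qed

end

section \<open>The functional attached to an isometry-dual flag\<close>

locale isometry_dual_flag = pole_filtration L tm lin ident ev S
  for L :: "int \<Rightarrow> 'f set" and tm and lin :: "'f \<Rightarrow> 'k::field \<Rightarrow> 'f \<Rightarrow> 'f" and ident
    and ev :: "'f \<Rightarrow> 'p \<Rightarrow> 'k" and S +
  fixes Ps :: "'p list" and n :: nat and m :: "nat \<Rightarrow> nat" and x :: "'k vec"
  assumes Ps_S: "set Ps \<subseteq> S" and n: "length Ps = n" "2 \<le> n"
    and m_mono: "strict_mono_on {1..n} m"
    and m_image: "m ` {1..n} = jumps Ps"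
    and x_carrier: "x \<in> carrier_vec n"
    and x_nz: "j < n \<Longrightarrow> x $ j \<noteq> 0"
    and isometric: "i \<le> n \<Longrightarrow> isometric_by x (flag Ps m i) (dual_code n (flag Ps m (n - i)))"
begin

lemma finite_jumps: "finite (jumps Ps)"
  using m_image by (metis finite_atLeastAtMost finite_imageI)

lemma card_jumps: "card (jumps Ps) = n"
  using m_image m_mono by (metis card_atLeastAtMost card_image diff_Suc_1' One_nat_def strict_mono_on_imp_inj_on)

text \<open>Plays the part of the dimension of \<open>code Ps s\<close>: it is the index at which
  this code stands in the flag.\<close>

definition cnt :: "nat \<Rightarrow> nat" where "cnt s = card (jumps Ps \<inter> {..s})"

definition last_jump :: nat where "last_jump = m n"

definition lam :: "'f \<Rightarrow> 'k" where "lam f = (\<Sum>j<n. x $ j * ev f (Ps ! j))"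

lemma m_le: "i \<in> {1..n} \<Longrightarrow> j \<in> {1..n} \<Longrightarrow> m i \<le> m j \<longleftrightarrow> i \<le> j"
  using strict_mono_on_leD[OF m_mono] strict_mono_onD[OF m_mono] by (meson leD leI)

text \<open>The codes are constant between consecutive jumps, so \<open>code Ps s\<close> agrees
  with the code at the largest jump up to \<open>s\<close>, whose index is the number of jumps up to
  \<open>s\<close>.\<close>

lemma cnt_props: "1 \<le> cnt s \<and> cnt s \<le> n \<and> code Ps s = code Ps (m (cnt s))"
proof -
  define J where "J = {j \<in> {1..n}. m j \<le> s}"
  have "0 \<in> m ` {1..n}" using m_image zero_jumps by simp
  then have ne: "J \<noteq> {}" unfolding J_def by force
  have fin: "finite J" by (simp add: J_def)
  define k where "k = Max J"
  have kJ: "k \<in> J" using ne fin by (simp add: k_def)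
  then have k: "1 \<le> k" "k \<le> n" "m k \<le> s" by (auto simp: J_def)
  have J: "J = {1..k}"
  proof (intro equalityI subsetI)
    fix j assume "j \<in> J"
    then show "j \<in> {1..k}" using Max_ge[OF fin] by (auto simp: k_def J_def)
  next
    fix j assume "j \<in> {1..k}"
    then show "j \<in> J" using k m_le[of j k] by (auto simp: J_def)
  qed
  have "jumps Ps \<inter> {..s} = m ` J" unfolding m_image[symmetric] by (auto simp: J_def)
  moreover have "card (m ` J) = card J"
    by (intro card_image inj_on_subset[OF strict_mono_on_imp_inj_on[OF m_mono]]) (auto simp: J_def)
  ultimately have cnt: "cnt s = k" by (simp add: cnt_def J)
  have "code Ps t = code Ps (m k)" if "m k \<le> t" "t \<le> s" for t
    using that
  proof (induction t rule: dec_induct)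
    case (step t)
    have "Suc t \<notin> jumps Ps"
    proof
      assume "Suc t \<in> jumps Ps"
      then obtain j where j: "j \<in> {1..n}" "Suc t = m j" using m_image by blast
      then have "j \<in> J" using step.prems by (simp add: J_def)
      then have "m j \<le> m k" using m_le[of j k] k by (auto simp: J)
      then show False using j step.hyps by simp
    qed
    then show ?case using step by (auto simp: jumps_def)
  qed simp
  from this[of s] show ?thesis using k cnt by simp
qed

lemma evals_carrier: "evals Ps f \<in> carrier_vec n"
  by (simp add: evals_def n)

lemma chi_scalar:
  "v \<in> carrier_vec n \<Longrightarrow> chi x u \<bullet> v = (\<Sum>j<n. x $ j * u $ j * v $ j)"
  using x_carrier by (auto simp: chi_def scalar_prod_def lessThan_atLeast0)

lemma ev_nth_S: "j < n \<Longrightarrow> Ps ! j \<in> S"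
  using Ps_S n by auto

text \<open>The isometry at index \<open>cnt s\<close> puts \<open>chi x (evals Ps f)\<close> into
  the dual of the member with index \<open>n - cnt s\<close>, and that member contains
  \<open>evals Ps h\<close>.\<close>

lemma lam_tm_zero:
  assumes "f \<in> L (int s)" "h \<in> L (int t)" "cnt s + cnt t \<le> n"
  shows "lam (tm f h) = 0"
proof -
  let ?i = "cnt s"
  have i: "?i \<le> n" "1 \<le> ?i" "1 \<le> cnt t" using cnt_props by auto
  have "evals Ps f \<in> flag Ps m ?i" using assms(1) cnt_props[of s] by (auto simp: flag_def code_def)
  then have d: "chi x (evals Ps f) \<in> dual_code n (flag Ps m (n - ?i))"
    using isometric[OF i(1)] by (auto simp: isometric_by_def)
  have "m (cnt t) \<le> m (n - ?i)" using assms(3) i m_le[of "cnt t" "n - cnt s"] by auto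
  then have "code Ps (m (cnt t)) \<subseteq> code Ps (m (n - ?i))" by (rule code_mono)
  moreover have "evals Ps h \<in> code Ps (m (cnt t))" using assms(2) cnt_props[of t] by (auto simp: code_def)
  ultimately have "evals Ps h \<in> flag Ps m (n - ?i)" using assms(3) i by (auto simp: flag_def)
  then have "chi x (evals Ps f) \<bullet> evals Ps h = 0" using d by (auto simp: dual_code_def)
  then have "0 = (\<Sum>j<n. x $ j * ev f (Ps ! j) * ev h (Ps ! j))"
    by (simp add: chi_scalar[OF evals_carrier]) (simp add: evals_def n)
  also have "\<dots> = lam (tm f h)"
    unfolding lam_def using ev_tm[OF assms(1,2)] ev_nth_S by (intro sum.cong) (auto simp: mult.assoc)
  finally show ?thesis by simp
qed

text \<open>The surjective half of the isometry: every vector orthogonal to \<open>code Ps s\<close>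
  comes from a function. It later turns the weights of the smaller flag into a function on the
  curve.\<close>

lemma dual_representation:
  fixes v :: "'k vec"
  assumes "cnt s + cnt t = n" "v \<in> carrier_vec n"
    and "\<And>h. h \<in> L (int s) \<Longrightarrow> (\<Sum>j<n. v $ j * ev h (Ps ! j)) = 0"
  obtains f where "f \<in> L (int t)" "\<And>j. j < n \<Longrightarrow> v $ j = x $ j * ev f (Ps ! j)"
proof -
  have i: "1 \<le> cnt t" "cnt t \<le> n" "1 \<le> cnt s" "n - cnt t = cnt s" using cnt_props assms(1) by auto
  have "v \<in> dual_code n (code Ps s)"
    using assms(2,3) evals_carrier
    by (auto simp: dual_code_def code_def scalar_prod_def evals_def n lessThan_atLeast0)
  also have "code Ps s = flag Ps m (n - cnt t)" using i cnt_props[of s] by (auto simp: flag_def)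
  finally have "v \<in> chi x ` flag Ps m (cnt t)" using isometric[OF i(2)] by (simp add: isometric_by_def)
  also have "flag Ps m (cnt t) = code Ps t" using i cnt_props[of t] by (auto simp: flag_def)
  finally obtain f where "f \<in> L (int t)" "v = chi x (evals Ps f)" by (auto simp: code_def)
  then show thesis using that x_carrier by (auto simp: chi_def evals_def n)
qed

lemma top_mem: "last_jump \<in> jumps Ps" "s \<in> jumps Ps \<Longrightarrow> s \<le> last_jump"
proof -
  show "last_jump \<in> jumps Ps" unfolding m_image[symmetric] last_jump_def using n(2) by auto
  assume "s \<in> jumps Ps"
  then obtain j where "j \<in> {1..n}" "s = m j" unfolding m_image[symmetric] by auto
  then show "s \<le> last_jump" using m_le[of j n] by (auto simp: last_jump_def)
qed

lemma top_pos: "0 < last_jump"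
proof (rule ccontr)
  assume "\<not> 0 < last_jump"
  then have "jumps Ps \<subseteq> {0}" using top_mem(2) by fastforce
  then have "card (jumps Ps) \<le> card {0::nat}" by (intro card_mono) auto
  then show False using card_jumps n by simp
qed

text \<open>At index \<open>n\<close> the isometry identifies the last code with the dual of the
  zero code, which is the whole space; since \<open>x\<close> has no zero entry,
  \<open>chi x\<close> can be cancelled.\<close>

lemma surjective:
  fixes y :: "'k vec"
  assumes "y \<in> carrier_vec n"
  obtains f where "f \<in> L (int last_jump)" "\<And>j. j < n \<Longrightarrow> ev f (Ps ! j) = y $ j"
proof -
  have "chi x ` code Ps last_jump = dual_code n {0\<^sub>v n}"
    using isometric[of n] n(2) by (simp add: isometric_by_def flag_def last_jump_def n(1))
  also have "\<dots> = carrier_vec n" by (auto simp: dual_code_def)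
  finally have "chi x y \<in> chi x ` code Ps last_jump" using x_carrier by (auto simp: chi_def)
  then obtain f where f: "f \<in> L (int last_jump)" "chi x y = chi x (evals Ps f)" by (auto simp: code_def)
  have "ev f (Ps ! j) = y $ j" if "j < n" for j
  proof -
    have "chi x y $ j = chi x (evals Ps f) $ j" using f by simp
    then show ?thesis using that x_carrier x_nz[OF that] by (simp add: chi_def evals_def n)
  qed
  then show thesis using that f by blast
qed

text \<open>Write \<open>f\<close> as \<open>f\<close> times one: one has index
  \<open>cnt 0 = 1\<close>, and below the last jump the index of \<open>f\<close> is at most
  \<open>n - 1\<close>.\<close>

lemma lam_below_top:
  assumes "f \<in> L (int last_jump - 1)" shows "lam f = 0"
proof -
  have f: "f \<in> L (int (last_jump - 1))" using assms top_pos by (simp add: of_nat_diff)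
  have "jumps Ps \<inter> {..last_jump - 1} \<subset> jumps Ps" using top_mem top_pos by force
  then have "cnt (last_jump - 1) < n" using psubset_card_mono[OF finite_jumps] by (simp add: cnt_def card_jumps)
  moreover have "jumps Ps \<inter> {..0} = {0}" using zero_jumps by auto
  then have "cnt 0 = 1" by (simp add: cnt_def)
  ultimately have "lam (tm f ident) = 0" using one_L by (intro lam_tm_zero[OF f, of _ 0]) auto
  moreover have "lam (tm f ident) = lam f"
    unfolding lam_def using ev_tm[OF f one_L(1)] ev_one ev_nth_S by (intro sum.cong) auto
  ultimately show ?thesis by simp
qed

lemma lam_lin:
  assumes "f \<in> L a" "h \<in> L a" shows "lam (lin f c h) = lam f - c * lam h"
proof -
  have "lam (lin f c h) = (\<Sum>j<n. x $ j * ev f (Ps ! j) - c * (x $ j * ev h (Ps ! j)))"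
    unfolding lam_def
  proof (rule sum.cong)
    fix j assume "j \<in> {..<n}"
    then have "ev (lin f c h) (Ps ! j) = ev f (Ps ! j) - c * ev h (Ps ! j)"
      using ev_lin[OF assms] ev_nth_S by simp
    then show "x $ j * ev (lin f c h) (Ps ! j) = x $ j * ev f (Ps ! j) - c * (x $ j * ev h (Ps ! j))"
      by (simp only: right_diff_distrib mult.left_commute)
  qed simp
  then show ?thesis by (simp add: sum_subtractf lam_def sum_distrib_left)
qed

text \<open>By surjectivity \<open>lam\<close> is nonzero somewhere on \<open>L last_jump\<close>.
  There every function is a multiple of \<open>f\<close> plus one of lower order, on which
  \<open>lam\<close> vanishes, so \<open>lam f = 0\<close> would make \<open>lam\<close> vanish on
  all of it.\<close>

lemma lam_exact_top:
  assumes "exact (int last_jump) f" shows "lam f \<noteq> 0"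
proof
  assume 0: "lam f = 0"
  obtain f0 where f0: "f0 \<in> L (int last_jump)" "\<And>j. j < n \<Longrightarrow> ev f0 (Ps ! j) = unit_vec n 0 $ j"
    using surjective[of "unit_vec n 0"] by auto
  have "lam f0 = (\<Sum>j<n. if j = 0 then x $ 0 else 0)"
    unfolding lam_def using f0(2) n(2) by (intro sum.cong) (auto simp: unit_vec_def)
  then have "lam f0 \<noteq> 0" using x_nz[of 0] n(2) by simp
  moreover obtain c where "lin f0 c f \<in> L (int last_jump - 1)"
    using L_reduce[OF f0(1)] assms by (auto simp: exact_def)
  then have "lam (lin f0 c f) = 0" by (rule lam_below_top)
  ultimately show False using lam_lin[OF f0(1), of f c] assms 0 by (auto simp: exact_def)
qed

text \<open>A factor with the values of the \<open>j\<close>-th unit vector isolates the term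
  \<open>x $ j * ev f (Ps ! j)\<close> of \<open>lam\<close>, and the zero of \<open>f\<close> at
  \<open>Q\<close> keeps the product below the last jump.\<close>

lemma negative_vanishes:
  assumes f: "f \<in> L (- 1)" and j: "j < n" shows "ev f (Ps ! j) = 0"
proof -
  obtain k where k: "k \<in> L (int last_jump)" "\<And>i. i < n \<Longrightarrow> ev k (Ps ! i) = unit_vec n j $ i"
    using surjective[of "unit_vec n j"] by auto
  have "tm f k \<in> L (int last_jump - 1)" using L_tm[OF f k(1)] by simp
  then have "0 = lam (tm f k)" using lam_below_top by simp
  also have "\<dots> = (\<Sum>i<n. if i = j then x $ j * ev f (Ps ! j) else 0)"
    unfolding lam_def using k(2) ev_tm[OF f k(1)] ev_nth_S j
    by (intro sum.cong) (auto simp: unit_vec_def)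
  finally show ?thesis using x_nz[OF j] j by simp
qed

text \<open>
  Functions in \<open>L (- 1)\<close> vanish at all evaluation points because \<open>lam\<close> does on their multiples. If \<open>f\<close>
  were one with a zero at \<open>Q\<close>, a product of powers of \<open>f\<close> and of a function with a pole at \<open>Q\<close> would have order
  zero and minus its value at \<open>Q\<close> again lie in \<open>L (- 1)\<close>, although it does not vanish at the evaluation points.
\<close>

lemma exact_nonneg:
  assumes "exact a f" shows "0 \<le> a"
proof (rule ccontr)
  assume a: "\<not> 0 \<le> a"
  define e where "e = nat (- a)"
  have e: "int e = - a" "0 < e" using a by (auto simp: e_def)
  have "f \<in> L (- 1)" using assms L_mono[of a "- 1"] a by (auto simp: exact_def)
  then have f0: "ev f (Ps ! 0) = 0" using negative_vanishes n(2) by simp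
  obtain h where h: "exact (int last_jump) h" using top_mem(1) jumps_sub by (auto simp: orders_def)
  \<comment> \<open>The exponents \<open>last_jump\<close> for \<open>f\<close> and \<open>e\<close>
    for \<open>h\<close> make the orders cancel; \<open>last_jump > 0\<close> keeps the zero of
    \<open>f\<close> at the first point.\<close>
  obtain f' where f': "exact (int last_jump * a) f'" "\<And>P. P \<in> S \<Longrightarrow> ev f' P = ev f P ^ last_jump"
    using exact_power[OF assms] by blast
  obtain h' where h': "exact (int e * int last_jump) h'" using exact_power[OF h] by blast
  define u where "u = tm f' h'"
  have u: "exact 0 u" using exact_tm[OF f'(1) h'] e by (simp add: u_def algebra_simps)
  have X0: "Ps ! 0 \<in> S" using ev_nth_S n(2) by simp
  have evu: "ev u (Ps ! 0) = 0"
    using ev_tm[of f' _ h' _ "Ps ! 0"] f' h' X0 f0 top_pos by (auto simp: u_def exact_def)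
  have uL: "u \<in> L 0" "u \<notin> L (- 1)" using u by (auto simp: exact_def)
  obtain c where c: "lin u c ident \<in> L (- 1)" using L_reduce[OF uL(1) one_L(1)] one_L by auto
  then have "ev (lin u c ident) (Ps ! 0) = 0" using negative_vanishes n(2) by simp
  \<comment> \<open>At the first point \<open>u\<close> is zero and the constant is one, so
    vanishing there forces \<open>c = 0\<close>; then \<open>u\<close> itself would lie in
    \<open>L (- 1)\<close>.\<close>
  then have "c = 0" using ev_lin[OF uL(1) one_L(1) X0] evu ev_one[OF X0] by simp
  then show False using c uL lin_0[OF uL(1) one_L(1)] by simp
qed

end

text \<open>Kept separate because finiteness of the gaps is derived from the genus only after
  \<open>exact_nonneg\<close> has been applied to the flag.\<close>

locale finite_gap_flag = isometry_dual_flag +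
  assumes gaps_finite: "finite (- orders)"
begin

sublocale semigroup_ideal_complement orders "jumps Ps"
  by unfold_locales
    (auto intro: orders_zero orders_add gaps_finite zero_jumps finite_jumps
      dest: jumps_ideal[OF Ps_S] subsetD[OF jumps_sub])

lemma cnt_le: "cnt s \<le> card (orders \<inter> {..s})"
  unfolding cnt_def by (rule card_A_le)

text \<open>\<open>cnt s\<close> is at most the number of orders up to \<open>s\<close>, which is
  \<open>s + 1 - gaps\<close> from \<open>2 * gaps - 1\<close> on. If both arguments are that large,
  the hypothesis on \<open>a + b\<close> is what is needed; otherwise the bounds at
  \<open>2 * gaps - 1\<close> and \<open>n - 1\<close> are \<open>gaps\<close> and
  \<open>n - gaps\<close>.\<close>

lemma cnt_add_le:
  assumes ab: "a < n" "b < n" "a + b + 2 \<le> n + 2 * gaps" and n_gaps: "2 * gaps + 2 \<le> n"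
  shows "cnt a + cnt b \<le> n"
proof -
  let ?M = "\<lambda>s. card (orders \<inter> {..s})"
  have mono: "?M s \<le> ?M t" if "s \<le> t" for s t using that by (intro card_mono) auto
  have M_large: "?M s + gaps = s + 1" if "2 * gaps \<le> s + 1" for s by (rule card_below_conductor[OF that])
  have small: "?M s + ?M t \<le> n" if "s + 1 < 2 * gaps" "t < n" for s t
  proof -
    have "?M s \<le> ?M (2 * gaps - 1)" "?M t \<le> ?M (n - 1)" using that by (intro mono; simp)+
    then show ?thesis using M_large[of "2 * gaps - 1"] M_large[of "n - 1"] that n_gaps by simp
  qed
  have "?M a + ?M b \<le> n"
  proof (cases "a + 1 < 2 * gaps \<or> b + 1 < 2 * gaps")
    case True then show ?thesis using small[of a b] small[of b a] ab by (auto simp: add.commute)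
  next
    case False then show ?thesis using M_large[of a] M_large[of b] ab by simp
  qed
  then show ?thesis using cnt_le[of a] cnt_le[of b] by simp
qed

lemma top_eq:
  assumes n_gaps: "2 * gaps + 2 \<le> n" shows "last_jump + 1 = n + 2 * gaps"
proof (rule ccontr)
  assume "last_jump + 1 \<noteq> n + 2 * gaps"
  then have lt: "last_jump + 2 \<le> n + 2 * gaps" using A_upper[OF top_mem(1)] card_jumps by simp
  have "\<exists>a b. a \<in> orders \<and> b \<in> orders \<and> a + b = last_jump \<and> a < n \<and> b < n"
  \<comment> \<open>Below \<open>n\<close> the decomposition with summand zero suffices; the
    semigroup argument assumes \<open>n \<le> last_jump\<close>.\<close>
  proof (cases "last_jump < n")
    case True
    then show ?thesis using orders_zero top_mem(1) jumps_sub by (intro exI[of _ 0] exI[of _ last_jump]) auto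
  next
    case False
    then show ?thesis using decomposition_below[of n last_jump] lt n_gaps by (metis leI)
  qed
  then obtain a b where ab: "a \<in> orders" "b \<in> orders" "a + b = last_jump" "a < n" "b < n" by blast
  then obtain f h where fh: "exact (int a) f" "exact (int b) h" by (auto simp: orders_def)
  have "lam (tm f h) = 0"
    using fh cnt_add_le[OF ab(4,5) _ n_gaps] lt ab by (intro lam_tm_zero[of _ a _ b]) (auto simp: exact_def)
  moreover have "exact (int last_jump) (tm f h)" using exact_tm[OF fh] ab(3) by (metis of_nat_add)
  ultimately show False using lam_exact_top by blast
qed

text \<open>By \<open>top_eq\<close> the order bound is attained, so the jumps are symmetric:
  reflection in \<open>last_jump\<close> sends the jumps up to \<open>t\<close> to those beyond
  \<open>s\<close>.\<close>

lemma cnt_complement: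
  assumes "2 * gaps + 2 \<le> n" "s + t + 1 = last_jump"
  shows "cnt s + cnt t = n"
proof -
  have top1: "last_jump + 1 = card (jumps Ps) + 2 * gaps" unfolding card_jumps by (rule top_eq[OF assms(1)])
  note sym = A_symmetric[OF top_mem(1) top1]
  have "bij_betw (\<lambda>a. last_jump - a) (jumps Ps \<inter> {..t}) (jumps Ps \<inter> {s<..})"
  proof (rule bij_betw_byWitness[where f' = "\<lambda>a. last_jump - a"])
    show "(\<lambda>a. last_jump - a) ` (jumps Ps \<inter> {..t}) \<subseteq> jumps Ps \<inter> {s<..}"
    proof (rule image_subsetI)
      fix a assume a: "a \<in> jumps Ps \<inter> {..t}"
      then have "s < last_jump - a" using assms(2) by (simp only: Int_iff atMost_iff) linarith
      then show "last_jump - a \<in> jumps Ps \<inter> {s<..}" using sym[of a] a by (simp only: Int_iff greaterThan_iff)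
    qed
    show "(\<lambda>a. last_jump - a) ` (jumps Ps \<inter> {s<..}) \<subseteq> jumps Ps \<inter> {..t}"
    proof (rule image_subsetI)
      fix a assume a: "a \<in> jumps Ps \<inter> {s<..}"
      then have "last_jump - a \<le> t" using assms(2) by (simp only: Int_iff greaterThan_iff) linarith
      then show "last_jump - a \<in> jumps Ps \<inter> {..t}" using sym[of a] a by (simp only: Int_iff atMost_iff)
    qed
  qed (use top_mem(2) in auto)
  then have "cnt t = card (jumps Ps \<inter> {s<..})" by (simp add: cnt_def bij_betw_same_card)
  moreover have "card (jumps Ps \<inter> {..s} \<union> jumps Ps \<inter> {s<..}) = cnt s + card (jumps Ps \<inter> {s<..})"
    unfolding cnt_def by (rule card_Un_disjoint) (use finite_jumps in auto)
  moreover have "jumps Ps \<inter> {..s} \<union> jumps Ps \<inter> {s<..} = jumps Ps" by auto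
  ultimately show ?thesis using card_jumps by simp
qed

end

section \<open>Comparison of the flags of two point sets\<close>

lemma sum_nth_distinct:
  assumes "distinct xs" shows "(\<Sum>j<length xs. F (xs ! j)) = (\<Sum>P\<in>set xs. F P)"
  by (rule sum.reindex_bij_betw) (use bij_betw_nth[OF assms] in simp)

lemma distinct_nth_inverse:
  assumes "distinct xs" obtains r where "\<And>j. j < length xs \<Longrightarrow> r (xs ! j) = j"
proof
  fix j assume "j < length xs"
  then show "(\<lambda>y. THE j. j < length xs \<and> xs ! j = y) (xs ! j) = j"
    using assms by (intro the_equality) (auto simp: nth_eq_iff_index_eq)
qed

text \<open>
  The vector \<open>x'\<close> extended by zero is \<open>x * ev f\<close> for some \<open>f\<close> of pole order at most \<open>n - n'\<close>. As \<open>lam (f h) = lam' h\<close>,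
  multiplication by \<open>f\<close> takes order \<open>n' + 2 gaps - 1\<close> to order at least \<open>n + 2 gaps - 1\<close>, so equality holds.
\<close>

theorem isometry_dual_subflag:
  assumes C: "finite_gap_flag L tm lin ident ev S Ps n m x"
    and C': "finite_gap_flag L tm lin ident ev S Ps' n' m' x'"
    and dist: "distinct Ps" "distinct Ps'" and sub: "set Ps' \<subseteq> set Ps"
    and size: "2 * card (- pole_filtration.orders L) + 2 \<le> n'" "n' < n"
  shows "n - n' \<in> pole_filtration.orders L"
proof -
  interpret C: finite_gap_flag L tm lin ident ev S Ps n m x by (rule C)
  interpret C': finite_gap_flag L tm lin ident ev S Ps' n' m' x' by (rule C')
  have gaps': "2 * C.gaps + 2 \<le> n'" using size by (simp add: C.gaps_def)
  have last_jump: "C.last_jump + 1 = n + 2 * C.gaps" and last_jump': "C'.last_jump + 1 = n' + 2 * C.gaps"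
    using C.top_eq C'.top_eq gaps' size by auto
  obtain r where r: "\<And>j. j < n' \<Longrightarrow> r (Ps' ! j) = j"
    using distinct_nth_inverse[OF dist(2)] C'.n by metis
  define F where "F P = (if P \<in> set Ps' then x' $ r P else 0)" for P
  define y where "y = vec n (\<lambda>j. F (Ps ! j))"
  have sum_y: "(\<Sum>j<n. y $ j * ev h (Ps ! j)) = C'.lam h" for h
  proof -
    have "(\<Sum>j<n. y $ j * ev h (Ps ! j)) = (\<Sum>P\<in>set Ps. F P * ev h P)"
      using sum_nth_distinct[OF dist(1), of "\<lambda>P. F P * ev h P"] C.n by (simp add: y_def)
    also have "\<dots> = (\<Sum>P\<in>set Ps'. F P * ev h P)"
      by (rule sum.mono_neutral_right) (use sub in \<open>auto simp: F_def\<close>)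
    also have "\<dots> = (\<Sum>j<n'. F (Ps' ! j) * ev h (Ps' ! j))"
      using sum_nth_distinct[OF dist(2), of "\<lambda>P. F P * ev h P"] C'.n by simp
    also have "\<dots> = C'.lam h"
      unfolding C'.lam_def using C'.n r by (intro sum.cong) (auto simp: F_def)
    finally show ?thesis .
  qed
  \<comment> \<open>The last jumps differ by \<open>n - n'\<close>, so \<open>n - n'\<close> is the
    level complementary to \<open>C'.last_jump - 1\<close>, up to which the extended vector
    \<open>y\<close> is orthogonal to all functions.\<close>
  have cnt: "C.cnt (C'.last_jump - 1) + C.cnt (n - n') = n"
    using gaps' size last_jump last_jump' C'.top_pos by (intro C.cnt_complement) auto
  obtain f where f: "f \<in> L (int (n - n'))" "\<And>j. j < n \<Longrightarrow> y $ j = x $ j * ev f (Ps ! j)"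
    using C.dual_representation[OF cnt, of y] sum_y C'.lam_below_top C'.top_pos
    by (auto simp: y_def of_nat_diff)
  obtain h where h: "C.exact (int C'.last_jump) h"
    using C'.top_mem(1) C.jumps_sub by (auto simp: C.orders_def)
  have lam_fh: "C.lam (tm f h) \<noteq> 0"
  proof -
    have hL: "h \<in> L (int C'.last_jump)" using h by (simp add: C.exact_def)
    have "C.lam (tm f h) = (\<Sum>j<n. y $ j * ev h (Ps ! j))"
      unfolding C.lam_def using f C.ev_tm[OF f(1) hL] C.ev_nth_S by (intro sum.cong) auto
    then show ?thesis using sum_y C'.lam_exact_top[OF h] by simp
  qed
  \<comment> \<open>A point where \<open>f\<close> does not vanish is required by
    \<open>exact_order\<close>, which then provides the exact order of \<open>f\<close>.\<close>
  have "\<exists>j<n. y $ j \<noteq> 0"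
  proof (rule ccontr)
    assume "\<not> (\<exists>j<n. y $ j \<noteq> 0)"
    then have "(\<Sum>j<n. y $ j * ev h (Ps ! j)) = 0" by (intro sum.neutral) auto
    then show False using sum_y C'.lam_exact_top[OF h] by simp
  qed
  then obtain j where "j < n" "y $ j \<noteq> 0" by blast
  then have "ev f (Ps ! j) \<noteq> 0" "Ps ! j \<in> S" using f(2) C.ev_nth_S by auto
  then obtain e where e: "e \<le> int (n - n')" "C.exact e f"
    using C.exact_order[OF f(1)] by (auto simp: C.exact_def)
  have fh: "tm f h \<in> L (e + int C'.last_jump)" using C.exact_tm[OF e(2) h] by (simp add: C.exact_def)
  have "e = int (n - n')"
  proof (rule ccontr)
    assume "e \<noteq> int (n - n')"
    then have "e + int C'.last_jump \<le> int C.last_jump - 1" using e last_jump last_jump' size by simp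
    then have "tm f h \<in> L (int C.last_jump - 1)" using fh C.L_mono by blast
    then show False using lam_fh C.lam_below_top by blast
  qed
  then show ?thesis using e by (auto simp: C.orders_def)
qed

section \<open>Evaluation of forms over the algebraic closure\<close>

abbreviation lookup where "lookup \<equiv> Poly_Mapping.lookup"
abbreviation keys where "keys \<equiv> Poly_Mapping.keys"
abbreviation single where "single \<equiv> Poly_Mapping.single"

definition mdeg :: "('i::finite \<Rightarrow>\<^sub>0 nat) \<Rightarrow> nat" where
  "mdeg e = (\<Sum>i\<in>UNIV. lookup e i)"

definition mon :: "('i::finite \<Rightarrow>\<^sub>0 nat) \<Rightarrow> ('i \<Rightarrow> 'a::comm_semiring_1) \<Rightarrow> 'a" where
  "mon e v = (\<Prod>i\<in>UNIV. v i ^ lookup e i)"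

definition eval_ac :: "('i::finite, 'k::field) mpol \<Rightarrow> ('i \<Rightarrow> 'k alg_closure) \<Rightarrow> 'k alg_closure" where
  "eval_ac p v = poly_eval (base_change p) v"

lemma mdeg_add: "mdeg (a + b) = mdeg a + mdeg b"
  by (simp add: mdeg_def lookup_add sum.distrib)

lemma mdeg_zero [simp]: "mdeg 0 = 0"
  by (simp add: mdeg_def)

lemma mdeg_single [simp]: "mdeg (single i k) = k"
  by (simp add: mdeg_def lookup_single when_def)

lemma mon_add: "mon (a + b) v = mon a v * mon b v"
  by (simp add: mon_def lookup_add power_add prod.distrib)

lemma mon_zero [simp]: "mon 0 v = 1"
  by (simp add: mon_def)

lemma mon_single [simp]: "mon (single i k) v = v i ^ k"
proof -
  have "mon (single i k) v = (\<Prod>j\<in>UNIV. if j = i then v i ^ k else 1)"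
    unfolding mon_def by (intro prod.cong) (auto simp: lookup_single when_def)
  then show ?thesis by simp
qed

lemma mon_scale: "mon e (\<lambda>i. c * v i) = c ^ mdeg e * mon e v"
  by (simp add: mon_def mdeg_def power_mult_distrib prod.distrib power_sum)

lemma homogeneous_iff: "homogeneous d p \<longleftrightarrow> (\<forall>e\<in>keys p. mdeg e = d)"
  by (simp add: homogeneous_def mdeg_def)

lemma homogeneous_zero [simp]: "homogeneous d 0"
  by (simp add: homogeneous_def)

lemma homogeneous_one [simp]: "homogeneous 0 1"
  by (simp add: homogeneous_iff)

lemma homogeneous_single: "mdeg e = d \<Longrightarrow> homogeneous d (single e c)"
  by (simp add: homogeneous_iff)

lemma homogeneous_add: "homogeneous d p \<Longrightarrow> homogeneous d q \<Longrightarrow> homogeneous d (p + q)"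
  using keys_add[of p q] by (auto simp: homogeneous_iff)

lemma homogeneous_diff:
  fixes p q :: "('i::finite, 'a::ab_group_add) mpol"
  shows "homogeneous d p \<Longrightarrow> homogeneous d q \<Longrightarrow> homogeneous d (p - q)"
  by (auto simp: homogeneous_iff in_keys_iff lookup_minus)

lemma homogeneous_uminus:
  fixes p :: "('i::finite, 'a::ab_group_add) mpol"
  shows "homogeneous d p \<Longrightarrow> homogeneous d (- p)"
  by (auto simp: homogeneous_iff in_keys_iff)

lemma homogeneous_mult:
  "homogeneous d p \<Longrightarrow> homogeneous d' q \<Longrightarrow> homogeneous (d + d') (p * q)"
  using keys_mult[of p q] by (auto simp: homogeneous_iff mdeg_add dest!: subsetD)

lemma homogeneous_unique: "homogeneous d p \<Longrightarrow> homogeneous d' p \<Longrightarrow> p \<noteq> 0 \<Longrightarrow> d = d'"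
  unfolding homogeneous_iff by (metis ex_in_conv keys_eq_empty)

lemma homogeneous_sum:
  "(\<And>x. x \<in> A \<Longrightarrow> homogeneous d (f x)) \<Longrightarrow> homogeneous d (sum f A)"
  by (induction A rule: infinite_finite_induct) (auto intro: homogeneous_add)

lemma homogeneous_power: "homogeneous d p \<Longrightarrow> homogeneous (k * d) (p ^ k)"
  by (induction k) (auto intro: homogeneous_mult)

lemma sum_singles: "p = (\<Sum>e\<in>keys p. single e (lookup p e))"
proof (rule poly_mapping_eqI)
  fix e
  have "lookup (\<Sum>e\<in>keys p. single e (lookup p e)) e
      = (\<Sum>e'\<in>keys p. if e' = e then lookup p e else 0)"
    unfolding lookup_sum by (intro sum.cong) (auto simp: lookup_single when_def)
  also have "\<dots> = lookup p e" by (simp add: in_keys_iff)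
  finally show "lookup p e = lookup (\<Sum>e\<in>keys p. single e (lookup p e)) e" by simp
qed

lemma lookup_base_change: "lookup (base_change p) e = to_ac (lookup p e)"
  unfolding base_change_def by (simp add: Poly_Mapping.map.rep_eq when_def)

lemma keys_base_change [simp]: "keys (base_change p) = keys p"
  by (auto simp: in_keys_iff lookup_base_change)

lemma homogeneous_base_change [simp]: "homogeneous d (base_change p) = homogeneous d p"
  by (simp add: homogeneous_def)

text \<open>\<open>poly_eval\<close> sums over the support, which may shrink in sums; evaluating
  over a common finite superset makes additivity a statement about sums over one index set.\<close>

lemma eval_ac_superset:
  "finite S \<Longrightarrow> keys p \<subseteq> S \<Longrightarrow> eval_ac p v = (\<Sum>e\<in>S. to_ac (lookup p e) * mon e v)"
  unfolding eval_ac_def poly_eval_def mon_def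
  by (rule sum.mono_neutral_cong_left) (auto simp: lookup_base_change in_keys_iff)

lemma eval_ac_add: "eval_ac (p + q) v = eval_ac p v + eval_ac q v"
  using eval_ac_superset[of "keys p \<union> keys q" "p + q"] eval_ac_superset[of "keys p \<union> keys q" p]
    eval_ac_superset[of "keys p \<union> keys q" q] keys_add[of p q]
  by (simp add: lookup_add distrib_right sum.distrib)

lemma eval_ac_single [simp]: "eval_ac (single e c) v = to_ac c * mon e v"
  using eval_ac_superset[of "{e}" "single e c"] by simp

lemma eval_ac_zero [simp]: "eval_ac 0 v = 0"
  using eval_ac_superset[of "{}" "0"] by simp

lemma eval_ac_one [simp]: "eval_ac 1 v = 1"
  using eval_ac_single[of 0 1 v] by (simp flip: single_one)

lemma eval_ac_uminus [simp]: "eval_ac (- p) v = - eval_ac p v"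
  using eval_ac_add[of p "- p" v] by (simp add: add_eq_0_iff)

lemma eval_ac_diff: "eval_ac (p - q) v = eval_ac p v - eval_ac q v"
  using eval_ac_add[of p "- q" v] by simp

lemma eval_ac_sum: "eval_ac (sum f A) v = (\<Sum>a\<in>A. eval_ac (f a) v)"
  by (induction A rule: infinite_finite_induct) (auto simp: eval_ac_add)

lemma eval_ac_mult: "eval_ac (p * q) v = eval_ac p v * eval_ac q v"
proof -
  have "p * q = (\<Sum>e\<in>keys p. \<Sum>e'\<in>keys q. single (e + e') (lookup p e * lookup q e'))"
    by (subst sum_singles[of p], subst sum_singles[of q]) (simp add: sum_product mult_single)
  then have "eval_ac (p * q) v =
      (\<Sum>e\<in>keys p. \<Sum>e'\<in>keys q. (to_ac (lookup p e) * mon e v) * (to_ac (lookup q e') * mon e' v))"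
    by (simp add: eval_ac_sum mon_add mult_ac)
  also have "\<dots> = eval_ac p v * eval_ac q v"
    by (simp add: sum_product eval_ac_superset[of "keys p" p] eval_ac_superset[of "keys q" q])
  finally show ?thesis .
qed

lemma eval_ac_power: "eval_ac (p ^ k) v = eval_ac p v ^ k"
  by (induction k) (auto simp: eval_ac_mult)

lemma eval_ac_scale:
  assumes "homogeneous d p" shows "eval_ac p (\<lambda>i. c * v i) = c ^ d * eval_ac p v"
proof -
  have "eval_ac p (\<lambda>i. c * v i) = (\<Sum>e\<in>keys p. c ^ d * (to_ac (lookup p e) * mon e v))"
    unfolding eval_ac_superset[of "keys p" p, OF finite_keys subset_refl]
    using assms by (intro sum.cong) (auto simp: mon_scale homogeneous_iff)
  then show ?thesis
    by (simp add: sum_distrib_left eval_ac_superset[of "keys p" p])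
qed

lemma eval_ac_to_ac: "eval_ac p (\<lambda>i. to_ac (w i)) = to_ac (poly_eval p w)"
proof -
  have "mon e (\<lambda>i. to_ac (w i)) = to_ac (mon e w)" for e
    by (simp add: mon_def to_ac_prod)
  then show ?thesis
    unfolding eval_ac_superset[of "keys p" p, OF finite_keys subset_refl]
    by (simp add: poly_eval_def to_ac_sum flip: mon_def)
qed

lemma vanishes_at_iff: "vanishes_at P F \<longleftrightarrow> (\<forall>v\<in>P. eval_ac F v = 0)"
  by (simp add: vanishes_at_def eval_ac_def)

lemma proj_point_self: "v \<in> proj_point v"
  by (auto simp: proj_point_def intro!: exI[of _ 1])

lemma proj_space_scaled:
  assumes "P \<in> proj_space" "v \<in> P" "w \<in> P"
  obtains c where "c \<noteq> 0" "w = (\<lambda>i. c * v i)"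
proof -
  obtain u a b where "a \<noteq> 0" "b \<noteq> 0" "v = (\<lambda>i. a * u i)" "w = (\<lambda>i. b * u i)"
    using assms by (auto simp: proj_space_def proj_point_def)
  then show thesis by (intro that[of "b / a"]) auto
qed

lemma proj_space_nonempty: "P \<in> proj_space \<Longrightarrow> \<exists>v. v \<in> P"
  by (auto simp: proj_space_def intro: proj_point_self)

lemma proj_space_eq: 
  assumes "P \<in> proj_space" "v \<in> P" shows "P = proj_point v"
proof -
  obtain u a where u: "P = proj_point u" "a \<noteq> 0" "v = (\<lambda>i. a * u i)"
    using assms by (auto simp: proj_space_def proj_point_def)
  have "\<exists>c'. (\<lambda>i. c * u i) = (\<lambda>i. c' * v i) \<and> c' \<noteq> 0" if "c \<noteq> 0" for c
    using u that by (intro exI[of _ "c / a"]) auto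
  moreover have "\<exists>c'. (\<lambda>i. c * v i) = (\<lambda>i. c' * u i) \<and> c' \<noteq> 0" if "c \<noteq> 0" for c
    using u that by (intro exI[of _ "c * a"]) (auto simp: mult_ac)
  ultimately show ?thesis unfolding u(1) by (auto simp: proj_point_def)
qed

text \<open>Rescaling the coordinates multiplies the value of a form by a power of the factor, so
  one coordinate vector decides.\<close>

lemma vanishes_at_homogeneous:
  assumes "P \<in> proj_space" "v \<in> P" "homogeneous d F"
  shows "vanishes_at P F \<longleftrightarrow> eval_ac F v = 0"
proof
  assume 0: "eval_ac F v = 0"
  show "vanishes_at P F" unfolding vanishes_at_iff
  proof
    fix w assume "w \<in> P"
    then obtain c where "w = (\<lambda>i. c * v i)" using proj_space_scaled[OF assms(1,2)] by blast
    then show "eval_ac F w = 0" using eval_ac_scale[OF assms(3), of c v] 0 by simp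
  qed
qed (use assms in \<open>auto simp: vanishes_at_iff\<close>)

section \<open>The ascending chain condition for homogeneous ideals\<close>

text \<open>
  Integer polynomials form a linearly ordered group, so mapping the exponent vector \<open>e\<close> to the
  polynomial with coefficients \<open>e\<close> yields a monomial order that is compatible with multiplication.
  Well-foundedness is not needed, as only finitely many monomials have a given degree.
\<close>

definition coord_index :: "'i::finite \<Rightarrow> nat" where
  "coord_index = (SOME h. inj h)"

definition mon_rank :: "('i::finite \<Rightarrow>\<^sub>0 nat) \<Rightarrow> int poly" where
  "mon_rank e = (\<Sum>i\<in>UNIV. Polynomial.monom (int (lookup e i)) (coord_index i))"

lemma inj_coord_index: "inj (coord_index :: 'i::finite \<Rightarrow> nat)"
proof -
  have "\<exists>h :: 'i \<Rightarrow> nat. inj h"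
    using finite_imp_inj_to_nat_seg[of "UNIV :: 'i set"] by auto
  then show ?thesis unfolding coord_index_def by (rule someI_ex)
qed

lemma mon_rank_add: "mon_rank (a + b) = mon_rank a + mon_rank b"
  by (simp add: mon_rank_def lookup_add sum.distrib flip: add_monom)

lemma mon_rank_inj: "mon_rank a = mon_rank b \<Longrightarrow> a = b"
proof (rule poly_mapping_eqI)
  fix j assume eq: "mon_rank a = mon_rank b"
  have "Polynomial.coeff (mon_rank e) (coord_index j) = int (lookup e j)" for e :: "'a \<Rightarrow>\<^sub>0 nat"
  proof -
    have "Polynomial.coeff (mon_rank e) (coord_index j)
        = (\<Sum>i\<in>UNIV. if i = j then int (lookup e j) else 0)"
      unfolding mon_rank_def coeff_sum using inj_coord_index
      by (intro sum.cong) (auto simp: inj_def)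
    then show ?thesis by simp
  qed
  then show "lookup a j = lookup b j" using eq by (metis of_nat_eq_iff)
qed

section \<open>Leading exponents and Dickson's lemma\<close>

definition is_lead :: "('i::finite, 'a::zero) mpol \<Rightarrow> ('i \<Rightarrow>\<^sub>0 nat) \<Rightarrow> bool" where
  "is_lead F e \<longleftrightarrow> e \<in> keys F \<and> (\<forall>a\<in>keys F. mon_rank a \<le> mon_rank e)"

lemma lead_exists: "F \<noteq> 0 \<Longrightarrow> \<exists>e. is_lead F e"
proof -
  assume "F \<noteq> 0"
  then have "mon_rank ` keys F \<noteq> {}" by simp
  then have "Max (mon_rank ` keys F) \<in> mon_rank ` keys F" by (intro Max_in) auto
  then obtain e where "e \<in> keys F" "mon_rank e = Max (mon_rank ` keys F)" by auto
  then show ?thesis by (auto simp: is_lead_def)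
qed

lemma lookup_single_mult:
  fixes p :: "('i::finite, 'a::comm_semiring_1) mpol"
  shows "lookup (single a c * p) (a + b) = c * lookup p b"
proof -
  have "single a c * p = (\<Sum>e\<in>keys p. single (a + e) (c * lookup p e))"
    by (subst sum_singles[of p]) (simp add: sum_distrib_left mult_single)
  then have "lookup (single a c * p) (a + b) = (\<Sum>e\<in>keys p. if e = b then c * lookup p b else 0)"
    by (simp add: lookup_sum lookup_single when_def)
  then show ?thesis by (simp add: in_keys_iff)
qed

lemma keys_single_mult: "keys (single a c * p) \<subseteq> (+) a ` keys p"
  using keys_mult[of "single a c" p] by (auto split: if_splits)

text \<open>The homogeneous elements of a homogeneous ideal. Only forms of equal degree are
  subtracted and only terms are used as multipliers, so that the results are again forms.\<close>

definition form_ideal :: "('i::finite, 'a::field) mpol set \<Rightarrow> bool" where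
  "form_ideal J \<longleftrightarrow> 0 \<in> J \<and>
     (\<forall>F\<in>J. \<forall>G\<in>J. \<forall>d. homogeneous d F \<and> homogeneous d G \<longrightarrow> F - G \<in> J) \<and>
     (\<forall>F\<in>J. \<forall>e c. single e c * F \<in> J) \<and> (\<forall>F\<in>J. \<exists>d. homogeneous d F)"

definition leads :: "('i::finite, 'a::field) mpol set \<Rightarrow> ('i \<Rightarrow>\<^sub>0 nat) set" where
  "leads J = {e. \<exists>F\<in>J. is_lead F e}"

text \<open>Adding \<open>a\<close> to all exponents preserves the monomial order. Closure of the
  leading exponents under addition is what Dickson's lemma is applied to.\<close>

lemma leads_up:
  assumes J: "form_ideal J" and e: "e \<in> leads J" shows "e + a \<in> leads J"
proof -
  obtain F where F: "F \<in> J" "is_lead F e" using e by (auto simp: leads_def)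
  let ?G = "single a 1 * F"
  have "?G \<in> J" using J F(1) by (auto simp: form_ideal_def)
  moreover have "e + a \<in> keys ?G"
    using F(2) lookup_single_mult[of a 1 F e] by (auto simp: is_lead_def in_keys_iff add.commute)
  moreover have "mon_rank b \<le> mon_rank (e + a)" if "b \<in> keys ?G" for b
    using subsetD[OF keys_single_mult that] F(2) by (auto simp: is_lead_def mon_rank_add)
  ultimately show ?thesis by (auto simp: leads_def is_lead_def)
qed

lemma finite_mdeg: "finite {e :: 'i::finite \<Rightarrow>\<^sub>0 nat. mdeg e = d}"
proof (rule finite_imageD)
  have "lookup e i \<le> d" if "mdeg e = d" for e :: "'i \<Rightarrow>\<^sub>0 nat" and i
    using that member_le_sum[of i UNIV "lookup e"] by (auto simp: mdeg_def)
  then have "lookup ` {e :: 'i \<Rightarrow>\<^sub>0 nat. mdeg e = d}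
      \<subseteq> {f. \<forall>x. (x \<in> UNIV \<longrightarrow> f x \<in> {..d}) \<and> (x \<notin> UNIV \<longrightarrow> f x = 0)}" by auto
  then show "finite (lookup ` {e :: 'i \<Rightarrow>\<^sub>0 nat. mdeg e = d})"
    by (rule finite_subset) (intro finite_set_of_finite_funs, auto)
  show "inj_on lookup {e :: 'i \<Rightarrow>\<^sub>0 nat. mdeg e = d}"
    by (auto simp: inj_on_def intro: poly_mapping_eqI)
qed

text \<open>Division with remainder: the leading term of a form in \<open>J'\<close> is cancelled by
  an element of \<open>J\<close>, and the remainder is again in \<open>J'\<close> with smaller
  leading exponent.\<close>

lemma form_ideal_eq_if_leads:
  fixes J J' :: "('i::finite, 'a::field) mpol set"
  assumes J: "form_ideal J" and J': "form_ideal J'" and sub: "J \<subseteq> J'" and leads: "leads J' \<subseteq> leads J"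
  shows "J' \<subseteq> J"
proof
  fix F0 assume "F0 \<in> J'"
  then obtain d where "homogeneous d F0" using J' by (auto simp: form_ideal_def)
  \<comment> \<open>The termination measure: the exponents of degree \<open>d\<close> that do not
    exceed some exponent of \<open>F\<close>. Each cancellation removes at least the leading
    one.\<close>
  define B where "B F = {a :: 'i \<Rightarrow>\<^sub>0 nat. mdeg a = d \<and> (\<exists>e\<in>keys F. mon_rank a \<le> mon_rank e)}"
    for F :: "('i, 'a) mpol"
  have finB: "finite (B F)" for F
    by (rule finite_subset[OF _ finite_mdeg[of d]]) (auto simp: B_def)
  have "F \<in> J" if "F \<in> J'" "homogeneous d F" for F
    using that
  proof (induction "card (B F)" arbitrary: F rule: less_induct)
    case less
    show ?case
    proof (cases "F = 0")
      case True then show ?thesis using J by (simp add: form_ideal_def)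
    next
      case False
      then obtain e where e: "is_lead F e" using lead_exists by blast
      then have "e \<in> leads J" using less.prems leads by (auto simp: leads_def)
      then obtain G where G: "G \<in> J" "is_lead G e" by (auto simp: leads_def)
      obtain d' where "homogeneous d' G" using J G(1) by (auto simp: form_ideal_def)
      moreover have "mdeg e = d" using e less.prems by (auto simp: is_lead_def homogeneous_iff)
      ultimately have Gd: "homogeneous d G" using G(2) by (auto simp: is_lead_def homogeneous_iff)
      define c where "c = lookup F e / lookup G e"
      define H where "H = single 0 c * G"
      have H: "H \<in> J" using J G(1) by (auto simp: form_ideal_def H_def)
      have Hd: "homogeneous d H"
        using homogeneous_mult[OF homogeneous_single[of 0 0 c] Gd] by (simp add: H_def)
      have keysH: "keys H \<subseteq> keys G" using keys_single_mult[of 0 c G] by (auto simp: H_def)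
      have lookH: "lookup H e = lookup F e"
        using lookup_single_mult[of 0 c G e] G(2) by (simp add: H_def c_def is_lead_def in_keys_iff)
      define R where "R = F - H"
      have Rd: "homogeneous d R" unfolding R_def by (rule homogeneous_diff[OF less.prems(2) Hd])
      have RJ: "R \<in> J'"
        using J' less.prems Hd H sub by (auto simp: form_ideal_def R_def)
      have below: "mon_rank a < mon_rank e" if "a \<in> keys R" for a
      proof -
        have "a \<noteq> e" using that lookH by (auto simp: R_def in_keys_iff lookup_minus)
        moreover have "a \<in> keys F \<or> a \<in> keys G"
          using that keysH by (auto simp: R_def in_keys_iff lookup_minus)
        then have "mon_rank a \<le> mon_rank e" using e G(2) by (auto simp: is_lead_def)
        ultimately show ?thesis using mon_rank_inj[of a e] by (auto simp: order.order_iff_strict)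
      qed
      have "e \<in> B F" using e \<open>mdeg e = d\<close> by (auto simp: B_def is_lead_def)
      moreover have "e \<notin> B R" using below by (auto simp: B_def not_le)
      moreover have "B R \<subseteq> B F"
      proof
        fix a assume "a \<in> B R"
        then obtain b where "mdeg a = d" "b \<in> keys R" "mon_rank a \<le> mon_rank b" by (auto simp: B_def)
        then have "mon_rank a \<le> mon_rank e" using below[of b] by simp
        then show "a \<in> B F" using e \<open>mdeg a = d\<close> by (auto simp: B_def is_lead_def)
      qed
      ultimately have "card (B R) < card (B F)" by (intro psubset_card_mono finB) auto
      then have "R \<in> J" using less.hyps RJ Rd by blast
      \<comment> \<open>\<open>form_ideal\<close> provides differences only, so the sum
        \<open>R + H\<close> is written as \<open>R - (0 - H)\<close>.\<close>
      moreover have "0 - H \<in> J" using J H Hd by (auto simp: form_ideal_def simp del: diff_0)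
      ultimately have "R - (0 - H) \<in> J"
        using J Rd homogeneous_diff[OF homogeneous_zero Hd] unfolding form_ideal_def by blast
      then show ?thesis by (simp add: R_def)
    qed
  qed
  then show "F0 \<in> J" using \<open>F0 \<in> J'\<close> \<open>homogeneous d F0\<close> by blast
qed

text \<open>A decreasing sequence of naturals is constant from the place of its minimum on, so a
  tail of it is increasing in the weak sense.\<close>

lemma nat_seq_monosub:
  fixes s :: "nat \<Rightarrow> nat"
  obtains r :: "nat \<Rightarrow> nat" where "strict_mono r" "mono (\<lambda>k. s (r k))"
proof -
  obtain f :: "nat \<Rightarrow> nat" where f: "strict_mono f" "monoseq (\<lambda>k. s (f k))" using seq_monosub by blast
  show thesis
  proof (cases "incseq (\<lambda>k. s (f k))")
    case True
    then show thesis using that[OF f(1)] by simp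
  next
    case False
    then have dec: "decseq (\<lambda>k. s (f k))" using f(2) by (simp add: monoseq_iff)
    obtain k0 where k0: "\<And>k. s (f k0) \<le> s (f k)"
      using ex_has_least_nat[of "\<lambda>_. True" _ "\<lambda>k. s (f k)"] by auto
    have "s (f (k + k0)) = s (f k0)" for k
      using k0[of "k + k0"] decseqD[OF dec, of k0 "k + k0"] by simp
    moreover have "strict_mono (\<lambda>k. f (k + k0))"
      using f(1) by (auto simp: strict_mono_def)
    ultimately show thesis by (intro that[of "\<lambda>k. f (k + k0)"]) (auto simp: mono_def)
  qed
qed

text \<open>Subsequences are extracted one coordinate after the other until all coordinates are
  weakly increasing; then the first two terms are comparable.\<close>

lemma dickson:
  fixes e :: "nat \<Rightarrow> ('i::finite \<Rightarrow>\<^sub>0 nat)"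
  obtains i j a where "i < j" "e j = e i + a"
proof -
  have "\<exists>r :: nat \<Rightarrow> nat. strict_mono r \<and> (\<forall>c\<in>I. mono (\<lambda>k. lookup (e (r k)) c))" if "finite I" for I
    using that
  proof (induction I rule: finite_induct)
    case empty
    then show ?case by (intro exI[of _ "\<lambda>k. k"]) (auto simp: strict_mono_def)
  next
    case (insert c I)
    then obtain r :: "nat \<Rightarrow> nat" where r: "strict_mono r" "\<forall>c\<in>I. mono (\<lambda>k. lookup (e (r k)) c)" by blast
    obtain q :: "nat \<Rightarrow> nat" where q: "strict_mono q" "mono (\<lambda>k. lookup (e (r (q k))) c)"
      using nat_seq_monosub[of "\<lambda>k. lookup (e (r k)) c"] by blast
    have "strict_mono (\<lambda>k. r (q k))" using r(1) q(1) by (auto simp: strict_mono_def)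
    moreover have "mono (\<lambda>k. lookup (e (r (q k))) b)" if "b \<in> I" for b
      using r(2) that strict_mono_mono[OF q(1)] by (auto simp: mono_def)
    ultimately show ?case using q(2) by (intro exI[of _ "\<lambda>k. r (q k)"]) auto
  qed
  from this[of UNIV] obtain r :: "nat \<Rightarrow> nat" where r: "strict_mono r" "\<And>c. mono (\<lambda>k. lookup (e (r k)) c)" by auto
  have "lookup (e (r 0)) c \<le> lookup (e (r 1)) c" for c using r(2)[of c] by (auto simp: mono_def)
  then have "e (r 1) = e (r 0) + (e (r 1) - e (r 0))"
    by (intro poly_mapping_eqI) (simp add: lookup_add lookup_minus)
  moreover have "r 0 < r 1" using strict_monoD[OF r(1), of 0 1] by simp
  ultimately show thesis using that by blast
qed

text \<open>If every inclusion were strict, each step would bring a new leading exponent. By Dickson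
  one of them is an earlier one plus \<open>a\<close>, hence was already a leading exponent before
  its step.\<close>

lemma form_ideals_stabilize:
  fixes J :: "nat \<Rightarrow> ('i::finite, 'a::field) mpol set"
  assumes J: "\<And>k. form_ideal (J k)" and sub: "\<And>k. J k \<subseteq> J (Suc k)"
  obtains k where "J (Suc k) \<subseteq> J k"
proof (rule ccontr)
  assume "\<not> thesis"
  then have "\<not> J (Suc k) \<subseteq> J k" for k using that by blast
  then have "\<not> leads (J (Suc k)) \<subseteq> leads (J k)" for k
    using form_ideal_eq_if_leads[OF J J sub] by blast
  then have "\<exists>e. e \<in> leads (J (Suc k)) \<and> e \<notin> leads (J k)" for k by blast
  then obtain e where e: "\<And>k. e k \<in> leads (J (Suc k))" "\<And>k. e k \<notin> leads (J k)" by metis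
  obtain i j a where ij: "i < j" "e j = e i + a" using dickson by blast
  have "J (Suc i) \<subseteq> J j" using lift_Suc_mono_le[of J "Suc i" j] sub ij(1) by simp
  then have "e i \<in> leads (J j)" using e(1)[of i] by (auto simp: leads_def)
  then have "e j \<in> leads (J j)" using leads_up[OF J] ij(2) by simp
  then show False using e(2) by blast
qed

section \<open>The function field\<close>

text \<open>\<open>V_prime\<close> is primality of the homogeneous vanishing ideal over the base
  field, tested on forms: the cancellation law that makes fractions form a field.\<close>

locale irred_variety =
  fixes V :: "('i::finite, 'k::field) point set"
  assumes V_proj: "V \<subseteq> proj_space"
    and V_nonempty: "V \<noteq> {}"
    and V_prime: "homogeneous d G \<Longrightarrow> homogeneous d' H \<Longrightarrow> \<forall>P\<in>V. vanishes_at P (G * H) \<Longrightarrow>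
      (\<forall>P\<in>V. vanishes_at P G) \<or> (\<forall>P\<in>V. vanishes_at P H)"
begin

definition null :: "('i, 'k) mpol \<Rightarrow> bool" where
  "null F \<longleftrightarrow> (\<forall>P\<in>V. vanishes_at P F)"

abbreviation frac :: "('i, 'k) mpol \<Rightarrow> ('i, 'k) mpol \<Rightarrow> ('i, 'k) ratfun" where
  "frac G H \<equiv> frac_rel V `` {(G, H)}"

abbreviation valid :: "('i, 'k) mpol \<Rightarrow> ('i, 'k) mpol \<Rightarrow> bool" where
  "valid G H \<equiv> (G, H) \<in> fractions V"

abbreviation K :: "('i, 'k) ratfun ring" where "K \<equiv> function_field V"

lemma null_iff: "null F \<longleftrightarrow> (\<forall>P\<in>V. \<forall>v\<in>P. eval_ac F v = 0)"
  by (simp add: null_def vanishes_at_iff)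

lemma null_prime:
  "homogeneous d G \<Longrightarrow> homogeneous d' H \<Longrightarrow> null (G * H) \<Longrightarrow> null G \<or> null H"
  using V_prime by (auto simp: null_def)

lemma null_zero [simp]: "null 0" by (simp add: null_iff)

lemma null_add: "null F \<Longrightarrow> null G \<Longrightarrow> null (F + G)" by (simp add: null_iff eval_ac_add)

lemma null_uminus: "null F \<Longrightarrow> null (- F)" by (simp add: null_iff)

lemma null_mult: "null F \<Longrightarrow> null (G * F)" by (simp add: null_iff eval_ac_mult)

lemma not_null_one [simp]: "\<not> null 1"
  using V_nonempty V_proj proj_space_nonempty by (auto simp: null_iff)

lemma validE:
  assumes "valid G H" obtains d where "homogeneous d G" "homogeneous d H" "\<not> null H"
  using assms by (auto simp: fractions_def null_def)

lemma validI: "homogeneous d G \<Longrightarrow> homogeneous d H \<Longrightarrow> \<not> null H \<Longrightarrow> valid G H"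
  by (auto simp: fractions_def null_def)

lemma not_null_mult:
  "homogeneous d G \<Longrightarrow> homogeneous d' H \<Longrightarrow> \<not> null G \<Longrightarrow> \<not> null H \<Longrightarrow> \<not> null (G * H)"
  using null_prime by blast

lemma valid_mult: "valid G H \<Longrightarrow> valid G' H' \<Longrightarrow> valid (G * G') (H * H')"
  by (elim validE) (rule validI[OF homogeneous_mult homogeneous_mult not_null_mult])

lemma valid_add: "valid G H \<Longrightarrow> valid G' H' \<Longrightarrow> valid (G * H' + G' * H) (H * H')"
proof (elim validE)
  fix d d' assume *: "homogeneous d G" "homogeneous d H" "\<not> null H"
    "homogeneous d' G'" "homogeneous d' H'" "\<not> null H'"
  then have "homogeneous (d + d') (G * H' + G' * H)"
    using homogeneous_mult[of d G d' H'] homogeneous_mult[of d' G' d H]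
    by (auto intro!: homogeneous_add simp: add.commute)
  then show ?thesis
    by (rule validI[OF _ homogeneous_mult[OF *(2,5)] not_null_mult[OF *(2,5,3,6)]])
qed

lemma valid_uminus: "valid G H \<Longrightarrow> valid (- G) H"
  by (elim validE, rule validI) (auto intro: homogeneous_uminus)

lemma frac_rel_iff:
  "((G, H), (G', H')) \<in> frac_rel V \<longleftrightarrow> valid G H \<and> valid G' H' \<and> null (G * H' - G' * H)"
  by (auto simp: frac_rel_def null_def)

lemma equiv_frac_rel: "equiv (fractions V) (frac_rel V)"
proof (rule equivI)
  show "refl_on (fractions V) (frac_rel V)"
    by (auto simp: refl_on_def frac_rel_iff)
  show "frac_rel V \<subseteq> fractions V \<times> fractions V" by (auto simp: frac_rel_iff)
  show "sym (frac_rel V)"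
  proof (rule symI, clarify)
    fix G H G' H' assume "((G, H), (G', H')) \<in> frac_rel V"
    moreover have "G' * H - G * H' = - (G * H' - G' * H)" by simp
    ultimately show "((G', H'), (G, H)) \<in> frac_rel V"
      unfolding frac_rel_iff by (metis null_uminus)
  qed
  show "trans (frac_rel V)"
  proof (rule transI, clarify)
    fix G H G' H' G'' H''
    assume a: "((G, H), (G', H')) \<in> frac_rel V" and b: "((G', H'), (G'', H'')) \<in> frac_rel V"
    obtain d d' d'' where hom: "homogeneous d G" "homogeneous d H" "homogeneous d' H'"
      "homogeneous d'' G''" "homogeneous d'' H''"
      using a b by (auto simp: frac_rel_iff elim!: validE)
    have nn: "\<not> null H'" using a by (auto simp: frac_rel_iff elim: validE)
    \<comment> \<open>The combination equals \<open>H'\<close> times the cross difference of the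
      outer fractions, and primality removes \<open>H'\<close>.\<close>
    have "null (H'' * (G * H' - G' * H) + H * (G' * H'' - G'' * H'))"
      using a b by (intro null_add null_mult) (auto simp: frac_rel_iff)
    also have "H'' * (G * H' - G' * H) + H * (G' * H'' - G'' * H') = H' * (G * H'' - G'' * H)"
      by (simp add: algebra_simps)
    finally have n: "null (H' * (G * H'' - G'' * H))" .
    have "homogeneous (d + d'') (G * H'' - G'' * H)"
      using homogeneous_mult[OF hom(1,5)] homogeneous_mult[OF hom(4,2)]
      by (auto intro!: homogeneous_diff simp: add.commute)
    then have "null (G * H'' - G'' * H)" using null_prime[OF hom(3) _ n] nn by blast
    then show "((G, H), (G'', H'')) \<in> frac_rel V" using a b by (simp add: frac_rel_iff)
  qed
qed

lemma frac_eq_iff: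
  "valid G H \<Longrightarrow> valid G' H' \<Longrightarrow> frac G H = frac G' H' \<longleftrightarrow> null (G * H' - G' * H)"
  using eq_equiv_class_iff[OF equiv_frac_rel, of "(G, H)" "(G', H')"] frac_rel_iff by simp

lemma frac_cong: "valid G H \<Longrightarrow> valid G' H' \<Longrightarrow> G * H' = G' * H \<Longrightarrow> frac G H = frac G' H'"
  by (simp add: frac_eq_iff)

lemma frac_carrier: "valid G H \<Longrightarrow> frac G H \<in> carrier K"
  by (simp add: function_field_def quotientI)

lemma carrierE:
  assumes "f \<in> carrier K" obtains G H where "valid G H" "f = frac G H"
  using assms by (auto simp: function_field_def elim!: quotientE)

lemma mem_frac:
  assumes "f \<in> carrier K" "(G, H) \<in> f" shows "valid G H" "f = frac G H"
proof -
  obtain G0 H0 where f: "valid G0 H0" "f = frac G0 H0" using assms(1) by (rule carrierE)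
  then have r: "((G0, H0), (G, H)) \<in> frac_rel V" using assms(2) by simp
  then show "valid G H" by (simp add: frac_rel_iff)
  show "f = frac G H" unfolding f(2) by (rule equiv_class_eq[OF equiv_frac_rel r])
qed

lemma frac_self: "valid G H \<Longrightarrow> (G, H) \<in> frac G H"
  by (simp add: frac_rel_iff)

lemma UN_const: "A \<noteq> {} \<Longrightarrow> (\<And>x. x \<in> A \<Longrightarrow> f x = c) \<Longrightarrow> (\<Union>x\<in>A. f x) = c"
  by auto

text \<open>The field operations are unions over all representatives; if these all yield the same
  class, the union is that class.\<close>

lemma frac_op:
  assumes 1: "valid G H" and 2: "valid G' H'"
    and cong: "\<And>G1 H1 G2 H2. valid G1 H1 \<Longrightarrow> null (G * H1 - G1 * H) \<Longrightarrow>
      valid G2 H2 \<Longrightarrow> null (G' * H2 - G2 * H') \<Longrightarrow> op G1 H1 G2 H2 = op G H G' H'"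
  shows "(\<Union>(G, H)\<in>frac G H. \<Union>(G', H')\<in>frac G' H'. op G H G' H') = op G H G' H'"
proof (rule UN_const)
  show "frac G H \<noteq> {}" using frac_self[OF 1] by blast
  fix p assume "p \<in> frac G H"
  then obtain G1 H1 where p: "p = (G1, H1)" "valid G1 H1" "null (G * H1 - G1 * H)"
    by (cases p) (simp add: frac_rel_iff)
  have "(\<Union>(G2, H2)\<in>frac G' H'. op G1 H1 G2 H2) = op G H G' H'"
  proof (rule UN_const)
    show "frac G' H' \<noteq> {}" using frac_self[OF 2] by blast
    fix q assume "q \<in> frac G' H'"
    then obtain G2 H2 where q: "q = (G2, H2)" "valid G2 H2" "null (G' * H2 - G2 * H')"
      by (cases q) (simp add: frac_rel_iff)
    show "(case q of (G2, H2) \<Rightarrow> op G1 H1 G2 H2) = op G H G' H'"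
      unfolding q(1) prod.case by (rule cong[OF p(2,3) q(2,3)])
  qed
  then show "(case p of (G, H) \<Rightarrow> \<Union>(G', H')\<in>frac G' H'. op G H G' H') = op G H G' H'"
    unfolding p(1) prod.case .
qed

lemma mult_frac:
  assumes "valid G H" "valid G' H'"
  shows "frac G H \<otimes>\<^bsub>K\<^esub> frac G' H' = frac (G * G') (H * H')"
proof -
  have "frac (G1 * G2) (H1 * H2) = frac (G * G') (H * H')"
    if "valid G1 H1" "null (G * H1 - G1 * H)" "valid G2 H2" "null (G' * H2 - G2 * H')"
    for G1 H1 G2 H2
  proof (subst frac_eq_iff)
    have "G1 * G2 * (H * H') - G * G' * (H1 * H2)
        = - (G2 * H') * (G * H1 - G1 * H) + - (G * H1) * (G' * H2 - G2 * H')"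
      by (simp add: algebra_simps)
    then show "null (G1 * G2 * (H * H') - G * G' * (H1 * H2))"
      using that by (simp only: null_add null_mult)
  qed (use that assms in \<open>auto intro: valid_mult\<close>)
  from frac_op[where op = "\<lambda>G H G' H'. frac (G * G') (H * H')", OF assms this]
  show ?thesis by (simp add: function_field_def)
qed

lemma add_frac:
  assumes "valid G H" "valid G' H'"
  shows "frac G H \<oplus>\<^bsub>K\<^esub> frac G' H' = frac (G * H' + G' * H) (H * H')"
proof -
  have "frac (G1 * H2 + G2 * H1) (H1 * H2) = frac (G * H' + G' * H) (H * H')"
    if "valid G1 H1" "null (G * H1 - G1 * H)" "valid G2 H2" "null (G' * H2 - G2 * H')"
    for G1 H1 G2 H2
  proof (subst frac_eq_iff)
    have "(G1 * H2 + G2 * H1) * (H * H') - (G * H' + G' * H) * (H1 * H2)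
        = - (H2 * H') * (G * H1 - G1 * H) + - (H1 * H) * (G' * H2 - G2 * H')"
      by (simp add: algebra_simps)
    then show "null ((G1 * H2 + G2 * H1) * (H * H') - (G * H' + G' * H) * (H1 * H2))"
      using that by (simp only: null_add null_mult)
  qed (use that assms in \<open>auto intro: valid_mult valid_add\<close>)
  from frac_op[where op = "\<lambda>G H G' H'. frac (G * H' + G' * H) (H * H')", OF assms this]
  show ?thesis by (simp add: function_field_def)
qed

lemma one_frac: "\<one>\<^bsub>K\<^esub> = frac 1 1" and zero_frac: "\<zero>\<^bsub>K\<^esub> = frac 0 1"
  by (simp_all add: function_field_def)

lemma valid_const: "valid (single 0 c) 1"
  by (rule validI[of 0]) (auto intro: homogeneous_single)

lemma valid_zero_one [simp]: "valid 0 1" "valid 1 1"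
  using valid_const[of 0] valid_const[of 1] by simp_all

lemma frac_zero_iff: "valid G H \<Longrightarrow> frac G H = \<zero>\<^bsub>K\<^esub> \<longleftrightarrow> null G"
  unfolding zero_frac by (subst frac_eq_iff) auto

lemma cring_K: "cring K"
proof (rule cringI)
  show "abelian_group K"
  proof (rule abelian_groupI)
    fix x y z assume xyz: "x \<in> carrier K" "y \<in> carrier K" "z \<in> carrier K"
    obtain G H where x: "valid G H" "x = frac G H" using xyz(1) by (rule carrierE)
    obtain G' H' where y: "valid G' H'" "y = frac G' H'" using xyz(2) by (rule carrierE)
    obtain G'' H'' where z: "valid G'' H''" "z = frac G'' H''" using xyz(3) by (rule carrierE)
    show "x \<oplus>\<^bsub>K\<^esub> y \<oplus>\<^bsub>K\<^esub> z = x \<oplus>\<^bsub>K\<^esub> (y \<oplus>\<^bsub>K\<^esub> z)"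
      using x y z by (simp add: add_frac valid_add algebra_simps)
  next
    fix x y assume xy: "x \<in> carrier K" "y \<in> carrier K"
    obtain G H where x: "valid G H" "x = frac G H" using xy(1) by (rule carrierE)
    obtain G' H' where y: "valid G' H'" "y = frac G' H'" using xy(2) by (rule carrierE)
    show "x \<oplus>\<^bsub>K\<^esub> y \<in> carrier K" using x y by (simp add: add_frac valid_add frac_carrier)
    show "x \<oplus>\<^bsub>K\<^esub> y = y \<oplus>\<^bsub>K\<^esub> x" using x y by (simp add: add_frac algebra_simps)
  next
    fix x assume "x \<in> carrier K"
    then obtain G H where x: "valid G H" "x = frac G H" by (rule carrierE)
    show "\<zero>\<^bsub>K\<^esub> \<oplus>\<^bsub>K\<^esub> x = x" using x by (simp add: zero_frac add_frac)
    have "frac (- G) H \<oplus>\<^bsub>K\<^esub> x = \<zero>\<^bsub>K\<^esub>"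
      using x valid_add[OF valid_uminus[OF x(1)] x(1)] by (simp add: add_frac valid_uminus frac_zero_iff)
    then show "\<exists>y\<in>carrier K. y \<oplus>\<^bsub>K\<^esub> x = \<zero>\<^bsub>K\<^esub>"
      using frac_carrier[OF valid_uminus[OF x(1)]] by blast
  qed (simp add: zero_frac frac_carrier)
  show "comm_monoid K"
  proof (rule comm_monoidI)
    fix x y z assume xyz: "x \<in> carrier K" "y \<in> carrier K" "z \<in> carrier K"
    obtain G H where x: "valid G H" "x = frac G H" using xyz(1) by (rule carrierE)
    obtain G' H' where y: "valid G' H'" "y = frac G' H'" using xyz(2) by (rule carrierE)
    obtain G'' H'' where z: "valid G'' H''" "z = frac G'' H''" using xyz(3) by (rule carrierE)
    show "x \<otimes>\<^bsub>K\<^esub> y \<otimes>\<^bsub>K\<^esub> z = x \<otimes>\<^bsub>K\<^esub> (y \<otimes>\<^bsub>K\<^esub> z)"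
      using x y z by (simp add: mult_frac valid_mult mult.assoc)
  next
    fix x y assume xy: "x \<in> carrier K" "y \<in> carrier K"
    obtain G H where x: "valid G H" "x = frac G H" using xy(1) by (rule carrierE)
    obtain G' H' where y: "valid G' H'" "y = frac G' H'" using xy(2) by (rule carrierE)
    show "x \<otimes>\<^bsub>K\<^esub> y \<in> carrier K" using x y by (simp add: mult_frac valid_mult frac_carrier)
    show "x \<otimes>\<^bsub>K\<^esub> y = y \<otimes>\<^bsub>K\<^esub> x" using x y by (simp add: mult_frac mult.commute)
  next
    fix x assume "x \<in> carrier K"
    then obtain G H where x: "valid G H" "x = frac G H" by (rule carrierE)
    show "\<one>\<^bsub>K\<^esub> \<otimes>\<^bsub>K\<^esub> x = x" using x by (simp add: one_frac mult_frac)
  qed (simp add: one_frac frac_carrier)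
  fix x y z assume xyz: "x \<in> carrier K" "y \<in> carrier K" "z \<in> carrier K"
  obtain G H where x: "valid G H" "x = frac G H" using xyz(1) by (rule carrierE)
  obtain G' H' where y: "valid G' H'" "y = frac G' H'" using xyz(2) by (rule carrierE)
  obtain G'' H'' where z: "valid G'' H''" "z = frac G'' H''" using xyz(3) by (rule carrierE)
  have v: "valid (G * H' + G' * H) (H * H')" "valid (G * G'') (H * H'')" "valid (G' * G'') (H' * H'')"
    using x y z by (auto intro: valid_mult valid_add)
  show "(x \<oplus>\<^bsub>K\<^esub> y) \<otimes>\<^bsub>K\<^esub> z = x \<otimes>\<^bsub>K\<^esub> z \<oplus>\<^bsub>K\<^esub> y \<otimes>\<^bsub>K\<^esub> z"
    unfolding x(2) y(2) z(2) add_frac[OF x(1) y(1)] mult_frac[OF x(1) z(1)] mult_frac[OF y(1) z(1)]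
      mult_frac[OF v(1) z(1)] add_frac[OF v(2,3)]
    using x y z v by (intro frac_cong valid_mult valid_add) (auto simp: algebra_simps)
qed

lemma inverse_frac:
  assumes "valid G H" "\<not> null G"
  shows "valid H G" "frac G H \<otimes>\<^bsub>K\<^esub> frac H G = \<one>\<^bsub>K\<^esub>"
proof -
  show v: "valid H G" using assms by (auto elim!: validE intro: validI)
  show "frac G H \<otimes>\<^bsub>K\<^esub> frac H G = \<one>\<^bsub>K\<^esub>"
    unfolding mult_frac[OF assms(1) v] one_frac using assms v
    by (intro frac_cong valid_mult) (auto simp: mult.commute)
qed

lemma field_K: "field K"
proof -
  interpret cring K by (rule cring_K)
  show ?thesis
  proof (rule cring_fieldI)
    have nz: "\<one>\<^bsub>K\<^esub> \<noteq> \<zero>\<^bsub>K\<^esub>" unfolding one_frac by (simp add: frac_zero_iff)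
    show "Units K = carrier K - {\<zero>\<^bsub>K\<^esub>}"
    proof (intro equalityI subsetI)
      fix x assume "x \<in> Units K"
      then show "x \<in> carrier K - {\<zero>\<^bsub>K\<^esub>}" using nz by (auto simp: Units_def)
    next
      fix x assume x: "x \<in> carrier K - {\<zero>\<^bsub>K\<^esub>}"
      then have "x \<in> carrier K" by simp
      then obtain G H where f: "valid G H" "x = frac G H" by (rule carrierE)
      then have "\<not> null G" using x frac_zero_iff by auto
      from inverse_frac[OF f(1) this] show "x \<in> Units K"
        using f x frac_carrier m_comm by (auto simp: Units_def intro!: bexI[of _ "frac H G"])
    qed
  qed
qed

sublocale K: field K by (rule field_K)

lemma minus_frac: "valid G H \<Longrightarrow> \<ominus>\<^bsub>K\<^esub> frac G H = frac (- G) H"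
proof (rule K.minus_equality)
  assume v: "valid G H"
  show "frac (- G) H \<oplus>\<^bsub>K\<^esub> frac G H = \<zero>\<^bsub>K\<^esub>"
    using v valid_add[OF valid_uminus[OF v] v] by (simp add: add_frac valid_uminus frac_zero_iff)
qed (auto intro: frac_carrier valid_uminus)

definition const :: "'k \<Rightarrow> ('i, 'k) ratfun" where "const c = frac (single 0 c) 1"

lemma const_carrier [simp]: "const c \<in> carrier K"
  by (simp add: const_def frac_carrier valid_const)

lemma const_add: "const a \<oplus>\<^bsub>K\<^esub> const b = const (a + b)"
  by (simp add: const_def add_frac valid_const single_add)

lemma const_zero: "const 0 = \<zero>\<^bsub>K\<^esub>" and const_one: "const 1 = \<one>\<^bsub>K\<^esub>"
  by (simp_all add: const_def zero_frac one_frac)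

lemma const_eq_zero_iff: "const a = \<zero>\<^bsub>K\<^esub> \<longleftrightarrow> a = 0"
proof
  assume "const a = \<zero>\<^bsub>K\<^esub>"
  then have "null (single 0 a)" by (simp add: const_def frac_zero_iff valid_const)
  then show "a = 0" using V_nonempty V_proj proj_space_nonempty by (fastforce simp: null_iff)
qed (simp add: const_zero)

lemma constants_eq: "constants V = range const"
  by (auto simp: constants_def const_def)

end

text \<open>If \<open>G * H\<close> vanishes on \<open>V\<close>, the closed sets cut out by
  \<open>G\<close> and by \<open>H\<close> cover \<open>V\<close>, so one of them is all of
  \<open>V\<close>.\<close>

lemma irred_varietyI:
  assumes closed: "closed_over_base V" and irr: "geom_irreducible V"
  shows "irred_variety V"
proof
  obtain T where T: "\<And>F. F \<in> T \<Longrightarrow> \<exists>d. homogeneous d F" "V = zero_locus (base_change ` T)"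
    using closed by (auto simp: closed_over_base_def)
  show proj: "V \<subseteq> proj_space" unfolding T by (auto simp: zero_locus_def)
  show "V \<noteq> {}" using irr by (simp add: geom_irreducible_def)
  fix d d' and G H :: "('a, 'b) mpol"
  assume G: "homogeneous d G" and H: "homogeneous d' H" and GH: "\<forall>P\<in>V. vanishes_at P (G * H)"
  define Z where "Z F = {P \<in> V. vanishes_at P F}" for F
  have cl: "zariski_closed (Z F)" if "homogeneous e F" for e F
    unfolding zariski_closed_def
  proof (intro exI[of _ "insert (base_change F) (base_change ` T)"] conjI ballI)
    show "\<exists>d. homogeneous d F'" if "F' \<in> insert (base_change F) (base_change ` T)" for F'
      using that \<open>homogeneous e F\<close> T(1) by auto
    show "Z F = zero_locus (insert (base_change F) (base_change ` T))"
      unfolding Z_def T(2) by (auto simp: zero_locus_def vanishes_at_def)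
  qed
  have "V = Z G \<union> Z H"
  proof (intro equalityI subsetI)
    fix P assume P: "P \<in> V"
    then obtain v where v: "v \<in> P" using proj proj_space_nonempty by blast
    have "eval_ac G v * eval_ac H v = 0"
      using GH P v by (auto simp: vanishes_at_iff simp flip: eval_ac_mult)
    then show "P \<in> Z G \<union> Z H"
      using P v proj G H vanishes_at_homogeneous[of P v] by (auto simp: Z_def)
  qed (auto simp: Z_def)
  then have "V = Z G \<or> V = Z H" using irr cl G H by (auto simp: geom_irreducible_def)
  then show "(\<forall>P\<in>V. vanishes_at P G) \<or> (\<forall>P\<in>V. vanishes_at P H)" by (auto simp: Z_def)
qed

section \<open>Discrete valuations\<close>

text \<open>A discrete valuation ring \<open>A\<close> with maximal ideal \<open>M\<close> generated
  by \<open>t\<close>, seen inside its quotient field. \<open>separated\<close> says that the powers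
  of \<open>M\<close> meet in zero and stands in for a noetherian hypothesis.\<close>

locale discrete_valuation = field R for R (structure) +
  fixes A M :: "'a set" and t :: 'a
  assumes O_subring: "subring A R"
    and M_sub: "M \<subseteq> A"
    and unit: "u \<in> A \<Longrightarrow> u \<notin> M \<Longrightarrow> \<exists>w\<in>A. u \<otimes> w = \<one>"
    and t_O: "t \<in> A"
    and M_gen: "f \<in> M \<longleftrightarrow> (\<exists>a\<in>A. f = a \<otimes> t)"
    and t_nz: "t \<noteq> \<zero>"
    and one_M: "\<one> \<notin> M"
    and separated: "f \<in> A \<Longrightarrow> f \<noteq> \<zero> \<Longrightarrow> \<exists>n::nat. \<forall>a\<in>A. f \<noteq> a \<otimes> t [^] n"
    and quotient: "f \<in> carrier R \<Longrightarrow> \<exists>a\<in>A. \<exists>b\<in>A. b \<noteq> \<zero> \<and> f \<otimes> b = a"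
begin

lemma O_carrier: "f \<in> A \<Longrightarrow> f \<in> carrier R"
  using subringE(1)[OF O_subring] by blast

lemma O_mult: "f \<in> A \<Longrightarrow> h \<in> A \<Longrightarrow> f \<otimes> h \<in> A"
  by (rule subringE(6)[OF O_subring])

lemma O_add: "f \<in> A \<Longrightarrow> h \<in> A \<Longrightarrow> f \<oplus> h \<in> A"
  by (rule subringE(7)[OF O_subring])

lemma O_one: "\<one> \<in> A"
  by (rule subringE(3)[OF O_subring])

lemma t_carrier: "t \<in> carrier R"
  by (rule O_carrier[OF t_O])

lemma t_pow_carrier [simp]: "t [^] (n::nat) \<in> carrier R"
  using t_carrier by simp

lemma t_pow_O: "t [^] (n::nat) \<in> A"
  by (induction n) (auto intro: O_one O_mult t_O)

lemma pow_nz: "x \<in> carrier R \<Longrightarrow> x \<noteq> \<zero> \<Longrightarrow> x [^] (n::nat) \<noteq> \<zero>"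
  by (induction n) (auto simp: integral_iff)

lemma t_pow_nz: "t [^] (n::nat) \<noteq> \<zero>"
  by (rule pow_nz[OF t_carrier t_nz])

lemma M_mult: "f \<in> M \<Longrightarrow> h \<in> A \<Longrightarrow> h \<otimes> f \<in> M"
  unfolding M_gen using O_mult O_carrier t_carrier m_assoc by metis

lemma zero_M: "\<zero> \<in> M"
  unfolding M_gen using subringE(2)[OF O_subring] t_carrier by (intro bexI[of _ \<zero>]) auto

definition unit_set :: "'a set" where "unit_set = A - M"

lemma unit_setE:
  assumes "u \<in> unit_set" obtains w where "w \<in> unit_set" "u \<otimes> w = \<one>"
proof -
  obtain w where w: "w \<in> A" "u \<otimes> w = \<one>" using unit assms by (auto simp: unit_set_def)
  have "w \<notin> M" using M_mult[of w u] w one_M assms by (auto simp: unit_set_def)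
  then show thesis using that w by (auto simp: unit_set_def)
qed

lemma unit_carrier: "u \<in> unit_set \<Longrightarrow> u \<in> carrier R"
  by (auto simp: unit_set_def O_carrier)

lemma unit_nz: "u \<in> unit_set \<Longrightarrow> u \<noteq> \<zero>"
  using zero_M by (auto simp: unit_set_def)

lemma unit_mult:
  assumes "u \<in> unit_set" "w \<in> unit_set" shows "u \<otimes> w \<in> unit_set"
proof -
  obtain w' where w': "w' \<in> unit_set" "w \<otimes> w' = \<one>" using unit_setE[OF assms(2)] .
  note c = unit_carrier[OF assms(1)] unit_carrier[OF assms(2)] unit_carrier[OF w'(1)]
  have "u \<otimes> w \<notin> M"
  proof
    assume "u \<otimes> w \<in> M"
    then have "w' \<otimes> (u \<otimes> w) \<in> M" using w' by (intro M_mult[OF \<open>u \<otimes> w \<in> M\<close>]) (auto simp: unit_set_def)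
    also have "w' \<otimes> (u \<otimes> w) = u \<otimes> (w \<otimes> w')" using c by (simp add: m_ac)
    finally show False using w' c assms by (simp add: unit_set_def)
  qed
  then show ?thesis using assms O_mult by (auto simp: unit_set_def)
qed

text \<open>Encodes that \<open>f\<close> is a unit times \<open>t\<close> to the power
  \<open>b - a\<close> without using negative exponents.\<close>

definition has_val :: "'a \<Rightarrow> int \<Rightarrow> bool" where
  "has_val f z \<longleftrightarrow> (\<exists>u\<in>unit_set. \<exists>a b :: nat. f \<otimes> t [^] a = u \<otimes> t [^] b \<and> z = int b - int a)"

definition val :: "'a \<Rightarrow> int" where "val f = (THE z. has_val f z)"

text \<open>Let \<open>n\<close> be the least exponent such that \<open>t [^] n\<close> does not
  divide \<open>f\<close>. The cofactor of the preceding power is then a unit, since an element of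
  \<open>M\<close> would supply one more factor \<open>t\<close>.\<close>

lemma O_factor:
  assumes "f \<in> A" "f \<noteq> \<zero>" obtains u and n :: nat where "u \<in> unit_set" "f = u \<otimes> t [^] n"
proof -
  define Q where "Q = (\<lambda>n::nat. \<forall>a\<in>A. f \<noteq> a \<otimes> t [^] n)"
  have ex: "\<exists>n. Q n" using separated[OF assms] by (simp add: Q_def)
  define n where "n = (LEAST n. Q n)"
  have n: "Q n" unfolding n_def using ex by (rule LeastI_ex)
  have "\<not> Q 0" using assms O_carrier by (auto simp: Q_def)
  then obtain k where k: "n = Suc k" using n by (cases n) auto
  then have "\<not> Q k" using not_less_Least[of k Q] by (simp add: n_def)
  then obtain a where a: "a \<in> A" "f = a \<otimes> t [^] k" by (auto simp: Q_def)
  have "a \<notin> M"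
  proof
    assume "a \<in> M"
    then obtain b where b: "b \<in> A" "a = b \<otimes> t" using M_gen by blast
    then have "f = b \<otimes> t [^] n" using a k O_carrier t_carrier by (simp add: m_ac)
    then show False using n b(1) unfolding Q_def by blast
  qed
  then show thesis using that[of a k] a by (simp add: unit_set_def)
qed

lemma has_val_exists:
  assumes f: "f \<in> carrier R" "f \<noteq> \<zero>" shows "\<exists>z. has_val f z"
proof -
  obtain x y where xy: "x \<in> A" "y \<in> A" "y \<noteq> \<zero>" "f \<otimes> y = x" using quotient[OF f(1)] by blast
  have "x \<noteq> \<zero>" using xy f O_carrier integral_iff by metis
  then obtain u and b :: nat where u: "u \<in> unit_set" "x = u \<otimes> t [^] b" using O_factor[OF xy(1)] by blast
  obtain w and a :: nat where w: "w \<in> unit_set" "y = w \<otimes> t [^] a" using O_factor[OF xy(2,3)] by blast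
  obtain w' where w': "w' \<in> unit_set" "w \<otimes> w' = \<one>" using unit_setE[OF w(1)] .
  note c = unit_carrier[OF u(1)] unit_carrier[OF w(1)] unit_carrier[OF w'(1)]
  have "f \<otimes> t [^] a = (w \<otimes> w') \<otimes> (f \<otimes> t [^] a)" using f w' by simp
  also have "\<dots> = w' \<otimes> (f \<otimes> y)" using w c f by (simp add: m_ac)
  also have "\<dots> = (w' \<otimes> u) \<otimes> t [^] b" using xy u c by (simp add: m_ac)
  finally show ?thesis using unit_mult[OF w'(1) u(1)] unfolding has_val_def by blast
qed

lemma unit_pow_eq:
  assumes "u \<in> unit_set" "w \<in> unit_set" "u \<otimes> t [^] (i::nat) = w \<otimes> t [^] (j::nat)" shows "j \<le> i"
proof (rule ccontr)
  assume "\<not> j \<le> i"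
  then obtain k where k: "j = i + Suc k" by (metis add_Suc_right less_imp_Suc_add not_le)
  note c = unit_carrier[OF assms(1)] unit_carrier[OF assms(2)]
  have "t [^] j = t [^] i \<otimes> (t [^] k \<otimes> t)" using t_carrier by (simp add: k m_assoc flip: nat_pow_mult)
  then have "t [^] i \<otimes> u = t [^] i \<otimes> (w \<otimes> t [^] k \<otimes> t)" using assms(3) c t_carrier by (simp add: m_ac)
  then have "u = w \<otimes> t [^] k \<otimes> t" using m_lcancel[OF t_pow_nz[of i]] c t_carrier by simp
  then have "u \<in> M" using M_gen O_mult t_pow_O assms(2) by (auto simp: unit_set_def)
  then show False using assms(1) by (simp add: unit_set_def)
qed

lemma has_val_unique:
  assumes f: "f \<in> carrier R" and z: "has_val f z" and y: "has_val f y" shows "z = y"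
proof -
  obtain u a b where u: "u \<in> unit_set" "f \<otimes> t [^] (a::nat) = u \<otimes> t [^] (b::nat)" "z = int b - int a"
    using z by (auto simp: has_val_def)
  obtain w c d where w: "w \<in> unit_set" "f \<otimes> t [^] (c::nat) = w \<otimes> t [^] (d::nat)" "y = int d - int c"
    using y by (auto simp: has_val_def)
  note c = unit_carrier[OF u(1)] unit_carrier[OF w(1)]
  have "u \<otimes> t [^] (b + c) = (f \<otimes> t [^] a) \<otimes> t [^] c"
    using u(2) c t_carrier by (simp add: m_ac flip: nat_pow_mult)
  also have "\<dots> = (f \<otimes> t [^] c) \<otimes> t [^] a" using f by (simp add: m_ac)
  also have "\<dots> = w \<otimes> t [^] (d + a)"
    using w(2) c t_carrier by (simp add: m_ac flip: nat_pow_mult)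
  finally have e: "u \<otimes> t [^] (b + c) = w \<otimes> t [^] (d + a)" .
  have "b + c = d + a" using unit_pow_eq[OF u(1) w(1) e] unit_pow_eq[OF w(1) u(1) e[symmetric]] by simp
  then show ?thesis using u w by simp
qed

lemma has_val_val: "f \<in> carrier R \<Longrightarrow> f \<noteq> \<zero> \<Longrightarrow> has_val f (val f)"
  unfolding val_def by (rule theI') (use has_val_exists has_val_unique in blast)

lemma val_eqI: "f \<in> carrier R \<Longrightarrow> has_val f z \<Longrightarrow> val f = z"
  unfolding val_def using has_val_unique by blast

lemma val_mult:
  assumes f: "f \<in> carrier R" "f \<noteq> \<zero>" and h: "h \<in> carrier R" "h \<noteq> \<zero>"
  shows "val (f \<otimes> h) = val f + val h"
proof (rule val_eqI)
  obtain u a b where u: "u \<in> unit_set" "f \<otimes> t [^] (a::nat) = u \<otimes> t [^] (b::nat)" "val f = int b - int a"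
    using has_val_val[OF f] by (auto simp: has_val_def)
  obtain w c d where w: "w \<in> unit_set" "h \<otimes> t [^] (c::nat) = w \<otimes> t [^] (d::nat)" "val h = int d - int c"
    using has_val_val[OF h] by (auto simp: has_val_def)
  note cc = unit_carrier[OF u(1)] unit_carrier[OF w(1)]
  have "(f \<otimes> h) \<otimes> t [^] (a + c) = (f \<otimes> t [^] a) \<otimes> (h \<otimes> t [^] c)"
    using f h t_carrier by (simp add: m_ac flip: nat_pow_mult)
  also have "\<dots> = (u \<otimes> w) \<otimes> t [^] (b + d)"
    using u w cc t_carrier by (simp add: m_ac flip: nat_pow_mult)
  finally have "(f \<otimes> h) \<otimes> t [^] (a + c) = (u \<otimes> w) \<otimes> t [^] (b + d)" .
  moreover have "val f + val h = int (b + d) - int (a + c)" using u w by simp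
  ultimately show "has_val (f \<otimes> h) (val f + val h)"
    unfolding has_val_def using unit_mult[OF u(1) w(1)] by blast
qed (use f h in simp)

lemma val_unit_pow: "u \<in> unit_set \<Longrightarrow> val (u \<otimes> t [^] (n::nat)) = int n"
  by (rule val_eqI, simp add: unit_carrier, unfold has_val_def, rule bexI[of _ u],
      rule exI[of _ 0], rule exI[of _ n]) (auto simp: unit_carrier)

lemma one_unit: "\<one> \<in> unit_set"
  by (simp add: unit_set_def O_one one_M)

lemma val_unit: "u \<in> unit_set \<Longrightarrow> val u = 0"
  using val_unit_pow[of u 0] unit_carrier by simp

lemma val_nonneg_iff:
  assumes f: "f \<in> carrier R" "f \<noteq> \<zero>" shows "0 \<le> val f \<longleftrightarrow> f \<in> A"
proof
  assume v: "0 \<le> val f"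
  obtain u a b where u: "u \<in> unit_set" "f \<otimes> t [^] (a::nat) = u \<otimes> t [^] (b::nat)" "val f = int b - int a"
    using has_val_val[OF f] by (auto simp: has_val_def)
  then obtain k where k: "b = a + k" using v nat_le_iff_add[of a b] by auto
  have "t [^] a \<otimes> f = t [^] a \<otimes> (u \<otimes> t [^] k)"
    using u(2) unit_carrier[OF u(1)] f t_carrier by (simp add: k m_ac flip: nat_pow_mult)
  then have "f = u \<otimes> t [^] k" using m_lcancel[OF t_pow_nz[of a]] f unit_carrier[OF u(1)] by simp
  then show "f \<in> A" using O_mult t_pow_O u(1) by (auto simp: unit_set_def)
next
  assume "f \<in> A"
  then obtain u n where "u \<in> unit_set" "f = u \<otimes> t [^] (n::nat)" using O_factor f by blast
  then show "0 \<le> val f" using val_unit_pow by simp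
qed

lemma val_pos_iff:
  assumes f: "f \<in> carrier R" "f \<noteq> \<zero>" shows "1 \<le> val f \<longleftrightarrow> f \<in> M"
proof
  assume v: "1 \<le> val f"
  then have "f \<in> A" using val_nonneg_iff[OF f] by simp
  then show "f \<in> M" using val_unit[of f] v by (auto simp: unit_set_def)
next
  assume "f \<in> M"
  then obtain a where a: "a \<in> A" "f = a \<otimes> t" using M_gen by blast
  have az: "a \<noteq> \<zero>" using a f t_carrier by auto
  have "val t = 1" using val_unit_pow[OF one_unit, of 1] t_carrier by simp
  then show "1 \<le> val f"
    using val_mult[OF O_carrier[OF a(1)] az t_carrier t_nz] a val_nonneg_iff[OF O_carrier[OF a(1)] az] by simp
qed

lemma val_one: "val \<one> = 0"
  by (rule val_unit[OF one_unit])

lemma val_inv: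
  assumes f: "f \<in> carrier R" "f \<noteq> \<zero>" shows "inv f \<in> carrier R" "inv f \<noteq> \<zero>" "val (inv f) = - val f"
proof -
  have U: "f \<in> Units R" using f field_Units by simp
  show c: "inv f \<in> carrier R" using U by simp
  have e: "f \<otimes> inv f = \<one>" using U by (rule Units_r_inv)
  show nz: "inv f \<noteq> \<zero>"
  proof
    assume "inv f = \<zero>"
    then show False using e f by simp
  qed
  show "val (inv f) = - val f" using val_mult[OF f c nz] e val_one by simp
qed

lemma val_pow: "f \<in> carrier R \<Longrightarrow> f \<noteq> \<zero> \<Longrightarrow> val (f [^] (n::nat)) = int n * val f"
  by (induction n) (auto simp: val_one val_mult pow_nz algebra_simps)

lemma val_int_pow:
  assumes f: "f \<in> carrier R" "f \<noteq> \<zero>"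
  shows "f [^] (z::int) \<in> carrier R" "f [^] z \<noteq> \<zero>" "val (f [^] z) = z * val f"
proof -
  have "f [^] z \<in> carrier R \<and> f [^] z \<noteq> \<zero> \<and> val (f [^] z) = z * val f"
  proof (cases "z < 0")
    case True
    have e: "f [^] z = inv (f [^] nat (- z))" unfolding int_pow_def2 using True by (rule if_P)
    have p: "f [^] nat (- z) \<in> carrier R" "f [^] nat (- z) \<noteq> \<zero>"
      by (rule nat_pow_closed[OF f(1)], rule pow_nz[OF f])
    have "val (inv (f [^] nat (- z))) = z * val f"
      unfolding val_inv(3)[OF p] val_pow[OF f] using True by simp
    then show ?thesis unfolding e using val_inv(1,2)[OF p] by blast
  next
    case False
    have e: "f [^] z = f [^] nat z" unfolding int_pow_def2 using False by (rule if_not_P)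
    have "val (f [^] nat z) = z * val f" unfolding val_pow[OF f] using False by simp
    then show ?thesis unfolding e using nat_pow_closed[OF f(1)] pow_nz[OF f] by blast
  qed
  then show "f [^] z \<in> carrier R" "f [^] z \<noteq> \<zero>" "val (f [^] z) = z * val f" by blast+
qed

text \<open>From \<open>t = a \<otimes> s\<close> the valuations of \<open>a\<close> and
  \<open>s\<close> add up to one, with the second at least one. This makes orders independent of the
  uniformizer, over which \<open>ord_at\<close> quantifies.\<close>

lemma val_generator:
  assumes "s \<in> A" "\<And>f. f \<in> M \<longleftrightarrow> (\<exists>a\<in>A. f = a \<otimes> s)"
  shows "s \<noteq> \<zero>" "val s = 1"
proof -
  have tM: "t \<in> M" unfolding M_gen using t_carrier by (intro bexI[OF _ O_one]) simp
  then obtain a where a: "a \<in> A" "t = a \<otimes> s" using assms(2) by blast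
  show s: "s \<noteq> \<zero>" using a t_nz O_carrier by auto
  have az: "a \<noteq> \<zero>" using a t_nz O_carrier assms(1) by auto
  note c = O_carrier[OF a(1)] O_carrier[OF assms(1)]
  have "val t = 1" using val_unit_pow[OF one_unit, of 1] t_carrier by simp
  moreover have "s \<in> M" unfolding assms(2) using c by (intro bexI[OF _ O_one]) simp
  then have "1 \<le> val s" using val_pos_iff[OF c(2) s] by simp
  ultimately show "val s = 1"
    using val_mult[OF c(1) az c(2) s] a val_nonneg_iff[OF c(1) az] by simp
qed

text \<open>Multiplication by \<open>t\<close> to the power \<open>- z\<close> reduces to
  \<open>z = 0\<close>, where the claim is closure of \<open>A\<close> under addition.\<close>

lemma val_add_ge:
  assumes f: "f \<in> carrier R" "f \<noteq> \<zero>" "z \<le> val f" and h: "h \<in> carrier R" "h \<noteq> \<zero>" "z \<le> val h"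
    and fh: "f \<oplus> h \<noteq> \<zero>"
  shows "z \<le> val (f \<oplus> h)"
proof -
  define s where "s = t [^] (- z)"
  have "val t = 1" using val_unit_pow[OF one_unit, of 1] t_carrier by simp
  then have s: "s \<in> carrier R" "s \<noteq> \<zero>" "val s = - z"
    using val_int_pow[OF t_carrier t_nz, of "- z"] by (auto simp: s_def)
  have "f \<otimes> s \<in> A" "h \<otimes> s \<in> A"
    using val_mult[OF f(1,2) s(1,2)] val_mult[OF h(1,2) s(1,2)] f h s
      val_nonneg_iff[of "f \<otimes> s"] val_nonneg_iff[of "h \<otimes> s"] by (auto simp: integral_iff)
  then have "(f \<oplus> h) \<otimes> s \<in> A" using O_add f h s by (simp add: l_distr)
  then have "0 \<le> val ((f \<oplus> h) \<otimes> s)"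
    using val_nonneg_iff[of "(f \<oplus> h) \<otimes> s"] f h s fh by (simp add: integral_iff)
  then show ?thesis using val_mult[OF _ fh s(1,2)] f h s by simp
qed

end

section \<open>Local rings\<close>

context irred_variety
begin

definition pt :: "('i, 'k) point \<Rightarrow> 'i \<Rightarrow> 'k alg_closure" where
  "pt P = (SOME v. v \<in> P)"

abbreviation local_carrier :: "('i, 'k) point \<Rightarrow> ('i, 'k) ratfun set" where
  "local_carrier P \<equiv> carrier (local_ring V P)"

lemma pt_mem: "P \<in> V \<Longrightarrow> pt P \<in> P"
  unfolding pt_def using V_proj proj_space_nonempty by (intro someI_ex[of "\<lambda>v. v \<in> P"]) blast

lemma vanishes_pt: "P \<in> V \<Longrightarrow> homogeneous d F \<Longrightarrow> vanishes_at P F \<longleftrightarrow> eval_ac F (pt P) = 0"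
  using vanishes_at_homogeneous[OF _ pt_mem] V_proj by blast

lemma not_null_pt: "P \<in> V \<Longrightarrow> eval_ac F (pt P) \<noteq> 0 \<Longrightarrow> \<not> null F"
  using pt_mem by (auto simp: null_iff)

lemma null_pt: "P \<in> V \<Longrightarrow> null F \<Longrightarrow> eval_ac F (pt P) = 0"
  using pt_mem by (auto simp: null_iff)

lemma valid_vanishes_pt:
  assumes "P \<in> V" "valid G H"
  shows "vanishes_at P G \<longleftrightarrow> eval_ac G (pt P) = 0" "vanishes_at P H \<longleftrightarrow> eval_ac H (pt P) = 0"
proof -
  obtain d where "homogeneous d G" "homogeneous d H" using assms(2) by (rule validE)
  then show "vanishes_at P G \<longleftrightarrow> eval_ac G (pt P) = 0" "vanishes_at P H \<longleftrightarrow> eval_ac H (pt P) = 0"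
    using vanishes_pt[OF assms(1)] by blast+
qed

lemma local_carrier_eq:
  "local_carrier P = {f \<in> carrier K. \<exists>(G, H)\<in>f. \<not> vanishes_at P H}"
  by (simp add: local_ring_def)

lemma local_ring_eq: "local_ring V P = K\<lparr>carrier := local_carrier P\<rparr>"
  by (simp add: local_ring_def)

lemma mem_localE:
  assumes "P \<in> V" "f \<in> local_carrier P"
  obtains G H where "valid G H" "f = frac G H" "eval_ac H (pt P) \<noteq> 0"
proof -
  obtain G H where GH: "f \<in> carrier K" "(G, H) \<in> f" "\<not> vanishes_at P H"
    using assms(2) by (auto simp: local_carrier_eq)
  note m = mem_frac[OF GH(1,2)]
  then show thesis using that[OF m] GH(3) valid_vanishes_pt(2)[OF assms(1) m(1)] by blast
qed

lemma frac_local: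
  assumes "P \<in> V" "valid G H" "eval_ac H (pt P) \<noteq> 0"
  shows "frac G H \<in> local_carrier P"
  using frac_carrier[OF assms(2)] frac_self[OF assms(2)] valid_vanishes_pt(2)[OF assms(1,2)] assms(3)
  unfolding local_carrier_eq by blast

text \<open>The definition asks for one suitable representative; cross multiplication shows that any
  representative with denominator nonzero at \<open>P\<close> decides.\<close>

lemma max_ideal_iff:
  assumes P: "P \<in> V" and v: "valid G H" and H: "eval_ac H (pt P) \<noteq> 0"
  shows "frac G H \<in> max_ideal V P \<longleftrightarrow> eval_ac G (pt P) = 0"
proof
  assume 0: "eval_ac G (pt P) = 0"
  then show "frac G H \<in> max_ideal V P"
    using frac_carrier[OF v] frac_self[OF v] valid_vanishes_pt[OF P v] H
    unfolding max_ideal_def by blast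
next
  assume m: "frac G H \<in> max_ideal V P"
  obtain G' H' where *: "(G', H') \<in> frac G H" "\<not> vanishes_at P H'" "vanishes_at P G'"
    using m by (auto simp: max_ideal_def)
  have v': "valid G' H'" and n: "null (G * H' - G' * H)"
    using *(1) by (simp_all add: frac_rel_iff)
  have "eval_ac G (pt P) * eval_ac H' (pt P) = eval_ac G' (pt P) * eval_ac H (pt P)"
    using null_pt[OF P n] by (simp add: eval_ac_diff eval_ac_mult)
  then show "eval_ac G (pt P) = 0" using * valid_vanishes_pt[OF P v'] by auto
qed

lemma max_ideal_sub: "max_ideal V P \<subseteq> local_carrier P"
  by (auto simp: max_ideal_def local_carrier_eq)

lemma local_subring:
  assumes P: "P \<in> V" shows "subring (local_carrier P) K"
proof (rule K.subringI)
  show "local_carrier P \<subseteq> carrier K" by (auto simp: local_carrier_eq)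
  show "\<one>\<^bsub>K\<^esub> \<in> local_carrier P" unfolding one_frac by (rule frac_local[OF P]) auto
  fix f assume "f \<in> local_carrier P"
  then obtain G H where f: "valid G H" "f = frac G H" "eval_ac H (pt P) \<noteq> 0" by (rule mem_localE[OF P])
  show "\<ominus>\<^bsub>K\<^esub> f \<in> local_carrier P"
    unfolding f(2) minus_frac[OF f(1)] by (rule frac_local[OF P valid_uminus[OF f(1)] f(3)])
  fix h assume "h \<in> local_carrier P"
  then obtain G' H' where h: "valid G' H'" "h = frac G' H'" "eval_ac H' (pt P) \<noteq> 0" by (rule mem_localE[OF P])
  have nz: "eval_ac (H * H') (pt P) \<noteq> 0" using f(3) h(3) by (simp add: eval_ac_mult)
  show "f \<otimes>\<^bsub>K\<^esub> h \<in> local_carrier P"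
    unfolding f(2) h(2) mult_frac[OF f(1) h(1)] by (rule frac_local[OF P valid_mult[OF f(1) h(1)] nz])
  show "f \<oplus>\<^bsub>K\<^esub> h \<in> local_carrier P"
    unfolding f(2) h(2) add_frac[OF f(1) h(1)] by (rule frac_local[OF P valid_add[OF f(1) h(1)] nz])
qed

lemma local_cring:
  assumes P: "P \<in> V" shows "cring (local_ring V P)"
proof -
  have "cring (K\<lparr>carrier := local_carrier P\<rparr>)"
    using K.subcring_iff[OF subringE(1)[OF local_subring[OF P]]] K.subcringI'[OF local_subring[OF P]]
    by blast
  then show ?thesis by (simp only: local_ring_eq[symmetric])
qed

lemma local_mult [simp]: "x \<otimes>\<^bsub>local_ring V P\<^esub> y = x \<otimes>\<^bsub>K\<^esub> y" "\<one>\<^bsub>local_ring V P\<^esub> = \<one>\<^bsub>K\<^esub>"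
  by (simp_all add: local_ring_def)

lemma local_unit:
  assumes P: "P \<in> V" and u: "u \<in> local_carrier P" "u \<notin> max_ideal V P"
  shows "\<exists>w\<in>local_carrier P. u \<otimes>\<^bsub>K\<^esub> w = \<one>\<^bsub>K\<^esub>"
proof -
  obtain G H where f: "valid G H" "u = frac G H" "eval_ac H (pt P) \<noteq> 0" using u(1) by (rule mem_localE[OF P])
  have G: "eval_ac G (pt P) \<noteq> 0" using u(2) max_ideal_iff[OF P f(1,3)] f(2) by simp
  note inv = inverse_frac[OF f(1) not_null_pt[OF P G]]
  show ?thesis unfolding f(2) using inv(2) frac_local[OF P inv(1) G] by blast
qed

lemma one_max_ideal: "P \<in> V \<Longrightarrow> \<one>\<^bsub>K\<^esub> \<notin> max_ideal V P"
  unfolding one_frac by (subst max_ideal_iff) auto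

lemma max_ideal_mult:
  assumes P: "P \<in> V" and f: "f \<in> max_ideal V P" and h: "h \<in> local_carrier P"
  shows "f \<otimes>\<^bsub>K\<^esub> h \<in> max_ideal V P"
proof -
  have "f \<in> local_carrier P" using f max_ideal_sub by blast
  then obtain G H where f': "valid G H" "f = frac G H" "eval_ac H (pt P) \<noteq> 0" by (rule mem_localE[OF P])
  obtain G' H' where h': "valid G' H'" "h = frac G' H'" "eval_ac H' (pt P) \<noteq> 0" using h by (rule mem_localE[OF P])
  have "eval_ac G (pt P) = 0" using f f' max_ideal_iff[OF P f'(1,3)] by simp
  then show ?thesis
    unfolding f'(2) h'(2) mult_frac[OF f'(1) h'(1)] using f'(3) h'(3)
    by (subst max_ideal_iff[OF P valid_mult[OF f'(1) h'(1)]]) (auto simp: eval_ac_mult)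
qed

lemma local_Units:
  assumes P: "P \<in> V" shows "Units (local_ring V P) = local_carrier P - max_ideal V P"
proof (intro equalityI subsetI)
  fix u assume "u \<in> Units (local_ring V P)"
  then obtain w where w: "u \<in> local_carrier P" "w \<in> local_carrier P" "u \<otimes>\<^bsub>K\<^esub> w = \<one>\<^bsub>K\<^esub>"
    by (auto simp: Units_def)
  then show "u \<in> local_carrier P - max_ideal V P"
    using max_ideal_mult[OF P, of u w] one_max_ideal[OF P] by auto
next
  fix u assume u: "u \<in> local_carrier P - max_ideal V P"
  then obtain w where w: "w \<in> local_carrier P" "u \<otimes>\<^bsub>K\<^esub> w = \<one>\<^bsub>K\<^esub>" using local_unit[OF P] by blast
  have "w \<otimes>\<^bsub>K\<^esub> u = \<one>\<^bsub>K\<^esub>"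
    using w u subringE(1)[OF local_subring[OF P]] K.m_comm[of u w] by auto
  then show "u \<in> Units (local_ring V P)" using u w by (auto simp: Units_def)
qed

lemma uniformizer_iff:
  assumes P: "P \<in> V"
  shows "uniformizer V P t \<longleftrightarrow>
    t \<in> local_carrier P \<and> (\<forall>f. f \<in> max_ideal V P \<longleftrightarrow> (\<exists>a\<in>local_carrier P. f = a \<otimes>\<^bsub>K\<^esub> t))"
proof -
  interpret L: cring "local_ring V P" by (rule local_cring[OF P])
  have "Idl\<^bsub>local_ring V P\<^esub> {t} = {a \<otimes>\<^bsub>K\<^esub> t |a. a \<in> local_carrier P}" if "t \<in> local_carrier P"
    using L.cgenideal_eq_genideal[OF that] by (simp add: cgenideal_def)
  then show ?thesis by (auto simp: uniformizer_def)
qed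

lemma pt_coordinate:
  assumes P: "P \<in> V" obtains i where "pt P i \<noteq> 0"
proof -
  obtain u where u: "P = proj_point u" "u \<noteq> (\<lambda>_. 0)" using P V_proj by (auto simp: proj_space_def)
  obtain c where "c \<noteq> 0" "pt P = (\<lambda>i. c * u i)"
    using pt_mem[OF P] u(1) by (auto simp: proj_point_def)
  then show thesis using that u(2) by (auto simp: fun_eq_iff)
qed

text \<open>Numerator and denominator are both divided by a power of a coordinate that does not
  vanish at \<open>P\<close>.\<close>

lemma local_quotient:
  assumes P: "P \<in> V" and f: "f \<in> carrier K"
  shows "\<exists>a\<in>local_carrier P. \<exists>b\<in>local_carrier P. b \<noteq> \<zero>\<^bsub>K\<^esub> \<and> f \<otimes>\<^bsub>K\<^esub> b = a"
proof -
  obtain G H where v: "valid G H" and fe: "f = frac G H" using f by (rule carrierE)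
  obtain d where d: "homogeneous d G" "homogeneous d H" "\<not> null H" using v by (rule validE)
  obtain i where i: "pt P i \<noteq> 0" using pt_coordinate[OF P] .
  define T :: "('i, 'k) mpol" where "T = single (single i d) 1"
  have T: "homogeneous d T" "eval_ac T (pt P) \<noteq> 0"
    using i by (auto simp: T_def intro!: homogeneous_single)
  have T0: "\<not> null T" by (rule not_null_pt[OF P T(2)])
  have vG: "valid G T" and vH: "valid H T" using d T(1) T0 by (auto intro: validI)
  have "f \<otimes>\<^bsub>K\<^esub> frac H T = frac G T"
    unfolding fe mult_frac[OF v vH] using v vH vG
    by (intro frac_cong valid_mult) (auto simp: mult_ac)
  moreover have "frac H T \<noteq> \<zero>\<^bsub>K\<^esub>" unfolding frac_zero_iff[OF vH] by (rule d(3))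
  ultimately show ?thesis
    by (intro bexI[OF _ frac_local[OF P vG T(2)]] bexI[OF _ frac_local[OF P vH T(2)]] conjI)
qed

text \<open>
  If \<open>f = a n * t ^ n\<close> for all \<open>n\<close>, the forms \<open>F\<close> for which \<open>F\<close> divided by a power of a coordinate not
  vanishing at \<open>P\<close> lies in the ideal of \<open>a n\<close> give a strictly increasing chain of homogeneous ideals.
\<close>

lemma local_separated:
  assumes P: "P \<in> V" and t: "t \<in> local_carrier P" "t \<in> max_ideal V P" "t \<noteq> \<zero>\<^bsub>K\<^esub>"
    and f: "f \<in> local_carrier P" "f \<noteq> \<zero>\<^bsub>K\<^esub>"
  shows "\<exists>n::nat. \<forall>a\<in>local_carrier P. f \<noteq> a \<otimes>\<^bsub>K\<^esub> t [^]\<^bsub>K\<^esub> n"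
proof (rule ccontr)
  assume "\<not> ?thesis"
  then have "\<forall>n::nat. \<exists>a\<in>local_carrier P. f = a \<otimes>\<^bsub>K\<^esub> t [^]\<^bsub>K\<^esub> n" by blast
  then obtain a where a: "\<And>n::nat. a n \<in> local_carrier P" "\<And>n. f = a n \<otimes>\<^bsub>K\<^esub> t [^]\<^bsub>K\<^esub> n" by metis
  note sub = subsetD[OF subringE(1)[OF local_subring[OF P]]]
  have ac: "a n \<in> carrier K" for n using a(1) sub by blast
  have tc: "t \<in> carrier K" using t sub by blast
  have tn: "t [^]\<^bsub>K\<^esub> n \<noteq> \<zero>\<^bsub>K\<^esub>" for n :: nat
    by (induction n) (use tc t(3) in \<open>auto simp: K.integral_iff\<close>)
  have an: "a n \<noteq> \<zero>\<^bsub>K\<^esub>" for n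
  proof
    assume "a n = \<zero>\<^bsub>K\<^esub>"
    then have "a n \<otimes>\<^bsub>K\<^esub> t [^]\<^bsub>K\<^esub> n = \<zero>\<^bsub>K\<^esub>" using tc by simp
    then show False using f(2) a(2)[of n] by simp
  qed
  have step: "a n = t \<otimes>\<^bsub>K\<^esub> a (Suc n)" for n
  proof -
    have "a n \<otimes>\<^bsub>K\<^esub> t [^]\<^bsub>K\<^esub> n = a (Suc n) \<otimes>\<^bsub>K\<^esub> t [^]\<^bsub>K\<^esub> (Suc n)"
      by (rule trans[OF a(2)[of n, symmetric] a(2)])
    then have "t [^]\<^bsub>K\<^esub> n \<otimes>\<^bsub>K\<^esub> a n = t [^]\<^bsub>K\<^esub> n \<otimes>\<^bsub>K\<^esub> (t \<otimes>\<^bsub>K\<^esub> a (Suc n))"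
      using ac[of n] ac[of "Suc n"] tc by (simp add: K.m_ac)
    then show ?thesis using K.m_lcancel[OF tn[of n]] ac tc by simp
  qed
  obtain i where i: "pt P i \<noteq> 0" using pt_coordinate[OF P] .
  define T :: "nat \<Rightarrow> ('i, 'k) mpol" where "T d = single (single i d) 1" for d
  have T: "homogeneous d (T d)" "eval_ac (T d) (pt P) \<noteq> 0" "\<not> null (T d)" for d
    using i not_null_pt[OF P, of "T d"] by (auto simp: T_def intro!: homogeneous_single)
  have vT: "valid F (T d)" if "homogeneous d F" for F d using that T by (auto intro: validI)
  have Tadd: "T (d + d') = T d * T d'" for d d' by (simp add: T_def mult_single single_add)
  define J where "J n = {F. \<exists>d. homogeneous d F \<and> (\<exists>b\<in>local_carrier P. frac F (T d) = b \<otimes>\<^bsub>K\<^esub> a n)}" for n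
  have zero_frac_T: "frac 0 (T d) = \<zero>\<^bsub>K\<^esub>" for d using frac_zero_iff[OF vT[of d 0]] by simp
  \<comment> \<open>\<open>J n\<close> only provides some degree \<open>d\<close>; it is unique for
    nonzero \<open>F\<close>, and for \<open>F = 0\<close> every degree works with cofactor
    zero.\<close>
  have J_deg: "\<exists>b\<in>local_carrier P. frac F (T d) = b \<otimes>\<^bsub>K\<^esub> a n" if F: "F \<in> J n" "homogeneous d F" for F d n
  proof (cases "F = 0")
    case True
    then show ?thesis using zero_frac_T ac subringE(2)[OF local_subring[OF P]]
      by (intro bexI[of _ "\<zero>\<^bsub>K\<^esub>"]) auto
  next
    case False
    then show ?thesis using F homogeneous_unique[OF _ F(2)] unfolding J_def by blast
  qed
  have ideal: "form_ideal (J n)" for n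
    unfolding form_ideal_def
  proof (intro conjI ballI allI impI)
    show "0 \<in> J n" unfolding J_def
      using zero_frac_T[of 0] ac subringE(2)[OF local_subring[OF P]]
      by (intro CollectI exI[of _ 0] conjI bexI[of _ "\<zero>\<^bsub>K\<^esub>"]) auto
    show "\<exists>d. homogeneous d F" if "F \<in> J n" for F using that by (auto simp: J_def)
    show "F - G \<in> J n" if FG: "F \<in> J n" "G \<in> J n" "homogeneous d F \<and> homogeneous d G" for F G d
    proof -
      obtain b c where b: "b \<in> local_carrier P" "frac F (T d) = b \<otimes>\<^bsub>K\<^esub> a n"
        and c: "c \<in> local_carrier P" "frac G (T d) = c \<otimes>\<^bsub>K\<^esub> a n"
        using J_deg[OF FG(1)] J_deg[OF FG(2)] FG(3) by blast
      have hom: "homogeneous d F" "homogeneous d G" "homogeneous d (F - G)"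
        using FG(3) homogeneous_diff by auto
      have "frac (F - G) (T d) = frac F (T d) \<ominus>\<^bsub>K\<^esub> frac G (T d)"
        unfolding a_minus_def minus_frac[OF vT[OF hom(2)]] add_frac[OF vT[OF hom(1)] valid_uminus[OF vT[OF hom(2)]]]
        using valid_add[OF vT[OF hom(1)] valid_uminus[OF vT[OF hom(2)]]] vT[OF hom(3)]
        by (intro frac_cong) (auto simp: algebra_simps)
      also have "\<dots> = (b \<ominus>\<^bsub>K\<^esub> c) \<otimes>\<^bsub>K\<^esub> a n"
        using b c sub ac by (simp add: K.l_distr K.l_minus a_minus_def)
      finally have e: "frac (F - G) (T d) = (b \<ominus>\<^bsub>K\<^esub> c) \<otimes>\<^bsub>K\<^esub> a n" .
      have "b \<ominus>\<^bsub>K\<^esub> c \<in> local_carrier P"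
        unfolding a_minus_def using b(1) c(1) subringE(5,7)[OF local_subring[OF P]] by blast
      then show ?thesis unfolding J_def using hom(3) e by blast
    qed
    show "single e c * F \<in> J n" if F: "F \<in> J n" for F e c
    proof -
      obtain d b where d: "homogeneous d F" and b: "b \<in> local_carrier P" "frac F (T d) = b \<otimes>\<^bsub>K\<^esub> a n"
        using F by (auto simp: J_def)
      have he: "homogeneous (mdeg e) (single e c)" by (rule homogeneous_single) simp
      have l: "frac (single e c) (T (mdeg e)) \<in> local_carrier P"
        by (rule frac_local[OF P vT[OF he] T(2)])
      have "frac (single e c * F) (T (mdeg e + d)) = (frac (single e c) (T (mdeg e)) \<otimes>\<^bsub>K\<^esub> b) \<otimes>\<^bsub>K\<^esub> a n"
        unfolding Tadd mult_frac[OF vT[OF he] vT[OF d], symmetric] b(2)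
        using l b(1) sub ac by (simp add: K.m_assoc)
      then show ?thesis unfolding J_def
        using homogeneous_mult[OF he d] subringE(6)[OF local_subring[OF P] l b(1)] by blast
    qed
  qed
  have mono: "J n \<subseteq> J (Suc n)" for n
  proof
    fix F assume "F \<in> J n"
    then obtain d b where d: "homogeneous d F" and b: "b \<in> local_carrier P" "frac F (T d) = b \<otimes>\<^bsub>K\<^esub> a n"
      by (auto simp: J_def)
    have "frac F (T d) = (b \<otimes>\<^bsub>K\<^esub> t) \<otimes>\<^bsub>K\<^esub> a (Suc n)"
      using b step[of n] ac tc sub by (simp add: K.m_assoc)
    then show "F \<in> J (Suc n)" unfolding J_def
      using d subringE(6)[OF local_subring[OF P] b(1) t(1)] by blast
  qed
  obtain n where n: "J (Suc n) \<subseteq> J n" using form_ideals_stabilize[where J = J, OF ideal mono] .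
  \<comment> \<open>The numerator \<open>G\<close> of \<open>a (Suc n)\<close> lies in
    \<open>J (Suc n)\<close>, hence in \<open>J n\<close>. So \<open>G / T\<close> is both
    \<open>(H / T) a (Suc n)\<close> and \<open>b t a (Suc n)\<close>; cancelling puts
    \<open>H / T\<close> into the maximal ideal, although \<open>H\<close> is nonzero at
    \<open>P\<close>.\<close>
  obtain G H where GH: "valid G H" "a (Suc n) = frac G H" "eval_ac H (pt P) \<noteq> 0"
    using a(1)[of "Suc n"] by (rule mem_localE[OF P])
  obtain d where d: "homogeneous d G" "homogeneous d H" using GH(1) by (rule validE)
  have hl: "frac H (T d) \<in> local_carrier P" by (rule frac_local[OF P vT[OF d(2)] T(2)])
  have e: "frac G (T d) = frac H (T d) \<otimes>\<^bsub>K\<^esub> a (Suc n)"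
    unfolding GH(2) mult_frac[OF vT[OF d(2)] GH(1)]
    using vT[OF d(1)] valid_mult[OF vT[OF d(2)] GH(1)] by (intro frac_cong) (auto simp: mult_ac)
  have "G \<in> J (Suc n)" unfolding J_def using d(1) hl e by blast
  then have "G \<in> J n" using n by blast
  then obtain b where b: "b \<in> local_carrier P" "frac G (T d) = b \<otimes>\<^bsub>K\<^esub> a n" using J_deg d(1) by blast
  have "a (Suc n) \<otimes>\<^bsub>K\<^esub> frac H (T d) = a (Suc n) \<otimes>\<^bsub>K\<^esub> (t \<otimes>\<^bsub>K\<^esub> b)"
    using e b step[of n] ac tc sub hl by (simp add: K.m_ac)
  then have "frac H (T d) = t \<otimes>\<^bsub>K\<^esub> b"
    using K.m_lcancel[OF an[of "Suc n"] ac] sub[OF hl] tc sub[OF b(1)] by simp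
  then have "frac H (T d) \<in> max_ideal V P" using max_ideal_mult[OF P t(2) b(1)] by simp
  then show False using max_ideal_iff[OF P vT[OF d(2)] T(2)] GH(3) by simp
qed

lemma discrete_valuation_at:
  assumes P: "P \<in> V" and t: "uniformizer V P t" and nz: "\<exists>f\<in>max_ideal V P. f \<noteq> \<zero>\<^bsub>K\<^esub>"
  shows "discrete_valuation K (local_carrier P) (max_ideal V P) t"
proof (intro discrete_valuation.intro discrete_valuation_axioms.intro field_K)
  have t1: "t \<in> local_carrier P" and gen: "\<And>f. f \<in> max_ideal V P \<longleftrightarrow> (\<exists>a\<in>local_carrier P. f = a \<otimes>\<^bsub>K\<^esub> t)"
    using t uniformizer_iff[OF P] by auto
  note sub = subsetD[OF subringE(1)[OF local_subring[OF P]]]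
  show "subring (local_carrier P) K" by (rule local_subring[OF P])
  show "max_ideal V P \<subseteq> local_carrier P" by (rule max_ideal_sub)
  show "\<exists>w\<in>local_carrier P. u \<otimes>\<^bsub>K\<^esub> w = \<one>\<^bsub>K\<^esub>" if "u \<in> local_carrier P" "u \<notin> max_ideal V P" for u
    using local_unit[OF P that] .
  show "t \<in> local_carrier P" by (rule t1)
  show "f \<in> max_ideal V P \<longleftrightarrow> (\<exists>a\<in>local_carrier P. f = a \<otimes>\<^bsub>K\<^esub> t)" for f by (rule gen)
  show t0: "t \<noteq> \<zero>\<^bsub>K\<^esub>" using nz gen sub by auto
  show "\<one>\<^bsub>K\<^esub> \<notin> max_ideal V P" by (rule one_max_ideal[OF P])
  have tM: "t \<in> max_ideal V P"
    unfolding gen using sub[OF t1] by (intro bexI[OF _ subringE(3)[OF local_subring[OF P]]]) simp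
  show "\<exists>n::nat. \<forall>a\<in>local_carrier P. f \<noteq> a \<otimes>\<^bsub>K\<^esub> t [^]\<^bsub>K\<^esub> n" if "f \<in> local_carrier P" "f \<noteq> \<zero>\<^bsub>K\<^esub>" for f
    by (rule local_separated[OF P t1 tM t0 that])
  show "\<exists>a\<in>local_carrier P. \<exists>b\<in>local_carrier P. b \<noteq> \<zero>\<^bsub>K\<^esub> \<and> f \<otimes>\<^bsub>K\<^esub> b = a" if "f \<in> carrier K" for f
    by (rule local_quotient[OF P that])
qed

end

section \<open>Orders at the points of a smooth curve\<close>

text \<open>A nonzero polynomial of least degree with root \<open>c \<noteq> 0\<close> works: with
  zero constant term it could be divided by the variable.\<close>

lemma alg_closure_poly_nonzero_const:
  fixes c :: "'k::field alg_closure"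
  assumes "c \<noteq> 0"
  obtains p :: "'k Polynomial.poly" where "Polynomial.poly (map_poly to_ac p) c = 0" "Polynomial.coeff p 0 \<noteq> 0"
proof -
  define A where "A p \<longleftrightarrow> p \<noteq> 0 \<and> Polynomial.poly (map_poly to_ac p) c = 0" for p :: "'k Polynomial.poly"
  obtain p0 where "A p0" using alg_closure_algebraic[of c] unfolding A_def by blast
  then obtain p where p: "A p" "\<And>q. A q \<Longrightarrow> Polynomial.degree p \<le> Polynomial.degree q"
    using ex_has_least_nat[of A p0 Polynomial.degree] by blast
  have "Polynomial.coeff p 0 \<noteq> 0"
  proof
    assume "Polynomial.coeff p 0 = 0"
    then obtain q where q: "p = pCons 0 q" by (cases p) auto
    then have "q \<noteq> 0" using p(1) by (auto simp: A_def)
    moreover have "Polynomial.poly (map_poly to_ac q) c = 0"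
      using p(1) assms \<open>q \<noteq> 0\<close> by (auto simp: A_def q map_poly_pCons)
    ultimately have "Polynomial.degree p \<le> Polynomial.degree q" using p(2) by (simp add: A_def)
    then show False using \<open>q \<noteq> 0\<close> by (simp add: q)
  qed
  then show thesis using that p(1) unfolding A_def by blast
qed

context irred_variety
begin

lemma rational_pointE:
  assumes "Q \<in> rational_points V"
  obtains w where "Q \<in> V" "(\<lambda>i. to_ac (w i)) \<in> Q" "Q = proj_point (\<lambda>i. to_ac (w i))"
  using assms that by (auto simp: rational_points_def intro: proj_point_self)

text \<open>
  Such a form shows that no uniformizer is zero; otherwise the orders would be junk values.
\<close>

lemma separating_form:
  assumes P: "P \<in> V" and Q: "Q \<in> rational_points V" and ne: "P \<noteq> Q"
  obtains d F where "homogeneous d F" "eval_ac F (pt P) = 0" "\<not> null F"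
proof -
  obtain w where w: "Q \<in> V" "(\<lambda>i. to_ac (w i)) \<in> Q" "Q = proj_point (\<lambda>i. to_ac (w i))"
    using Q by (rule rational_pointE)
  have not_null: "\<not> null F" if "poly_eval F w \<noteq> 0" for F
    unfolding null_iff using w(1,2) that eval_ac_to_ac[of F w] to_ac_eq_0_iff by metis
  have "\<exists>i. w i \<noteq> 0"
  proof (rule ccontr)
    assume "\<nexists>i. w i \<noteq> 0"
    then have "Q = {\<lambda>_. 0}" unfolding w(3) proj_point_def by (auto intro!: exI[of _ 1])
    moreover obtain i where "pt Q i \<noteq> 0" using pt_coordinate[OF w(1)] .
    ultimately show False using pt_mem[OF w(1)] by auto
  qed
  then obtain i where i: "w i \<noteq> 0" by blast
  define x :: "'i \<Rightarrow> ('i, 'k) mpol" where "x j = single (single j 1) 1" for j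
  have x: "homogeneous 1 (x j)" "eval_ac (x j) v = v j" for j v
    by (auto simp: x_def intro!: homogeneous_single)
  define v where "v = pt P"
  show thesis
  proof (cases "v i = 0")
    case True
    have "to_ac (poly_eval (x i) w) = to_ac (w i)"
      unfolding eval_ac_to_ac[symmetric] x(2) by (rule refl)
    then have "poly_eval (x i) w \<noteq> 0" using i by simp
    moreover have "eval_ac (x i) (pt P) = 0" unfolding x(2) using True by (simp add: v_def)
    ultimately show thesis by (intro that[OF x(1)[of i]] not_null)
  next
    case False
    have "\<exists>j. v j \<noteq> to_ac (w j / w i) * v i"
    proof (rule ccontr)
      assume "\<nexists>j. v j \<noteq> to_ac (w j / w i) * v i"
      then have vj: "v j = to_ac (w j / w i) * v i" for j by blast
      have "v = (\<lambda>j. (v i / to_ac (w i)) * to_ac (w j))"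
      proof
        fix j
        have "to_ac (w j / w i) * v i = (v i / to_ac (w i)) * to_ac (w j)" by (simp add: mult.commute)
        then show "v j = (v i / to_ac (w i)) * to_ac (w j)" using vj[of j] by (rule trans[rotated])
      qed
      moreover have "v i / to_ac (w i) \<noteq> 0" using False i by simp
      ultimately have "v \<in> Q" unfolding w(3) proj_point_def by blast
      then have "Q = proj_point v" using proj_space_eq w(1) V_proj by blast
      moreover have "P = proj_point v" using proj_space_eq pt_mem[OF P] P V_proj by (auto simp: v_def)
      ultimately show False using ne by simp
    qed
    then obtain j where j: "v j \<noteq> to_ac (w j / w i) * v i" by blast
    define r where "r = w j / w i"
    define c where "c = (v j - to_ac r * v i) / v i"
    have "c \<noteq> 0" using j False by (simp add: c_def r_def)
    then obtain p :: "'k Polynomial.poly"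
      where p: "Polynomial.poly (map_poly to_ac p) c = 0" "Polynomial.coeff p 0 \<noteq> 0"
      by (rule alg_closure_poly_nonzero_const)
    define D where "D = Polynomial.degree p"
    define y where "y = x j - single 0 r * x i"
    \<comment> \<open>The homogenization of \<open>p\<close> in \<open>y\<close> and
      \<open>x i\<close>. At \<open>P\<close> the form \<open>y\<close> equals \<open>c\<close>
      times \<open>x i\<close>, so \<open>p\<close> annihilates; at \<open>Q\<close> it vanishes,
      which leaves the constant term of \<open>p\<close> times a power of \<open>w i\<close>. The
      detour by \<open>p\<close> is taken since \<open>c\<close> may lie outside the base
      field.\<close>
    define F where "F = (\<Sum>l\<le>D. single 0 (Polynomial.coeff p l) * (y ^ l * x i ^ (D - l)))"
    have "homogeneous (0 + 1) (single 0 r * x i)"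
      by (rule homogeneous_mult[OF homogeneous_single x(1)]) simp
    then have y: "homogeneous 1 y" "\<And>u. eval_ac y u = u j - to_ac r * u i"
      using homogeneous_diff[OF x(1)] x(2) by (auto simp: y_def eval_ac_diff eval_ac_mult)
    have "homogeneous D F"
      unfolding F_def
    proof (rule homogeneous_sum)
      fix l assume "l \<in> {..D}"
      then have "0 + (l * 1 + (D - l) * 1) = D" by simp
      then show "homogeneous D (single 0 (Polynomial.coeff p l) * (y ^ l * x i ^ (D - l)))"
        using homogeneous_mult[OF homogeneous_single[of 0 0 "Polynomial.coeff p l"]
            homogeneous_mult[OF homogeneous_power[OF y(1), of l] homogeneous_power[OF x(1)[of i], of "D - l"]]]
        by simp
    qed
    moreover have "eval_ac F v = 0"
    proof -
      have "eval_ac F v = (\<Sum>l\<le>D. to_ac (Polynomial.coeff p l) * ((c * v i) ^ l * v i ^ (D - l)))"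
        using False by (simp add: F_def eval_ac_sum eval_ac_mult eval_ac_power y(2) x(2) c_def)
      also have "\<dots> = (\<Sum>l\<le>D. v i ^ D * (to_ac (Polynomial.coeff p l) * c ^ l))"
      proof (rule sum.cong)
        fix l assume "l \<in> {..D}"
        then have "v i ^ D = v i ^ l * v i ^ (D - l)" by (simp flip: power_add)
        then show "to_ac (Polynomial.coeff p l) * ((c * v i) ^ l * v i ^ (D - l))
            = v i ^ D * (to_ac (Polynomial.coeff p l) * c ^ l)"
          by (simp add: power_mult_distrib mult_ac)
      qed simp
      also have "\<dots> = v i ^ D * Polynomial.poly (map_poly to_ac p) c"
        by (simp add: poly_altdef coeff_map_poly degree_map_poly D_def sum_distrib_left)
      finally show ?thesis using p(1) by simp
    qed
    moreover have "\<not> null F"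
    proof (rule not_null)
      have "to_ac (poly_eval F w) = (\<Sum>l\<le>D. to_ac (Polynomial.coeff p l) *
          ((to_ac (w j) - to_ac r * to_ac (w i)) ^ l * to_ac (w i) ^ (D - l)))"
        by (simp add: F_def eval_ac_sum eval_ac_mult eval_ac_power y(2) x(2) flip: eval_ac_to_ac)
      also have "to_ac (w j) - to_ac r * to_ac (w i) = 0" using i by (simp add: r_def)
      also have "(\<Sum>l\<le>D. to_ac (Polynomial.coeff p l) * (0 ^ l * to_ac (w i) ^ (D - l)))
          = (\<Sum>l\<le>D. if l = 0 then to_ac (Polynomial.coeff p 0) * to_ac (w i) ^ D else 0)"
        by (intro sum.cong) (auto simp: power_0_left)
      also have "\<dots> = to_ac (Polynomial.coeff p 0) * to_ac (w i) ^ D" by simp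
      finally show "poly_eval F w \<noteq> 0" using p(2) i by (metis mult_eq_0_iff power_eq_0_iff to_ac_eq_0_iff)
    qed
    ultimately show thesis unfolding v_def by (rule that)
  qed
qed

end

text \<open>\<open>Q0\<close> carries the poles. With a second rational point \<open>Q1\<close>,
  every \<open>P\<close>, even \<open>Q0\<close>, differs from some rational point, as
  \<open>separating_form\<close> requires.\<close>

locale smooth_curve = irred_variety V for V :: "('i::finite, 'k::field) point set" +
  fixes Q0 Q1 :: "('i, 'k) point"
  assumes uniformizer_exists: "P \<in> V \<Longrightarrow> \<exists>t. uniformizer V P t"
    and rational: "Q0 \<in> rational_points V" "Q1 \<in> rational_points V" "Q0 \<noteq> Q1"
begin

lemma max_ideal_nonzero:
  assumes P: "P \<in> V" shows "\<exists>f\<in>max_ideal V P. f \<noteq> \<zero>\<^bsub>K\<^esub>"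
proof -
  obtain Q where Q: "Q \<in> rational_points V" "P \<noteq> Q" using rational by metis
  obtain d F where F: "homogeneous d F" "eval_ac F (pt P) = 0" "\<not> null F"
    using separating_form[OF P Q] .
  obtain i where i: "pt P i \<noteq> 0" using pt_coordinate[OF P] .
  define T :: "('i, 'k) mpol" where "T = single (single i d) 1"
  have T: "homogeneous d T" "eval_ac T (pt P) \<noteq> 0"
    using i by (auto simp: T_def intro!: homogeneous_single)
  have v: "valid F T" using F(1) T(1) not_null_pt[OF P T(2)] by (rule validI)
  show ?thesis
    using max_ideal_iff[OF P v T(2)] F(2,3) frac_zero_iff[OF v] by (intro bexI[of _ "frac F T"]) auto
qed

definition ord :: "('i, 'k) point \<Rightarrow> ('i, 'k) ratfun \<Rightarrow> int" where
  "ord P f = ord_at V P f"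

definition valuation_at :: "('i, 'k) point \<Rightarrow> ('i, 'k) ratfun \<Rightarrow> bool" where
  "valuation_at P t \<longleftrightarrow> discrete_valuation K (local_carrier P) (max_ideal V P) t \<and>
     (\<forall>f\<in>carrier K. f \<noteq> \<zero>\<^bsub>K\<^esub> \<longrightarrow>
       ord P f = discrete_valuation.val K (local_carrier P) (max_ideal V P) t f)"

text \<open>Dividing \<open>f\<close> by the right power of a uniformizer leaves a unit, which gives
  existence in the description \<open>ord_at\<close>. All uniformizers have valuation one, which
  gives uniqueness.\<close>

lemma valuation_exists:
  assumes P: "P \<in> V" shows "\<exists>t. valuation_at P t"
proof -
  obtain t where t: "uniformizer V P t" using uniformizer_exists[OF P] by blast
  have dv: "discrete_valuation K (local_carrier P) (max_ideal V P) t"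
    by (rule discrete_valuation_at[OF P t max_ideal_nonzero[OF P]])
  interpret D: discrete_valuation K "local_carrier P" "max_ideal V P" t by (rule dv)
  have units: "Units (local_ring V P) = D.unit_set"
    unfolding D.unit_set_def by (rule local_Units[OF P])
  have gen: "s \<in> carrier K \<and> s \<noteq> \<zero>\<^bsub>K\<^esub> \<and> D.val s = 1" if "uniformizer V P s" for s
    using that D.val_generator[of s] D.O_carrier[of s] unfolding uniformizer_iff[OF P] by blast
  have "ord P f = D.val f" if f: "f \<in> carrier K" "f \<noteq> \<zero>\<^bsub>K\<^esub>" for f
    unfolding ord_def ord_at_def units
  proof (rule the_equality)
    define p where "p = t [^]\<^bsub>K\<^esub> D.val f"
    note tp = D.val_int_pow[of t "D.val f", folded p_def]
    have p: "p \<in> carrier K" "p \<noteq> \<zero>\<^bsub>K\<^esub>" "D.val p = D.val f" using tp gen[OF t] by auto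
    note ip = D.val_inv[OF p(1,2)]
    define u where "u = f \<otimes>\<^bsub>K\<^esub> inv\<^bsub>K\<^esub> p"
    have u: "u \<in> carrier K" "u \<noteq> \<zero>\<^bsub>K\<^esub>" using f ip by (auto simp: u_def K.integral_iff)
    have "D.val u = 0" unfolding u_def using D.val_mult[OF f ip(1,2)] ip(3) p(3) by simp
    then have "u \<in> D.unit_set"
      using D.val_nonneg_iff[OF u] D.val_pos_iff[OF u] by (auto simp: D.unit_set_def)
    moreover have "f = u \<otimes>\<^bsub>K\<^esub> p"
    proof -
      have "inv\<^bsub>K\<^esub> p \<otimes>\<^bsub>K\<^esub> p = \<one>\<^bsub>K\<^esub>" using p K.field_Units by (intro K.Units_l_inv) auto
      then show ?thesis unfolding u_def using f ip(1) p(1) by (simp add: K.m_assoc)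
    qed
    ultimately show "\<exists>t u. uniformizer V P t \<and> u \<in> D.unit_set \<and> f = u \<otimes>\<^bsub>K\<^esub> t [^]\<^bsub>K\<^esub> D.val f"
      using t unfolding p_def by blast
  next
    fix z :: int assume "\<exists>t u. uniformizer V P t \<and> u \<in> D.unit_set \<and> f = u \<otimes>\<^bsub>K\<^esub> t [^]\<^bsub>K\<^esub> z"
    then obtain s u where s: "uniformizer V P s" "u \<in> D.unit_set" "f = u \<otimes>\<^bsub>K\<^esub> s [^]\<^bsub>K\<^esub> z" by blast
    note sp = D.val_int_pow[of s z] gen[OF s(1)]
    have "D.val f = D.val u + D.val (s [^]\<^bsub>K\<^esub> z)"
      unfolding s(3) using sp D.unit_carrier[OF s(2)] D.unit_nz[OF s(2)] by (intro D.val_mult) auto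
    then show "z = D.val f" using sp D.val_unit[OF s(2)] by simp
  qed
  then show ?thesis using dv unfolding valuation_at_def by blast
qed

lemma ord_mult:
  assumes P: "P \<in> V" and f: "f \<in> carrier K" "f \<noteq> \<zero>\<^bsub>K\<^esub>" and h: "h \<in> carrier K" "h \<noteq> \<zero>\<^bsub>K\<^esub>"
  shows "ord P (f \<otimes>\<^bsub>K\<^esub> h) = ord P f + ord P h"
proof -
  obtain t where t: "valuation_at P t" using valuation_exists[OF P] by blast
  interpret D: discrete_valuation K "local_carrier P" "max_ideal V P" t
    using t by (simp add: valuation_at_def)
  have ord: "\<And>f. f \<in> carrier K \<Longrightarrow> f \<noteq> \<zero>\<^bsub>K\<^esub> \<Longrightarrow> ord P f = D.val f"
    using t by (simp add: valuation_at_def)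
  show ?thesis using D.val_mult[OF f h] ord f h by (simp add: K.integral_iff)
qed

lemma ord_iff:
  assumes P: "P \<in> V" and f: "f \<in> carrier K" "f \<noteq> \<zero>\<^bsub>K\<^esub>"
  shows "0 \<le> ord P f \<longleftrightarrow> f \<in> local_carrier P" "1 \<le> ord P f \<longleftrightarrow> f \<in> max_ideal V P"
proof -
  obtain t where t: "valuation_at P t" using valuation_exists[OF P] by blast
  interpret D: discrete_valuation K "local_carrier P" "max_ideal V P" t
    using t by (simp add: valuation_at_def)
  have ord: "\<And>f. f \<in> carrier K \<Longrightarrow> f \<noteq> \<zero>\<^bsub>K\<^esub> \<Longrightarrow> ord P f = D.val f"
    using t by (simp add: valuation_at_def)
  show "0 \<le> ord P f \<longleftrightarrow> f \<in> local_carrier P" "1 \<le> ord P f \<longleftrightarrow> f \<in> max_ideal V P"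
    using D.val_nonneg_iff[OF f] D.val_pos_iff[OF f] ord[OF f] by auto
qed

lemma ord_add_ge:
  assumes P: "P \<in> V" and f: "f \<in> carrier K" "f \<noteq> \<zero>\<^bsub>K\<^esub>" "z \<le> ord P f"
    and h: "h \<in> carrier K" "h \<noteq> \<zero>\<^bsub>K\<^esub>" "z \<le> ord P h" and fh: "f \<oplus>\<^bsub>K\<^esub> h \<noteq> \<zero>\<^bsub>K\<^esub>"
  shows "z \<le> ord P (f \<oplus>\<^bsub>K\<^esub> h)"
proof -
  obtain t where t: "valuation_at P t" using valuation_exists[OF P] by blast
  interpret D: discrete_valuation K "local_carrier P" "max_ideal V P" t
    using t by (simp add: valuation_at_def)
  have ord: "\<And>f. f \<in> carrier K \<Longrightarrow> f \<noteq> \<zero>\<^bsub>K\<^esub> \<Longrightarrow> ord P f = D.val f"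
    using t by (simp add: valuation_at_def)
  show ?thesis using D.val_add_ge[OF f(1,2) _ h(1,2) _ fh] f h fh ord by simp
qed

lemma ord_inv:
  assumes P: "P \<in> V" and f: "f \<in> carrier K" "f \<noteq> \<zero>\<^bsub>K\<^esub>"
  shows "inv\<^bsub>K\<^esub> f \<in> carrier K" "inv\<^bsub>K\<^esub> f \<noteq> \<zero>\<^bsub>K\<^esub>" "ord P (inv\<^bsub>K\<^esub> f) = - ord P f"
proof -
  obtain t where t: "valuation_at P t" using valuation_exists[OF P] by blast
  interpret D: discrete_valuation K "local_carrier P" "max_ideal V P" t
    using t by (simp add: valuation_at_def)
  have ord: "\<And>f. f \<in> carrier K \<Longrightarrow> f \<noteq> \<zero>\<^bsub>K\<^esub> \<Longrightarrow> ord P f = D.val f"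
    using t by (simp add: valuation_at_def)
  note i = D.val_inv[OF f]
  show "inv\<^bsub>K\<^esub> f \<in> carrier K" "inv\<^bsub>K\<^esub> f \<noteq> \<zero>\<^bsub>K\<^esub>" "ord P (inv\<^bsub>K\<^esub> f) = - ord P f"
    using i ord[OF f] ord[OF i(1,2)] by auto
qed

end

section \<open>Values and the pole filtration\<close>

context irred_variety
begin

text \<open>The quotient does not depend on the coordinate vector, because both forms have the same
  degree, nor on the fraction, by cross multiplication.\<close>

lemma value_frac:
  assumes P: "P \<in> V" and v: "valid G H" and H: "eval_ac H (pt P) \<noteq> 0"
    and u: "u \<in> P"
  shows "value_at (frac G H) P = eval_ac G u / eval_ac H u"
  unfolding value_at_def
proof (rule the_equality)
  have Pp: "P \<in> proj_space" using P V_proj by blast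
  have nz: "eval_ac H' u \<noteq> 0" if a: "valid G' H'" "x \<in> P" "eval_ac H' x \<noteq> 0" for G' H' x
  proof -
    obtain d where d: "homogeneous d G'" "homogeneous d H'" using a(1) by (rule validE)
    then show ?thesis
      using vanishes_at_homogeneous[OF Pp u d(2)] vanishes_at_homogeneous[OF Pp a(2) d(2)] a(3) by blast
  qed
  have "eval_ac H u \<noteq> 0" by (rule nz[OF v pt_mem[OF P] H])
  then show "\<exists>(G', H')\<in>frac G H. \<exists>v\<in>P. poly_eval (base_change H') v \<noteq> 0 \<and>
      eval_ac G u / eval_ac H u = poly_eval (base_change G') v / poly_eval (base_change H') v"
    using frac_self[OF v] u unfolding eval_ac_def by blast
  fix y assume "\<exists>(G', H')\<in>frac G H. \<exists>v\<in>P. poly_eval (base_change H') v \<noteq> 0 \<and>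
      y = poly_eval (base_change G') v / poly_eval (base_change H') v"
  then obtain G' H' x where *: "(G', H') \<in> frac G H" "x \<in> P" "eval_ac H' x \<noteq> 0"
    "y = eval_ac G' x / eval_ac H' x" unfolding eval_ac_def by blast
  have v': "valid G' H'" and n: "null (G * H' - G' * H)" using *(1) by (simp_all add: frac_rel_iff)
  obtain d where d: "homogeneous d G'" "homogeneous d H'" using v' by (rule validE)
  obtain c where c: "c \<noteq> 0" "x = (\<lambda>i. c * u i)" using proj_space_scaled[OF Pp u *(2)] .
  have y: "y = eval_ac G' u / eval_ac H' u"
    using *(4) c(1) by (simp add: c(2) eval_ac_scale[OF d(1)] eval_ac_scale[OF d(2)])
  have "eval_ac G u * eval_ac H' u = eval_ac G' u * eval_ac H u"
    using n P u by (auto simp: null_iff eval_ac_diff eval_ac_mult)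
  then show "y = eval_ac G u / eval_ac H u"
    unfolding y using \<open>eval_ac H u \<noteq> 0\<close> nz[OF v' *(2,3)] by (simp add: frac_eq_eq)
qed

lemmas value_frac_pt = value_frac[OF _ _ _ pt_mem]

lemma value_mult:
  assumes P: "P \<in> V" and f: "f \<in> local_carrier P" and h: "h \<in> local_carrier P"
  shows "value_at (f \<otimes>\<^bsub>K\<^esub> h) P = value_at f P * value_at h P"
proof -
  obtain G H where f: "valid G H" "f = frac G H" "eval_ac H (pt P) \<noteq> 0" using f by (rule mem_localE[OF P])
  obtain G' H' where h: "valid G' H'" "h = frac G' H'" "eval_ac H' (pt P) \<noteq> 0" using h by (rule mem_localE[OF P])
  have nz: "eval_ac (H * H') (pt P) \<noteq> 0" using f(3) h(3) by (simp add: eval_ac_mult)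
  show ?thesis
    unfolding f(2) h(2) mult_frac[OF f(1) h(1)] value_frac_pt[OF P f(1,3) P] value_frac_pt[OF P h(1,3) P]
      value_frac_pt[OF P valid_mult[OF f(1) h(1)] nz P]
    by (simp add: eval_ac_mult)
qed

lemma value_add:
  assumes P: "P \<in> V" and f: "f \<in> local_carrier P" and h: "h \<in> local_carrier P"
  shows "value_at (f \<oplus>\<^bsub>K\<^esub> h) P = value_at f P + value_at h P"
proof -
  obtain G H where f: "valid G H" "f = frac G H" "eval_ac H (pt P) \<noteq> 0" using f by (rule mem_localE[OF P])
  obtain G' H' where h: "valid G' H'" "h = frac G' H'" "eval_ac H' (pt P) \<noteq> 0" using h by (rule mem_localE[OF P])
  have nz: "eval_ac (H * H') (pt P) \<noteq> 0" using f(3) h(3) by (simp add: eval_ac_mult)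
  show ?thesis
    unfolding f(2) h(2) add_frac[OF f(1) h(1)] value_frac_pt[OF P f(1,3) P] value_frac_pt[OF P h(1,3) P]
      value_frac_pt[OF P valid_add[OF f(1) h(1)] nz P]
    using f(3) h(3) by (simp add: eval_ac_mult eval_ac_add add_frac_eq)
qed

lemma const_local: "P \<in> V \<Longrightarrow> const c \<in> local_carrier P"
  unfolding const_def by (rule frac_local) (auto simp: valid_const)

lemma value_const: "P \<in> V \<Longrightarrow> value_at (const c) P = to_ac c"
  unfolding const_def using value_frac_pt[of P "single 0 c" 1] by (simp add: valid_const)

lemma value_zero_iff:
  assumes P: "P \<in> V" and f: "f \<in> local_carrier P"
  shows "f \<in> max_ideal V P \<longleftrightarrow> value_at f P = 0"
proof -
  obtain G H where f: "valid G H" "f = frac G H" "eval_ac H (pt P) \<noteq> 0" using f by (rule mem_localE[OF P])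
  show ?thesis
    unfolding f(2) value_frac_pt[OF P f(1,3) P] max_ideal_iff[OF P f(1,3)] using f(3) by simp
qed

lemma value_rational:
  assumes P: "P \<in> rational_points V" and f: "f \<in> local_carrier P"
  shows "value_at f P \<in> range to_ac"
proof -
  obtain w where w: "P \<in> V" "(\<lambda>i. to_ac (w i)) \<in> P" using P by (rule rational_pointE)
  obtain G H where f: "valid G H" "f = frac G H" "eval_ac H (pt P) \<noteq> 0" using f by (rule mem_localE[OF w(1)])
  show ?thesis unfolding f(2) value_frac[OF w(1) f(1,3) w(2)] eval_ac_to_ac
    by (metis rangeI to_ac_divide)
qed

end

section \<open>The spaces of functions with poles at one rational point as a pole filtration\<close>

context smooth_curve
begin

text \<open>Extends \<open>L_space\<close> to integer bounds, so that \<open>L (a - 1)\<close> is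
  meaningful for every \<open>a\<close> and zeros at \<open>Q0\<close> are covered as well.\<close>

definition L :: "int \<Rightarrow> ('i, 'k) ratfun set" where
  "L a = {f \<in> carrier K. f = \<zero>\<^bsub>K\<^esub> \<or> (\<forall>P\<in>V. ord P f \<ge> - (if P = Q0 then a else 0))}"

definition lin :: "('i, 'k) ratfun \<Rightarrow> 'k \<Rightarrow> ('i, 'k) ratfun \<Rightarrow> ('i, 'k) ratfun" where
  "lin f c h = f \<oplus>\<^bsub>K\<^esub> (const (- c) \<otimes>\<^bsub>K\<^esub> h)"

definition ev :: "('i, 'k) ratfun \<Rightarrow> ('i, 'k) point \<Rightarrow> 'k" where
  "ev f P = of_ac (value_at f P)"

definition pts :: "('i, 'k) point set" where "pts = rational_points V - {Q0}"

lemma Q0_V: "Q0 \<in> V" using rational(1) by (auto simp: rational_points_def)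

lemma pts_V: "P \<in> pts \<Longrightarrow> P \<in> V \<and> P \<noteq> Q0 \<and> P \<in> rational_points V"
  by (auto simp: pts_def rational_points_def)

lemma L_carrier: "f \<in> L a \<Longrightarrow> f \<in> carrier K" by (simp add: L_def)

lemma L_ord: "f \<in> L a \<Longrightarrow> f \<noteq> \<zero>\<^bsub>K\<^esub> \<Longrightarrow> P \<in> V \<Longrightarrow> ord P f \<ge> - (if P = Q0 then a else 0)"
  by (simp add: L_def)

lemma L_I: "f \<in> carrier K \<Longrightarrow> (\<And>P. f \<noteq> \<zero>\<^bsub>K\<^esub> \<Longrightarrow> P \<in> V \<Longrightarrow> ord P f \<ge> - (if P = Q0 then a else 0)) \<Longrightarrow> f \<in> L a"
  unfolding L_def by blast

lemma zero_L: "\<zero>\<^bsub>K\<^esub> \<in> L a" by (simp add: L_def)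

lemma L_mono: "a \<le> b \<Longrightarrow> L a \<subseteq> L b"
proof
  fix f assume "a \<le> b" "f \<in> L a"
  show "f \<in> L b"
  proof (rule L_I[OF L_carrier[OF \<open>f \<in> L a\<close>]])
    fix P assume P: "f \<noteq> \<zero>\<^bsub>K\<^esub>" "P \<in> V"
    show "ord P f \<ge> - (if P = Q0 then b else 0)"
      using L_ord[OF \<open>f \<in> L a\<close> P] \<open>a \<le> b\<close> by (cases "P = Q0") simp_all
  qed
qed

lemma L_local: assumes "f \<in> L a" "P \<in> V" "P \<noteq> Q0" shows "f \<in> local_carrier P"
proof (cases "f = \<zero>\<^bsub>K\<^esub>")
  case True then show ?thesis using subringE(2)[OF local_subring[OF assms(2)]] by simp
next
  case False
  then show ?thesis using ord_iff(1)[OF assms(2) L_carrier[OF assms(1)] False] L_ord[OF assms(1) False assms(2)] assms(3) by simp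
qed

lemma L_exact_iff:
  assumes "f \<in> L a" shows "f \<notin> L (a - 1) \<longleftrightarrow> f \<noteq> \<zero>\<^bsub>K\<^esub> \<and> ord Q0 f = - a"
proof
  assume n: "f \<notin> L (a - 1)"
  then have nz: "f \<noteq> \<zero>\<^bsub>K\<^esub>" using zero_L by auto
  obtain P where P: "P \<in> V" "ord P f < - (if P = Q0 then a - 1 else 0)"
    using n nz L_carrier[OF assms] by (auto simp: L_def not_le)
  then have "P = Q0" using L_ord[OF assms nz P(1)] by (auto split: if_splits)
  then show "f \<noteq> \<zero>\<^bsub>K\<^esub> \<and> ord Q0 f = - a" using P L_ord[OF assms nz P(1)] nz by auto
next
  assume "f \<noteq> \<zero>\<^bsub>K\<^esub> \<and> ord Q0 f = - a"
  then show "f \<notin> L (a - 1)" using L_ord[of f "a - 1" Q0] Q0_V by auto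
qed

lemma L_mult: assumes f: "f \<in> L a" and h: "h \<in> L b" shows "f \<otimes>\<^bsub>K\<^esub> h \<in> L (a + b)"
proof (rule L_I)
  show "f \<otimes>\<^bsub>K\<^esub> h \<in> carrier K" using f h L_carrier by blast
  fix P assume nz: "f \<otimes>\<^bsub>K\<^esub> h \<noteq> \<zero>\<^bsub>K\<^esub>" and P: "P \<in> V"
  have nz': "f \<noteq> \<zero>\<^bsub>K\<^esub>" "h \<noteq> \<zero>\<^bsub>K\<^esub>" using nz L_carrier[OF f] L_carrier[OF h] by auto
  show "ord P (f \<otimes>\<^bsub>K\<^esub> h) \<ge> - (if P = Q0 then a + b else 0)"
    using ord_mult[OF P L_carrier[OF f] nz'(1) L_carrier[OF h] nz'(2)]
      L_ord[OF f nz'(1) P] L_ord[OF h nz'(2) P] by (auto split: if_splits)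
qed

lemma L_add: assumes f: "f \<in> L a" and h: "h \<in> L a" shows "f \<oplus>\<^bsub>K\<^esub> h \<in> L a"
proof (cases "f = \<zero>\<^bsub>K\<^esub> \<or> h = \<zero>\<^bsub>K\<^esub>")
  case True then show ?thesis using f h L_carrier by auto
next
  case False
  show ?thesis
  proof (rule L_I)
    show "f \<oplus>\<^bsub>K\<^esub> h \<in> carrier K" using f h L_carrier by blast
    fix P assume "f \<oplus>\<^bsub>K\<^esub> h \<noteq> \<zero>\<^bsub>K\<^esub>" "P \<in> V"
    then show "ord P (f \<oplus>\<^bsub>K\<^esub> h) \<ge> - (if P = Q0 then a else 0)"
      using False f h L_carrier L_ord by (intro ord_add_ge) auto
  qed
qed

lemma ord_const: assumes P: "P \<in> V" and c: "c \<noteq> 0" shows "ord P (const c) = 0"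
proof -
  have nz: "const c \<noteq> \<zero>\<^bsub>K\<^esub>" using c const_eq_zero_iff by simp
  have "const c \<notin> max_ideal V P" using value_zero_iff[OF P const_local[OF P]] value_const[OF P] c by simp
  then show ?thesis using ord_iff[OF P const_carrier nz] const_local[OF P] by (metis antisym_conv int_one_le_iff_zero_less linorder_not_le)
qed

lemma const_L: "const c \<in> L 0"
proof (rule L_I)
  fix P assume "const c \<noteq> \<zero>\<^bsub>K\<^esub>" "P \<in> V"
  then show "ord P (const c) \<ge> - (if P = Q0 then 0 else 0)" using ord_const[of P c] const_eq_zero_iff by simp
qed simp

lemma L_const_mult: "f \<in> L a \<Longrightarrow> const c \<otimes>\<^bsub>K\<^esub> f \<in> L a"
  using L_mult[OF const_L] by simp

lemma lin_L: "f \<in> L a \<Longrightarrow> h \<in> L a \<Longrightarrow> lin f c h \<in> L a"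
  unfolding lin_def by (intro L_add L_const_mult)

lemma lin_cancel:
  assumes f: "f \<in> L b" and h: "h \<in> L a" and l: "lin f c h \<in> L a" shows "f \<in> L a"
proof -
  have c: "f \<in> carrier K" "h \<in> carrier K" using L_carrier f h by auto
  have "lin f c h \<oplus>\<^bsub>K\<^esub> (const c \<otimes>\<^bsub>K\<^esub> h) = f \<oplus>\<^bsub>K\<^esub> ((const (- c) \<oplus>\<^bsub>K\<^esub> const c) \<otimes>\<^bsub>K\<^esub> h)"
    unfolding lin_def using c by (simp only: K.l_distr const_carrier K.a_assoc K.m_closed)
  also have "\<dots> = f" using c by (simp add: const_add const_zero)
  finally show ?thesis using L_add[OF l L_const_mult[OF h, of c]] by simp
qed

text \<open>The quotient \<open>f / h\<close> is regular at \<open>Q0\<close>, and its value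
  \<open>c\<close> there lies in the base field since \<open>Q0\<close> is rational. As
  \<open>f / h - c\<close> vanishes at \<open>Q0\<close>, multiplying by \<open>h\<close> gives
  order at least \<open>1 - a\<close>.\<close>

lemma lin_reduce:
  assumes f: "f \<in> L a" and h: "h \<in> L a" "h \<notin> L (a - 1)"
  shows "\<exists>c. lin f c h \<in> L (a - 1)"
proof -
  have hc: "h \<in> carrier K" "h \<noteq> \<zero>\<^bsub>K\<^esub>" "ord Q0 h = - a" using h L_carrier L_exact_iff by auto
  note fc = L_carrier[OF f]
  note ih = ord_inv[OF Q0_V hc(1,2)]
  define r where "r = f \<otimes>\<^bsub>K\<^esub> inv\<^bsub>K\<^esub> h"
  have rc: "r \<in> carrier K" using fc ih by (simp add: r_def)
  have rl: "r \<in> local_carrier Q0"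
  proof (cases "f = \<zero>\<^bsub>K\<^esub>")
    case True
    then show ?thesis using subringE(2)[OF local_subring[OF Q0_V]] ih by (simp add: r_def)
  next
    case False
    then have "r \<noteq> \<zero>\<^bsub>K\<^esub>" using fc ih by (simp add: r_def K.integral_iff)
    then show ?thesis
      using ord_iff(1)[OF Q0_V rc] ord_mult[OF Q0_V fc False ih(1,2)] ih(3) hc(3) L_ord[OF f False Q0_V]
      by (simp add: r_def)
  qed
  obtain c where c: "value_at r Q0 = to_ac c" using value_rational[OF rational(1) rl] by blast
  define s where "s = r \<oplus>\<^bsub>K\<^esub> const (- c)"
  have sc: "s \<in> carrier K" using rc by (simp add: s_def)
  have sl: "s \<in> local_carrier Q0"
    unfolding s_def using subringE(7)[OF local_subring[OF Q0_V]] rl const_local[OF Q0_V] by blast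
  have "value_at s Q0 = 0"
    unfolding s_def value_add[OF Q0_V rl const_local[OF Q0_V]] c value_const[OF Q0_V] by simp
  then have sM: "s \<in> max_ideal V Q0" using value_zero_iff[OF Q0_V sl] by simp
  have "inv\<^bsub>K\<^esub> h \<otimes>\<^bsub>K\<^esub> h = \<one>\<^bsub>K\<^esub>" using hc K.field_Units by (intro K.Units_l_inv) auto
  then have e: "lin f c h = s \<otimes>\<^bsub>K\<^esub> h"
    unfolding lin_def s_def r_def using fc hc(1) ih(1) by (simp add: K.l_distr K.m_assoc)
  have lL: "lin f c h \<in> L a" by (rule lin_L[OF f h(1)])
  have "lin f c h \<in> L (a - 1)"
  proof (rule ccontr)
    assume n: "lin f c h \<notin> L (a - 1)"
    then have l: "lin f c h \<noteq> \<zero>\<^bsub>K\<^esub>" "ord Q0 (lin f c h) = - a" using L_exact_iff[OF lL] by auto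
    have "s \<noteq> \<zero>\<^bsub>K\<^esub>"
    proof
      assume "s = \<zero>\<^bsub>K\<^esub>"
      then show False using l(1) e K.l_null[OF hc(1)] by simp
    qed
    then have "ord Q0 (lin f c h) \<ge> 1 - a"
      unfolding e using ord_mult[OF Q0_V sc _ hc(1,2)] ord_iff(2)[OF Q0_V sc] sM hc(3) by simp
    then show False using l by simp
  qed
  then show ?thesis by blast
qed

lemma to_ac_ev: "P \<in> pts \<Longrightarrow> f \<in> L a \<Longrightarrow> to_ac (ev f P) = value_at f P"
  unfolding ev_def using to_ac_of_ac value_rational L_local pts_V by blast

lemma value_zero: "P \<in> V \<Longrightarrow> value_at \<zero>\<^bsub>K\<^esub> P = 0"
  using value_const[of P 0] by (simp add: const_zero)

lemma L_exact_order:
  assumes f: "f \<in> L a" and f0: "f \<noteq> \<zero>\<^bsub>K\<^esub>"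
  shows "\<exists>b\<le>a. f \<in> L b \<and> f \<notin> L (b - 1)"
proof -
  define b where "b = - ord Q0 f"
  have "b \<le> a" using L_ord[OF f f0 Q0_V] by (simp add: b_def)
  moreover have fb: "f \<in> L b"
  proof (rule L_I[OF L_carrier[OF f]])
    fix R assume "R \<in> V"
    then show "ord R f \<ge> - (if R = Q0 then b else 0)"
      using L_ord[OF f f0 \<open>R \<in> V\<close>] by (simp add: b_def split: if_splits)
  qed
  moreover have "f \<notin> L (b - 1)" using L_exact_iff[OF fb] f0 by (simp add: b_def)
  ultimately show ?thesis by blast
qed

sublocale F: pole_filtration L "\<lambda>f h. f \<otimes>\<^bsub>K\<^esub> h" lin "\<one>\<^bsub>K\<^esub>" ev pts
proof
  show "L a \<subseteq> L b" if "a \<le> b" for a b using L_mono[OF that] .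
  show "f \<otimes>\<^bsub>K\<^esub> h \<in> L (a + b)" if "f \<in> L a" "h \<in> L b" for f h a b using L_mult[OF that] .
  show "f \<otimes>\<^bsub>K\<^esub> h \<notin> L (a + b - 1)"
    if f: "f \<in> L a" "f \<notin> L (a - 1)" and h: "h \<in> L b" "h \<notin> L (b - 1)" for f h a b
  proof -
    have "f \<noteq> \<zero>\<^bsub>K\<^esub>" "ord Q0 f = - a" "h \<noteq> \<zero>\<^bsub>K\<^esub>" "ord Q0 h = - b"
      using f h L_exact_iff by auto
    then show ?thesis
      using L_exact_iff[OF L_mult[OF f(1) h(1)]] ord_mult[OF Q0_V L_carrier[OF f(1)] _ L_carrier[OF h(1)]]
        L_carrier[OF f(1)] L_carrier[OF h(1)] by (auto simp: K.integral_iff)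
  qed
  show "lin f c h \<in> L a" if "f \<in> L a" "h \<in> L a" for f c h a using lin_L[OF that] .
  show "f \<in> L a" if "f \<in> L b" "h \<in> L a" "lin f c h \<in> L a" for f b h a c using lin_cancel[OF that] .
  show "\<exists>c. lin f c h \<in> L (a - 1)" if "f \<in> L a" "h \<in> L a" "h \<notin> L (a - 1)" for f a h
    using lin_reduce[OF that] .
  show "lin f 0 h = f" if "f \<in> L a" "h \<in> L a" for f a h
    unfolding lin_def using L_carrier[OF that(1)] L_carrier[OF that(2)] by (simp add: const_zero)
  show 1: "\<one>\<^bsub>K\<^esub> \<in> L 0" using const_L[of 1] by (simp add: const_one)
  show "\<one>\<^bsub>K\<^esub> \<notin> L (- 1)"
    using L_exact_iff[OF 1] ord_const[OF Q0_V, of 1] by (simp add: const_one)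
  fix P assume P: "P \<in> pts"
  note PV = pts_V[OF P]
  show "ev \<one>\<^bsub>K\<^esub> P = 1"
    using value_const[of P 1] PV by (simp add: const_one ev_def)
  show "\<exists>b\<le>a. f \<in> L b \<and> f \<notin> L (b - 1)" if f: "f \<in> L a" and nz: "ev f P \<noteq> 0" for f a
  proof (rule L_exact_order[OF f])
    show "f \<noteq> \<zero>\<^bsub>K\<^esub>"
    proof
      assume "f = \<zero>\<^bsub>K\<^esub>"
      then show False using nz value_zero[of P] PV by (simp add: ev_def)
    qed
  qed
  show "ev (f \<otimes>\<^bsub>K\<^esub> h) P = ev f P * ev h P" if f: "f \<in> L a" and h: "h \<in> L b" for f a h b
  proof -
    have "to_ac (ev (f \<otimes>\<^bsub>K\<^esub> h) P) = to_ac (ev f P * ev h P)"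
      using to_ac_ev[OF P f] to_ac_ev[OF P h] to_ac_ev[OF P L_mult[OF f h]]
        value_mult[OF _ L_local[OF f] L_local[OF h], of P] PV by simp
    then show ?thesis by (simp only: to_ac_eq_iff)
  qed
  show "ev (lin f c h) P = ev f P - c * ev h P" if f: "f \<in> L a" and h: "h \<in> L a" for f a h c
  proof -
    have "value_at (lin f c h) P = value_at f P + to_ac (- c) * value_at h P"
      unfolding lin_def
      using value_add[OF _ L_local[OF f] L_local[OF L_const_mult[OF h]], of P]
        value_mult[OF _ const_local L_local[OF h], of P] value_const[of P] PV by simp
    then have "to_ac (ev (lin f c h) P) = to_ac (ev f P - c * ev h P)"
      using to_ac_ev[OF P f] to_ac_ev[OF P h] to_ac_ev[OF P lin_L[OF f h]] by simp
    then show ?thesis by (simp only: to_ac_eq_iff)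
  qed
qed

end

section \<open>Frobenius\<close>

text \<open>Multiplication by \<open>a \<noteq> 0\<close> permutes the nonzero elements; comparing
  their products gives \<open>a ^ (q - 1) = 1\<close>.\<close>

lemma finite_field_power_card:
  fixes a :: "'k::{field,finite}"
  shows "a ^ CARD('k) = a"
proof (cases "a = 0")
  case False
  let ?U = "UNIV - {0 :: 'k}"
  have "bij_betw ((*) a) ?U ?U"
    using False by (intro bij_betw_byWitness[where f' = "\<lambda>x. x / a"]) auto
  then have "(\<Prod>x\<in>?U. a * x) = \<Prod>?U"
    using prod.reindex_bij_betw[of "(*) a" ?U ?U "\<lambda>x. x"] by simp
  then have "a ^ card ?U * \<Prod>?U = \<Prod>?U" by (simp add: prod.distrib)
  then have "a ^ card ?U = 1" by (auto simp: prod_zero_iff)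
  moreover have "CARD('k) = Suc (card ?U)" by (rule card_Suc_Diff1[symmetric]) auto
  ultimately show ?thesis by (simp only: power_Suc mult_1_right)
qed (simp add: power_0_left)

text \<open>Both sides are monic of degree \<open>q\<close> in \<open>y\<close> and vanish on the
  base field, so their difference has degree below \<open>q\<close> and \<open>q\<close>
  roots.\<close>

lemma alg_closure_power_card_diff:
  fixes y :: "'k::{field,finite} alg_closure"
  shows "y ^ CARD('k) - y = (\<Prod>a::'k\<in>UNIV. y - to_ac a)"
proof -
  let ?q = "CARD('k)"
  define f where "f = (\<Prod>a::'k\<in>UNIV. [:- to_ac a, 1:])"
  define p where "p = Polynomial.monom 1 ?q - [:0, 1:] - f"
  have q: "1 < ?q"
  proof -
    have "card {0, 1 :: 'k} \<le> ?q" by (intro card_mono) auto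
    then show ?thesis by simp
  qed
  have deg_f: "Polynomial.degree f = ?q"
    unfolding f_def by (subst degree_prod_eq_sum_degree) auto
  have "lead_coeff f = 1" unfolding f_def by (simp add: lead_coeff_prod)
  then have coeff_f: "Polynomial.coeff f ?q = 1" by (simp add: deg_f)
  have "Polynomial.degree p \<le> ?q"
    unfolding p_def using q deg_f by (intro degree_diff_le) (auto intro: degree_monom_le)
  moreover have "Polynomial.coeff p ?q = 0"
    unfolding p_def using q coeff_f by (simp add: coeff_pCons split: nat.splits)
  ultimately have deg: "p = 0 \<or> Polynomial.degree p < ?q"
    by (metis le_neq_implies_less leading_coeff_0_iff)
  have roots: "Polynomial.poly p (to_ac a) = 0" for a
    using finite_field_power_card[of a]
    by (auto simp: p_def f_def poly_monom poly_prod simp flip: to_ac_power)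
  have "p = 0"
  proof (rule ccontr)
    assume p: "p \<noteq> 0"
    have "card (range (to_ac :: 'k \<Rightarrow> _)) \<le> card {x. Polynomial.poly p x = 0}"
      using roots poly_roots_finite[OF p] by (intro card_mono) auto
    also have "\<dots> \<le> Polynomial.degree p" by (rule card_poly_roots_bound[OF p])
    finally have "card (range (to_ac :: 'k \<Rightarrow> _)) \<le> Polynomial.degree p" .
    moreover have "card (range (to_ac :: 'k \<Rightarrow> _)) = CARD('k)" by (rule card_image[OF inj_to_ac])
    ultimately show False using deg p by simp
  qed
  then have "Polynomial.poly p y = 0" by simp
  then show ?thesis by (simp add: p_def f_def poly_monom poly_prod)
qed

text \<open>
  The product over the base field is invariant under \<open>y \<mapsto> y - 1\<close>, so \<open>(y - 1) ^ q = y ^ q - 1\<close>.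
\<close>

lemma alg_closure_power_card_eq_one:
  fixes y :: "'k::{field,finite} alg_closure"
  assumes "y ^ CARD('k) = 1" shows "y = 1"
proof -
  have "(\<Prod>a::'k\<in>UNIV. (y - 1) - to_ac a) = (\<Prod>a::'k\<in>UNIV. y - to_ac (a + 1))"
    by (simp add: algebra_simps)
  also have "\<dots> = (\<Prod>a::'k\<in>UNIV. y - to_ac a)"
    by (rule prod.reindex_bij_betw[where h = "\<lambda>a. a + 1"])
      (intro bij_betw_byWitness[where f' = "\<lambda>a. a - 1"], auto)
  finally have "(y - 1) ^ CARD('k) - (y - 1) = y ^ CARD('k) - y"
    by (simp only: alg_closure_power_card_diff)
  then show ?thesis using assms by simp
qed

text \<open>Invariance of the divisor \<open>s Q\<close> needs that \<open>Q\<close> is fixed and is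
  also its only preimage. For a preimage with coordinates \<open>v\<close>,
  \<open>v i ^ q = c w i\<close>; with \<open>d ^ q = c\<close> the quotient of \<open>v i\<close>
  by \<open>d w i\<close> has \<open>q\<close>-th power one, hence is one.\<close>

lemma frobenius_eq_iff:
  fixes P Q :: "('i, 'k::{field,finite}) point"
  assumes P: "P \<in> proj_space" and Q: "Q = proj_point (\<lambda>i. to_ac (w i))"
  shows "frobenius P = Q \<longleftrightarrow> P = Q"
proof
  let ?q = "CARD('k)"
  assume F: "frobenius P = Q"
  obtain v where v: "v \<in> P" using proj_space_nonempty[OF P] by blast
  then have "(\<lambda>i. v i ^ ?q) \<in> Q" unfolding F[symmetric] frobenius_def by blast
  then obtain c where c: "c \<noteq> 0" "\<And>i. v i ^ ?q = c * to_ac (w i)"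
    unfolding Q by (auto simp: proj_point_def fun_eq_iff)
  obtain d where d: "d ^ ?q = c" using nth_root_exists[of ?q c] by auto
  then have d0: "d \<noteq> 0" using c(1) by (auto simp: power_0_left)
  have "v i = d * to_ac (w i)" for i
  proof (cases "w i = 0")
    case True
    then show ?thesis using c(2)[of i] by simp
  next
    case False
    have "to_ac (w i) ^ ?q = to_ac (w i)"
      using finite_field_power_card[of "w i"] by (simp flip: to_ac_power)
    then have "(v i / (d * to_ac (w i))) ^ ?q = 1"
      using False c d by (simp add: power_divide power_mult_distrib)
    then show ?thesis using alg_closure_power_card_eq_one[of "v i / (d * to_ac (w i))"] False d0 by simp
  qed
  then have "v \<in> Q" unfolding Q proj_point_def using d0 by blast
  moreover have "Q \<in> proj_space"
  proof -
    obtain i where "v i \<noteq> 0"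
    proof -
      obtain u b where "P = proj_point u" "u \<noteq> (\<lambda>_. 0)" "b \<noteq> 0" "v = (\<lambda>i. b * u i)"
        using P v by (auto simp: proj_space_def proj_point_def)
      then show thesis using that by (auto simp: fun_eq_iff)
    qed
    then have "(\<lambda>i. to_ac (w i)) \<noteq> (\<lambda>_. 0)"
      using \<open>\<And>i. v i = d * to_ac (w i)\<close> by (auto simp: fun_eq_iff)
    then show ?thesis unfolding Q proj_space_def by blast
  qed
  ultimately show "P = Q" using proj_space_eq[OF P v] proj_space_eq by metis
next
  let ?q = "CARD('k)"
  assume PQ: "P = Q"
  have wq: "to_ac (w i) ^ ?q = to_ac (w i)" for i
    using finite_field_power_card[of "w i"] by (simp flip: to_ac_power)
  show "frobenius P = Q"
    unfolding PQ
  proof (intro equalityI subsetI)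
    fix v assume "v \<in> frobenius Q"
    then obtain c where c: "c \<noteq> 0" "v = (\<lambda>i. (c * to_ac (w i)) ^ ?q)"
      unfolding frobenius_def Q proj_point_def by blast
    then have "v = (\<lambda>i. c ^ ?q * to_ac (w i))" by (simp add: power_mult_distrib wq)
    moreover have "c ^ ?q \<noteq> 0" using c(1) by simp
    ultimately show "v \<in> Q" unfolding Q proj_point_def by blast
  next
    fix v assume "v \<in> Q"
    then obtain c where c: "c \<noteq> 0" "v = (\<lambda>i. c * to_ac (w i))" unfolding Q proj_point_def by blast
    obtain d where d: "d ^ ?q = c" using nth_root_exists[of ?q c] by auto
    then have d0: "d \<noteq> 0" using c(1) by (auto simp: power_0_left)
    have "v = (\<lambda>i. (d * to_ac (w i)) ^ ?q)" using c(2) d by (simp add: power_mult_distrib wq)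
    moreover have "(\<lambda>i. d * to_ac (w i)) \<in> Q" unfolding Q proj_point_def using d0 by blast
    ultimately show "v \<in> frobenius Q"
      unfolding frobenius_def by (intro image_eqI[where x = "\<lambda>i. d * to_ac (w i)"])
  qed
qed

section \<open>Gaps, genus and the main theorem\<close>

context smooth_curve
begin

lemma L_line_extension:
  assumes h: "h \<in> L a" "h \<notin> L (a - 1)"
  shows "K.line_extension (constants V) h (L (a - 1)) = L a"
proof (intro equalityI subsetI)
  fix f assume "f \<in> K.line_extension (constants V) h (L (a - 1))"
  then obtain c e where ce: "e \<in> L (a - 1)" "f = const c \<otimes>\<^bsub>K\<^esub> h \<oplus>\<^bsub>K\<^esub> e"
    by (auto simp: K.line_extension_def set_add_def' r_coset_def constants_eq)
  then show "f \<in> L a" using L_mono[of "a - 1" a] L_add[OF L_const_mult[OF h(1)]] by auto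
next
  fix f assume f: "f \<in> L a"
  obtain c where c: "lin f c h \<in> L (a - 1)" using lin_reduce[OF f h] by blast
  note cc = L_carrier[OF f] L_carrier[OF h(1)]
  have "const c \<otimes>\<^bsub>K\<^esub> h \<oplus>\<^bsub>K\<^esub> lin f c h
      = f \<oplus>\<^bsub>K\<^esub> ((const c \<oplus>\<^bsub>K\<^esub> const (- c)) \<otimes>\<^bsub>K\<^esub> h)"
    unfolding lin_def using cc by (simp only: K.l_distr const_carrier K.a_ac K.m_closed K.a_closed)
  also have "\<dots> = f" using cc by (simp add: const_add const_zero)
  finally have "f = const c \<otimes>\<^bsub>K\<^esub> h \<oplus>\<^bsub>K\<^esub> lin f c h" by simp
  then show "f \<in> K.line_extension (constants V) h (L (a - 1))"
    using c unfolding K.line_extension_def set_add_def' r_coset_def constants_eq by blast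
qed

text \<open>Each order adds exactly one line to the space, other steps add nothing, and
  \<open>neg\<close> makes the count start at dimension zero.\<close>

lemma L_dimension:
  assumes neg: "L (- 1) = {\<zero>\<^bsub>K\<^esub>}"
  shows "K.dimension (card (F.orders \<inter> {..s})) (constants V) (L (int s))"
proof (induction s)
  case 0
  have o: "\<one>\<^bsub>K\<^esub> \<in> L 0" "\<one>\<^bsub>K\<^esub> \<notin> L (0 - 1)" using F.one_L by auto
  have "K.dimension (Suc 0) (constants V) (K.line_extension (constants V) \<one>\<^bsub>K\<^esub> (L (0 - 1)))"
    using o neg by (intro K.Suc_dim) auto
  moreover have "F.orders \<inter> {..0} = {0}" using F.orders_zero by auto
  ultimately show ?case unfolding L_line_extension[OF o] by simp
next
  case (Suc s)
  have i: "int (Suc s) - 1 = int s" by simp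
  show ?case
  proof (cases "Suc s \<in> F.orders")
    case True
    then obtain h where "F.exact (int (Suc s)) h" by (auto simp: F.orders_def)
    then have h: "h \<in> L (int (Suc s))" "h \<notin> L (int (Suc s) - 1)" by (auto simp: F.exact_def)
    have "F.orders \<inter> {..Suc s} = insert (Suc s) (F.orders \<inter> {..s})" using True by (auto simp: le_Suc_eq)
    then have "card (F.orders \<inter> {..Suc s}) = Suc (card (F.orders \<inter> {..s}))" by simp
    moreover have "K.dimension (Suc (card (F.orders \<inter> {..s}))) (constants V)
        (K.line_extension (constants V) h (L (int (Suc s) - 1)))"
      using Suc h(2) L_carrier[OF h(1)] unfolding i by (intro K.Suc_dim)
    ultimately show ?thesis unfolding L_line_extension[OF h] by simp
  next
    case False
    then have "F.orders \<inter> {..Suc s} = F.orders \<inter> {..s}" by (auto simp: le_Suc_eq)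
    moreover have "L (int (Suc s)) \<subseteq> L (int s)"
    proof (rule subsetI, rule ccontr)
      fix f assume "f \<in> L (int (Suc s))" "f \<notin> L (int s)"
      then have "F.exact (int (Suc s)) f" unfolding F.exact_def i by (rule conjI)
      then have "Suc s \<in> F.orders" unfolding F.orders_def by (intro CollectI exI)
      then show False using False by contradiction
    qed
    then have "L (int (Suc s)) = L (int s)" by (rule equalityI) (rule L_mono, simp)
    ultimately show ?thesis using Suc by simp
  qed
qed

lemma L_space_eq: "L_space V Q0 s = L (int s)"
  unfolding L_space_def riemann_roch_space_def L_def ord_def by simp

lemma weierstrass_semigroup_eq: "weierstrass_semigroup V Q0 = F.orders"
proof -
  have "s \<in> F.orders \<longleftrightarrow> L (int s) \<noteq> L (int s - 1)" for s
    using L_mono[of "int s - 1" "int s"] by (auto simp: F.orders_def F.exact_def)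
  then show ?thesis
    using F.orders_zero by (auto simp: weierstrass_semigroup_def L_space_eq of_nat_diff)
qed

lemma one_point_code_eq:
  assumes "set Ps \<subseteq> pts" shows "one_point_code V Q0 Ps s = F.code Ps s"
proof (intro equalityI subsetI)
  have Ps: "Ps ! j \<in> pts" if "j < length Ps" for j using that assms by auto
  {
    fix c assume "c \<in> one_point_code V Q0 Ps s"
    then obtain f where f: "f \<in> L (int s)" and c: "c \<in> carrier_vec (length Ps)"
      "\<And>j. j < length Ps \<Longrightarrow> to_ac (c $ j) = value_at f (Ps ! j)"
      by (auto simp: one_point_code_def L_space_eq)
    have "c $ j = ev f (Ps ! j)" if "j < length Ps" for j
      using trans[OF c(2)[OF that] to_ac_ev[OF Ps[OF that] f, symmetric]] by (simp only: to_ac_eq_iff)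
    then have "c = F.evals Ps f" using c(1) by (auto simp: F.evals_def)
    then show "c \<in> F.code Ps s" using f by (auto simp: F.code_def)
  }
  fix c assume "c \<in> F.code Ps s"
  then obtain f where f: "f \<in> L (int s)" "c = F.evals Ps f" by (auto simp: F.code_def)
  then show "c \<in> one_point_code V Q0 Ps s"
    using to_ac_ev[OF Ps f(1)] by (auto simp: one_point_code_def L_space_eq F.evals_def intro!: bexI[of _ f])
qed

lemma code_jumps_eq: "set Ps \<subseteq> pts \<Longrightarrow> code_jumps V Q0 Ps = F.jumps Ps"
  by (simp add: code_jumps_def F.jumps_def one_point_code_eq)

lemma code_sequence_eq: "set Ps \<subseteq> pts \<Longrightarrow> code_sequence V Q0 Ps m = F.flag Ps m"
  by (simp add: code_sequence_def F.flag_def one_point_code_eq fun_eq_iff)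

end

section \<open>From the geometric hypotheses to the abstract flags\<close>

lemma (in smooth_curve) isometry_dual_flagI:
  assumes "set Ps \<subseteq> pts" "length Ps = n" "2 \<le> n" "strict_mono_on {1..n} m"
    "m ` {1..n} = code_jumps V Q0 Ps" "isometry_dual n (code_sequence V Q0 Ps m)"
  obtains x where "isometry_dual_flag L (\<lambda>f h. f \<otimes>\<^bsub>K\<^esub> h) lin \<one>\<^bsub>K\<^esub> ev pts Ps n m x"
proof -
  obtain x :: "'k vec" where x: "x \<in> carrier_vec n" "\<forall>j<n. x $ j \<noteq> 0"
    "\<forall>i\<le>n. isometric_by x (F.flag Ps m i) (dual_code n (F.flag Ps m (n - i)))"
    using assms(6) unfolding isometry_dual_def code_sequence_eq[OF assms(1)] by blast
  have "isometry_dual_flag L (\<lambda>f h. f \<otimes>\<^bsub>K\<^esub> h) lin \<one>\<^bsub>K\<^esub> ev pts Ps n m x"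
    using assms(1-5) x code_jumps_eq[OF assms(1)] by unfold_locales auto
  then show thesis by (rule that)
qed

lemma divisor_multiple_rational_point:
  fixes V :: "('i::finite, 'k::{field,finite}) point set"
  assumes V: "V \<subseteq> proj_space" and Q: "Q \<in> rational_points V"
  shows "divisor V (\<lambda>P. if P = Q then int s else 0)"
    "divisor_degree (\<lambda>P. if P = Q then int s else 0) = int s"
proof -
  obtain w where w: "Q \<in> V" "Q = proj_point (\<lambda>i. to_ac (w i))"
    using Q by (auto simp: rational_points_def)
  have "{P. (if P = Q then int s else 0) \<noteq> 0} = (if s = 0 then {} else {Q})" by auto
  moreover have "frobenius P = Q \<longleftrightarrow> P = Q" if "P \<in> V" for P
    using frobenius_eq_iff[OF _ w(2)] that V by blast
  ultimately show "divisor V (\<lambda>P. if P = Q then int s else 0)"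
    "divisor_degree (\<lambda>P. if P = Q then int s else 0) = int s"
    using w(1) by (auto simp: divisor_def divisor_degree_def)
qed

text \<open>In dimension one regularity supplies a one-element generating set of the maximal ideal,
  that is, a uniformizer.\<close>

lemma smooth_curveI:
  fixes V :: "('i::finite, 'k::field) point set"
  assumes "nonsingular_projective_curve V" "Q \<in> rational_points V" "R \<in> rational_points V" "Q \<noteq> R"
  shows "smooth_curve V Q R"
proof -
  interpret irred_variety V
    using assms(1) by (intro irred_varietyI) (auto simp: nonsingular_projective_curve_def)
  show ?thesis
  proof
    fix P assume "P \<in> V"
    then obtain B where B: "finite B" "enat (card B) = 1" "B \<subseteq> carrier (local_ring V P)"
      "max_ideal V P = Idl\<^bsub>local_ring V P\<^esub> B"
      using assms(1) by (fastforce simp: nonsingular_projective_curve_def nonsingular_def)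
    then have "card B = 1" by (simp add: one_enat_def)
    then obtain t where "B = {t}" by (rule card_1_singletonE)
    then show "\<exists>t. uniformizer V P t" using B unfolding uniformizer_def by blast
  qed (use assms in auto)
qed

text \<open>For \<open>D = s Q\<close> the number \<open>deg D + 1 - l(D)\<close> is the number of
  gaps up to \<open>s\<close>, and the genus bounds it. A bound uniform in \<open>s\<close> gives
  finiteness.\<close>

lemma card_gaps_le_genus:
  fixes V :: "('i::finite, 'k::{field,finite}) point set"
  assumes "smooth_curve V Q R" and genus: "has_genus V g"
    and neg: "smooth_curve.L V Q (- 1) = {\<zero>\<^bsub>function_field V\<^esub>}"
  shows "finite (- weierstrass_semigroup V Q) \<and> card (- weierstrass_semigroup V Q) \<le> g"
proof -
  interpret smooth_curve V Q R by fact
  have bound: "card (- F.orders \<inter> {..s}) \<le> g" for s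
  proof -
    let ?D = "\<lambda>P. if P = Q then int s else 0" and ?l = "card (F.orders \<inter> {..s})"
    have "K.dimension ?l (constants V) (riemann_roch_space V ?D)"
      using L_dimension[OF neg, of s] unfolding L_space_eq[symmetric] L_space_def .
    then have "divisor_degree ?D + 1 - int ?l \<le> int g"
      using genus divisor_multiple_rational_point(1)[OF V_proj rational(1), of s]
      unfolding has_genus_def Let_def by blast
    then have 1: "int s + 1 - int ?l \<le> int g"
      using divisor_multiple_rational_point(2)[OF V_proj rational(1), of s] by simp
    have "card (F.orders \<inter> {..s} \<union> - F.orders \<inter> {..s}) = ?l + card (- F.orders \<inter> {..s})"
      by (rule card_Un_disjoint) auto
    moreover have "F.orders \<inter> {..s} \<union> - F.orders \<inter> {..s} = {..s}" by auto
    ultimately show ?thesis using 1 by simp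
  qed
  have "finite (- F.orders) \<and> card (- F.orders) \<le> g"
  proof (rule finite_if_finite_subsets_card_bdd)
    fix G assume G: "G \<subseteq> - F.orders" "finite G"
    then obtain s where "G \<subseteq> {..s}" using finite_nat_iff_bounded_le by blast
    then have "card G \<le> card (- F.orders \<inter> {..s})" using G by (intro card_mono) auto
    then show "card G \<le> g" using bound[of s] by simp
  qed
  then show ?thesis by (simp add: weierstrass_semigroup_eq)
qed

theorem theorem2:
  fixes V :: "('i::finite, 'k::{field,finite}) point set"
    and Ps Ps' :: "('i, 'k) point list"
    and Q :: "('i, 'k) point"
    and g n n' :: nat
    and m m' :: "nat \<Rightarrow> nat"
  assumes curve: "nonsingular_projective_curve V" "has_genus V g"
    and points: "distinct Ps" "length Ps = n" "set Ps \<subseteq> rational_points V"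
      "Q \<in> rational_points V" "Q \<notin> set Ps"
    and jumps: "strict_mono_on {1..n} m" "m ` {1..n} = code_jumps V Q Ps"
    and dual: "isometry_dual n (code_sequence V Q Ps m)"
    and subset: "distinct Ps'" "length Ps' = n'" "set Ps' \<subseteq> set Ps"
    and size: "2 * g + 2 < n'" "n' < n"
    and jumps': "strict_mono_on {1..n'} m'" "m' ` {1..n'} = code_jumps V Q Ps'"
    and dual': "isometry_dual n' (code_sequence V Q Ps' m')"
  shows "n - n' \<in> weierstrass_semigroup V Q"
proof -
  \<comment> \<open>An evaluation point serves as the second rational point of
    \<open>smooth_curve\<close>.\<close>
  have "Ps ! 0 \<in> set Ps" using points(2) size by (intro nth_mem) simp
  then have R: "Ps ! 0 \<in> rational_points V" "Q \<noteq> Ps ! 0" using points(3,5) by auto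
  have sc: "smooth_curve V Q (Ps ! 0)" by (rule smooth_curveI[OF curve(1) points(4) R])
  interpret smooth_curve V Q "Ps ! 0" by (rule sc)
  have pts: "set Ps \<subseteq> pts" "set Ps' \<subseteq> pts" using points(3,5) subset(3) by (auto simp: pts_def)
  obtain x where x: "isometry_dual_flag L (\<lambda>f h. f \<otimes>\<^bsub>K\<^esub> h) lin \<one>\<^bsub>K\<^esub> ev pts Ps n m x"
    using isometry_dual_flagI[OF pts(1) points(2) _ jumps dual] size by auto
  obtain x' where x': "isometry_dual_flag L (\<lambda>f h. f \<otimes>\<^bsub>K\<^esub> h) lin \<one>\<^bsub>K\<^esub> ev pts Ps' n' m' x'"
    using isometry_dual_flagI[OF pts(2) subset(2) _ jumps' dual'] size by auto
  interpret C: isometry_dual_flag L "\<lambda>f h. f \<otimes>\<^bsub>K\<^esub> h" lin "\<one>\<^bsub>K\<^esub>" ev pts Ps n m x by (rule x)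
  interpret C': isometry_dual_flag L "\<lambda>f h. f \<otimes>\<^bsub>K\<^esub> h" lin "\<one>\<^bsub>K\<^esub>" ev pts Ps' n' m' x' by (rule x')
  \<comment> \<open>A nonzero function here would have an exact negative order, against
    \<open>exact_nonneg\<close>. This has to precede any use of the genus, because the dimension
    count starts at \<open>L (- 1)\<close>.\<close>
  have "L (- 1) \<subseteq> {\<zero>\<^bsub>K\<^esub>}"
  proof
    fix f assume f: "f \<in> L (- 1)"
    show "f \<in> {\<zero>\<^bsub>K\<^esub>}"
    proof (rule ccontr)
      assume "f \<notin> {\<zero>\<^bsub>K\<^esub>}"
      then obtain b where "b \<le> - 1" "F.exact b f"
        using L_exact_order[OF f] unfolding F.exact_def by blast
      then show False using C.exact_nonneg by force
    qed
  qed
  then have neg: "L (- 1) = {\<zero>\<^bsub>K\<^esub>}" using zero_L by blast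
  have gaps: "finite (- F.orders)" "card (- F.orders) \<le> g"
    using card_gaps_le_genus[OF sc curve(2) neg] by (auto simp: weierstrass_semigroup_eq)
  have "n - n' \<in> F.orders"
  proof (rule isometry_dual_subflag)
    show "finite_gap_flag L (\<lambda>f h. f \<otimes>\<^bsub>K\<^esub> h) lin \<one>\<^bsub>K\<^esub> ev pts Ps n m x"
      by unfold_locales (rule gaps)
    show "finite_gap_flag L (\<lambda>f h. f \<otimes>\<^bsub>K\<^esub> h) lin \<one>\<^bsub>K\<^esub> ev pts Ps' n' m' x'"
      by unfold_locales (rule gaps)
    \<comment> \<open>The number of gaps is at most \<open>g\<close>, so the size hypothesis in
      terms of the genus yields the one in terms of gaps.\<close>
    show "2 * card (- F.orders) + 2 \<le> n'" using gaps(2) size by simp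
  qed (use points subset size in auto)
  then show ?thesis by (simp add: weierstrass_semigroup_eq)
qed

end
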